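(* There exist positive constants $\gamma_1,\gamma_2,\gamma_3,\gamma_4$, independent of $c,\alpha,\delta$ (and of $f,w,\nu$), such that the following holds. Let $c>0$, $\alpha\in(0,1)$, $\delta\in(0,1)$, let $f,w\in L^2([-1,1])$ with $\|\mathcal{F}_c[f]-w\|_{L^2([-1,1])}\le\delta$, and suppose that $f\in\mathcal{H}^\nu([-1,1])$ with $\nu>0$. Put $\rho=\frac{4}{ec}\alpha\log(\delta^{-1})$ and let $n^*=n^*(c,\alpha,\delta)$ be as defined in the context. Then $$\|f-\mathcal{F}_{n^*,c}^{-1}[w]\|_{L^2([-1,1])}\le\gamma_1c^{-\gamma_2}(1+c)^{\gamma_3}(1+\rho)^{\gamma_4}\exp\left(\frac{\pi^2c\log(1+\rho)}{2e\rho}\right)\delta^{1-\alpha}+C(1+c^2)^{\nu/2}\|f\|_{\mathcal{H}^\nu([-1,1])}\left(2+\frac{ec}{4}\cdot\frac{\rho}{\log(1+\rho)}\right)^{-\nu},$$ where $C$ is the constant of the embedding inequality (EMB) stated in the context.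
   Context: $\mathbb{N}=\{0,1,\ldots\}$; $e$ is Euler's number. For $c>0$, the compact operator $\mathcal{F}_c$ on $L^2([-1,1])$ is $\mathcal{F}_c[f](x):=\int_{-1}^1e^{icxy}f(y)\,dy$. Its eigenfunctions $(\psi_{j,c})_{j\in\mathbb{N}}$ (prolate spheroidal wave functions) are real-valued and form an orthonormal basis of $L^2([-1,1])$; the corresponding eigenvalues $(\mu_{j,c})_{j\in\mathbb{N}}$ are simple and non-zero, ordered so that $0<|\mu_{j+1,c}|<|\mu_{j,c}|$. For $n\in\mathbb{N}$, $\mathcal{F}_{n,c}^{-1}[w](y):=\sum_{j=0}^n\frac{1}{\mu_{j,c}}\psi_{j,c}(y)\int_{-1}^1\psi_{j,c}(x)w(x)\,dx$. For $\alpha,\delta\in(0,1)$, $n^*=n^*(c,\alpha,\delta):=\left\lfloor3+\tau\frac{ec}{4}\right\rfloor$, where $\tau=\tau(c,\alpha,\delta)\ge1$ is the solution of $\tau\log\tau=\frac{4}{ec}\alpha\log(\delta^{-1})$. The functions $\psi_{n,c}$ are also the eigenfunctions of $\mathcal{L}_c[\psi]:=-\frac{d}{dx}\left[(1-x^2)\frac{d\psi}{dx}\right]+c^2x^2\psi$, $\psi\in C^2([-1,1])$, with real, positive, simple eigenvalues $0<\chi_{0,c}<\chi_{1,c}<\cdots$: $\mathcal{L}_c\psi_{n,c}=\chi_{n,c}\psi_{n,c}$. For $\nu\ge0$ set $\|f\|_{\widetilde{\mathcal{H}}^\nu_c([-1,1])}:=\left(\sum_{n\in\mathbb{N}}(\chi_{n,c})^\nu\left|\int_{-1}^1\psi_{n,c}(y)f(y)\,dy\right|^2\right)^{1/2}$.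 $\mathcal{H}^\nu([-1,1])$ denotes the standard ($L^2$-based) Sobolev space on the interval. It is known that $\mathcal{H}^\nu([-1,1])$ embeds in $\widetilde{\mathcal{H}}^\nu_c([-1,1])$ with $$\text{(EMB)}\qquad \|f\|_{\widetilde{\mathcal{H}}^\nu_c([-1,1])}\le C(1+c^2)^{\nu/2}\|f\|_{\mathcal{H}^\nu([-1,1])},$$ where $C$ is a constant independent of $c$ and $f$ provided $c\ge c_0>0$ (so $C=C(c_0,\nu)$); $C$ in the claim is this constant. *)

theory Defs
  imports "HOL-Analysis.Analysis"
begin

text \<open>Elements of $L^2([-1,1])$ are represented by functions on the real line; only the
  values on $[-1,1]$ (up to null sets) matter.\<close>

abbreviation leb_I :: "real measure" where
  "leb_I \<equiv> lebesgue_on {-1..1}"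

definition L2_I :: "(real \<Rightarrow> complex) set" where
  "L2_I = {f \<in> borel_measurable leb_I. integrable leb_I (\<lambda>x. (cmod (f x))\<^sup>2)}"

definition L2_norm :: "(real \<Rightarrow> complex) \<Rightarrow> real" where
  "L2_norm f = sqrt (\<integral>x. (cmod (f x))\<^sup>2 \<partial>leb_I)"

definition pairing :: "(real \<Rightarrow> real) \<Rightarrow> (real \<Rightarrow> complex) \<Rightarrow> complex" where
  "pairing \<psi> f = (\<integral>x. of_real (\<psi> x) * f x \<partial>leb_I)"

definition fourier_op :: "real \<Rightarrow> (real \<Rightarrow> complex) \<Rightarrow> real \<Rightarrow> complex" where
  "fourier_op c f x = (\<integral>y. exp (\<i> * of_real (c * x * y)) * f y \<partial>leb_I)"

definition C2_I :: "(real \<Rightarrow> real) \<Rightarrow> bool" where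
  "C2_I \<psi> \<longleftrightarrow> (\<exists>\<psi>1 \<psi>2.
     (\<forall>x\<in>{-1..1}. (\<psi> has_real_derivative \<psi>1 x) (at x within {-1..1})) \<and>
     (\<forall>x\<in>{-1..1}. (\<psi>1 has_real_derivative \<psi>2 x) (at x within {-1..1})) \<and>
     continuous_on {-1..1} \<psi>2)"

definition prolate_op :: "real \<Rightarrow> (real \<Rightarrow> real) \<Rightarrow> real \<Rightarrow> real" where
  "prolate_op c \<psi> x =
     - vector_derivative (\<lambda>t. (1 - t\<^sup>2) * vector_derivative \<psi> (at t within {-1..1}))
         (at x within {-1..1})
     + c\<^sup>2 * x\<^sup>2 * \<psi> x"

definition orthonormal_basis_I :: "(nat \<Rightarrow> real \<Rightarrow> real) \<Rightarrow> bool" where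
  "orthonormal_basis_I \<psi> \<longleftrightarrow>
     (\<forall>j. (\<lambda>x. of_real (\<psi> j x)) \<in> L2_I) \<and>
     (\<forall>i j. pairing (\<psi> i) (\<lambda>x. of_real (\<psi> j x)) = (if i = j then 1 else 0)) \<and>
     (\<forall>f\<in>L2_I. (\<lambda>N. L2_norm (\<lambda>x. f x - (\<Sum>j<N. pairing (\<psi> j) f * of_real (\<psi> j x))))
        \<longlonglongrightarrow> 0)"

text \<open>The prolate spheroidal wave functions for the bandwidth $c$, in their $C^2$
  representatives, with the eigenvalues of both operators. Together these conditions determine
  \<open>\<mu>\<close> and \<open>chi\<close> uniquely and each \<open>\<psi> j\<close> up to sign on $[-1,1]$. Since \<open>\<psi>\<close> is a basis and the
  eigenvalues are strictly ordered, all eigenvalues of \<open>fourier_op c\<close> occur and are simple.\<close>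

definition pswf_system ::
    "real \<Rightarrow> (nat \<Rightarrow> real \<Rightarrow> real) \<Rightarrow> (nat \<Rightarrow> complex) \<Rightarrow> (nat \<Rightarrow> real) \<Rightarrow> bool" where
  "pswf_system c \<psi> \<mu> chi \<longleftrightarrow>
     orthonormal_basis_I \<psi> \<and>
     (\<forall>j. \<forall>x\<in>{-1..1}. fourier_op c (\<lambda>y. of_real (\<psi> j y)) x = \<mu> j * of_real (\<psi> j x)) \<and>
     (\<forall>j. 0 < cmod (\<mu> (Suc j)) \<and> cmod (\<mu> (Suc j)) < cmod (\<mu> j)) \<and>
     (\<forall>j. C2_I (\<psi> j)) \<and>
     (\<forall>j. \<forall>x\<in>{-1..1}. prolate_op c (\<psi> j) x = chi j * \<psi> j x) \<and>
     0 < chi 0 \<and> (\<forall>j. chi j < chi (Suc j))"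

definition truncated_inverse ::
    "(nat \<Rightarrow> real \<Rightarrow> real) \<Rightarrow> (nat \<Rightarrow> complex) \<Rightarrow> nat \<Rightarrow> (real \<Rightarrow> complex) \<Rightarrow> real \<Rightarrow> complex" where
  "truncated_inverse \<psi> \<mu> n w y = (\<Sum>j\<le>n. 1 / \<mu> j * of_real (\<psi> j y) * pairing (\<psi> j) w)"

definition tau :: "real \<Rightarrow> real \<Rightarrow> real \<Rightarrow> real" where
  "tau c \<alpha> \<delta> = (THE \<tau>. 1 \<le> \<tau> \<and> \<tau> * ln \<tau> = 4 / (exp 1 * c) * \<alpha> * ln (inverse \<delta>))"

definition n_star :: "real \<Rightarrow> real \<Rightarrow> real \<Rightarrow> nat" where
  "n_star c \<alpha> \<delta> = nat \<lfloor>3 + tau c \<alpha> \<delta> * (exp 1 * c / 4)\<rfloor>"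

definition Htilde ::
    "(nat \<Rightarrow> real \<Rightarrow> real) \<Rightarrow> (nat \<Rightarrow> real) \<Rightarrow> real \<Rightarrow> (real \<Rightarrow> complex) set" where
  "Htilde \<psi> chi \<nu> = {f \<in> L2_I. summable (\<lambda>n. chi n powr \<nu> * (cmod (pairing (\<psi> n) f))\<^sup>2)}"

definition Htilde_norm ::
    "(nat \<Rightarrow> real \<Rightarrow> real) \<Rightarrow> (nat \<Rightarrow> real) \<Rightarrow> real \<Rightarrow> (real \<Rightarrow> complex) \<Rightarrow> real" where
  "Htilde_norm \<psi> chi \<nu> f = sqrt (\<Sum>n. chi n powr \<nu> * (cmod (pairing (\<psi> n) f))\<^sup>2)"

text \<open>The Sobolev space of real order on the interval, with the Sobolev--Slobodeckij norm:
  weak derivatives up to order $\lfloor\nu\rfloor$ in $L^2$ and, for non-integer $\nu$, a finite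
  Gagliardo seminorm of the highest one with exponent $\nu-\lfloor\nu\rfloor$.\<close>

definition test_function :: "(real \<Rightarrow> real) \<Rightarrow> bool" where
  "test_function \<phi> \<longleftrightarrow>
     (\<forall>k x. ((deriv ^^ k) \<phi>) differentiable (at x)) \<and>
     (\<exists>a b. -1 < a \<and> b < 1 \<and> (\<forall>x. x \<notin> {a..b} \<longrightarrow> \<phi> x = 0))"

definition is_weak_deriv :: "nat \<Rightarrow> (real \<Rightarrow> complex) \<Rightarrow> (real \<Rightarrow> complex) \<Rightarrow> bool" where
  "is_weak_deriv k f g \<longleftrightarrow> (\<forall>\<phi>. test_function \<phi> \<longrightarrow>
     (\<integral>x. f x * of_real ((deriv ^^ k) \<phi> x) \<partial>leb_I) =
     (-1) ^ k * (\<integral>x. g x * of_real (\<phi> x) \<partial>leb_I))"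

definition weak_deriv :: "nat \<Rightarrow> (real \<Rightarrow> complex) \<Rightarrow> real \<Rightarrow> complex" where
  "weak_deriv k f = (SOME g. g \<in> L2_I \<and> is_weak_deriv k f g)"

definition gagliardo_sq :: "real \<Rightarrow> (real \<Rightarrow> complex) \<Rightarrow> ennreal" where
  "gagliardo_sq \<sigma> g = (\<integral>\<^sup>+ z. ennreal ((cmod (g (fst z) - g (snd z)))\<^sup>2 /
     \<bar>fst z - snd z\<bar> powr (1 + 2 * \<sigma>)) \<partial>(leb_I \<Otimes>\<^sub>M leb_I))"

definition sobolev :: "real \<Rightarrow> (real \<Rightarrow> complex) set" where
  "sobolev \<nu> = {f \<in> L2_I.
     (\<forall>k \<le> nat \<lfloor>\<nu>\<rfloor>. \<exists>g\<in>L2_I. is_weak_deriv k f g) \<and>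
     (frac \<nu> > 0 \<longrightarrow> gagliardo_sq (frac \<nu>) (weak_deriv (nat \<lfloor>\<nu>\<rfloor>) f) < \<infinity>)}"

definition sobolev_norm :: "real \<Rightarrow> (real \<Rightarrow> complex) \<Rightarrow> real" where
  "sobolev_norm \<nu> f = sqrt ((\<Sum>k\<le>nat \<lfloor>\<nu>\<rfloor>. (L2_norm (weak_deriv k f))\<^sup>2) +
     (if frac \<nu> > 0 then enn2real (gagliardo_sq (frac \<nu>) (weak_deriv (nat \<lfloor>\<nu>\<rfloor>) f)) else 0))"

definition embedding_constant ::
    "(real \<Rightarrow> nat \<Rightarrow> real \<Rightarrow> real) \<Rightarrow> (real \<Rightarrow> nat \<Rightarrow> real) \<Rightarrow> real \<Rightarrow> real \<Rightarrow> real \<Rightarrow> bool" where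
  "embedding_constant \<psi> chi c0 \<nu> C \<longleftrightarrow>
     (\<forall>c\<ge>c0. \<forall>f\<in>sobolev \<nu>. f \<in> Htilde (\<psi> c) (chi c) \<nu> \<and>
        Htilde_norm (\<psi> c) (chi c) \<nu> f \<le> C * (1 + c\<^sup>2) powr (\<nu> / 2) * sobolev_norm \<nu> f)"

end

theory Submission
  imports Defs
begin

text \<open>
  The error splits orthogonally in the basis \<open>\<psi>\<close>. The coefficients of index at most \<open>n = n_star\<close>
  carry only the noise, amplified by at most \<open>1 / cmod (\<mu> n)\<close>; the others are those of \<open>f\<close>, and the
  \<open>Htilde\<close> norm bounds them by \<open>chi (n + 1) powr (- \<nu> / 2)\<close> (\<open>truncation_error\<close>, \<open>Htilde_tail\<close>). With
  \<open>N = \<tau> * exp 1 * c / 4\<close> one has \<open>N + 2 < n \<le> N + 3\<close> and \<open>\<tau> \<ge> \<rho> / ln (1 + \<rho>)\<close>, so the smoothness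
  term follows from \<open>chi n \<ge> n (n + 1)\<close> (\<open>chi_lower_bound\<close>). The noise term needs a lower bound of
  \<open>cmod (\<mu> n)\<close> of the size \<open>exp (- N ln \<tau>) = \<delta> powr \<alpha>\<close>, up to a factor \<open>exp (const * c / \<tau>)\<close>
  and polynomial factors.

  That lower bound comes from an exact relation between \<open>\<mu> n\<close> and the growth of \<open>\<psi> n\<close> outside
  \<open>[-1,1]\<close>. The function \<open>\<integral> exp (\<i> c x y) \<psi>(y) dy\<close> is \<open>\<mu> \<psi>(x)\<close> on \<open>[-1,1]\<close>, solves the
  prolate equation on the whole line because the Fourier kernel is symmetric under exchange of the
  equation in \<open>x\<close> and in \<open>y\<close>, and behaves for large \<open>x\<close> like boundary terms of size
  \<open>cmod (\<psi>(1)) / (c x)\<close>. If every solution regular at \<open>1\<close> satisfies \<open>cmod (x u(x)) \<le> G cmod (u(1))\<close>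
  for large \<open>x\<close>, then \<open>1 \<le> c G cmod \<mu>\<close> (\<open>eigenvalue_lower_bound\<close>). Here \<open>G\<close>
  depends on the differential equation alone.

  In the variable \<open>x = cosh t\<close> the solution grows up to the turning point \<open>sqrt chi / c\<close>. There the
  energy \<open>u_t\<^sup>2 + (chi - c\<^sup>2 cosh\<^sup>2 t) u\<^sup>2\<close> grows at most at the rate
  \<open>2 sqrt (chi - c\<^sup>2 cosh\<^sup>2 t)\<close>, which gives the WKB exponent without any correction
  (\<open>energy_to_turning_point\<close>); beyond it a monotone amplitude bounds the oscillation
  (\<open>amplitude_outside\<close>). Since \<open>cosh\<^sup>2 t \<ge> 1/2 + exp (2 t) / 4\<close>, the exponent is at most
  \<open>a ln (4 a / c) - a + c\<^sup>2 / (4 a)\<close> for any \<open>a\<close> with \<open>a\<^sup>2 \<ge> chi - c\<^sup>2 / 2\<close>. It is therefore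
  essential to know \<open>chi n \<le> n\<^sup>2 + c\<^sup>2 / 2\<close> up to terms of size \<open>n\<close> and \<open>c\<^sup>4 / n\<^sup>2\<close>: the trivial bound with \<open>c\<^sup>2\<close> in
  place of \<open>c\<^sup>2 / 2\<close> would cost a factor \<open>(n / c) powr (c\<^sup>2 / (4 n))\<close>. The sharp bound
  (\<open>chi_upper_bound\<close>) results from the min-max principle with trial functions cut out of an explicit
  WKB function at its zeros; the lower bound for \<open>chi n\<close> is the dual argument with cuts at the
  zeros of a Legendre polynomial. For \<open>chi\<close> close to or below \<open>c\<^sup>2\<close> there is no growth region worth
  the name; then \<open>\<tau> \<le> 3/2\<close>, so that a factor \<open>exp c\<close> is affordable and a crude energy estimate suffices
  (\<open>growth_near_critical\<close>).
\<close>

section \<open>Linear algebra and the prolate equation on the interval\<close>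

text \<open>
  Fewer homogeneous linear equations than unknowns. The index sets are arbitrary because the
  equations are indexed by zeros of a polynomial in one application and by numbers in the other.
\<close>

lemma exists_nontrivial_kernel_vector:
  fixes M :: "'i \<Rightarrow> 'j \<Rightarrow> real"
  assumes "finite I" "finite J" "card I < card J"
  shows "\<exists>s. (\<exists>j\<in>J. s j \<noteq> 0) \<and> (\<forall>i\<in>I. (\<Sum>j\<in>J. M i j * s j) = 0)"
  using assms
proof (induction I arbitrary: J M rule: finite_induct)
  case empty
  then have "J \<noteq> {}" by auto
  then show ?case by (intro exI[of _ "\<lambda>_. 1"]) auto
next
  case (insert r I)
  show ?case
  proof (cases "\<forall>j\<in>J. M r j = 0")
    case True
    have "card I < card J" using insert by auto
    from insert.IH[OF insert.prems(1) this, of M] True show ?thesis by force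
  next
    case False
    then obtain j0 where j0: "j0 \<in> J" "M r j0 \<noteq> 0" by auto
    \<comment> \<open>Gaussian elimination of the unknown \<open>j0\<close> by the pivot row \<open>r\<close>.\<close>
    define M' where "M' i j = M i j - M i j0 * M r j / M r j0" for i j
    have "finite (J - {j0})" "card I < card (J - {j0})" using insert j0 by auto
    from insert.IH[OF this, of M'] obtain s where
      s: "\<exists>j\<in>J - {j0}. s j \<noteq> 0" "\<forall>i\<in>I. (\<Sum>j\<in>J - {j0}. M' i j * s j) = 0" by auto
    define S where "S = (\<Sum>j\<in>J - {j0}. M r j * s j)"
    define s' where "s' = s(j0 := - S / M r j0)"
    have split: "(\<Sum>j\<in>J. M i j * s' j) = - M i j0 * S / M r j0 + (\<Sum>j\<in>J - {j0}. M i j * s j)" for i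
    proof -
      have "(\<Sum>j\<in>J. M i j * s' j) = M i j0 * s' j0 + (\<Sum>j\<in>J - {j0}. M i j * s' j)"
        using j0 insert.prems by (simp add: sum.remove)
      also have "(\<Sum>j\<in>J - {j0}. M i j * s' j) = (\<Sum>j\<in>J - {j0}. M i j * s j)"
        by (intro sum.cong) (auto simp: s'_def)
      finally show ?thesis by (simp add: s'_def)
    qed
    have "(\<Sum>j\<in>J. M i j * s' j) = 0" if "i \<in> I" for i
    proof -
      have "(\<Sum>j\<in>J - {j0}. M' i j * s j) = (\<Sum>j\<in>J - {j0}. M i j * s j) - M i j0 / M r j0 * S"
        unfolding S_def M'_def sum_distrib_left sum_subtractf[symmetric]
        by (intro sum.cong) (auto simp: algebra_simps)
      then show ?thesis using s(2) that split[of i] by simp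
    qed
    moreover have "(\<Sum>j\<in>J. M r j * s' j) = 0"
      unfolding split using j0 by (simp add: S_def)
    moreover have "\<exists>j\<in>J. s' j \<noteq> 0" using s(1) by (auto simp: s'_def)
    ultimately show ?thesis by blast
  qed
qed

text \<open>
  One-sided at the end points, in accordance with the notion of \<open>C\<^sup>2\<close>
  function on the closed interval; the derivatives of a \<open>C2_I\<close> function become
  terms instead of existential witnesses.
\<close>

definition dI :: "(real \<Rightarrow> real) \<Rightarrow> real \<Rightarrow> real" where
  "dI f x = vector_derivative f (at x within {-1..1})"

lemma dI_eqI:
  assumes "(f has_real_derivative d) (at x within {-1..1})" "x \<in> {-1..1}"
  shows "dI f x = d"
  unfolding dI_def using assms
  by (intro vector_derivative_within_closed_interval)
     (auto simp: has_real_derivative_iff_has_vector_derivative)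

lemma C2_I_dI:
  assumes "C2_I f"
  shows has_dI: "\<And>x. x \<in> {-1..1} \<Longrightarrow> (f has_real_derivative dI f x) (at x within {-1..1})"
    and has_dI2: "\<And>x. x \<in> {-1..1} \<Longrightarrow> (dI f has_real_derivative dI (dI f) x) (at x within {-1..1})"
    and continuous_dI2: "continuous_on {-1..1} (dI (dI f))"
proof -
  obtain f1 f2 where
    d1: "\<And>x. x \<in> {-1..1} \<Longrightarrow> (f has_real_derivative f1 x) (at x within {-1..1})" and
    d2: "\<And>x. x \<in> {-1..1} \<Longrightarrow> (f1 has_real_derivative f2 x) (at x within {-1..1})" and
    c2: "continuous_on {-1..1} f2"
    using assms unfolding C2_I_def by blast
  have e1: "dI f x = f1 x" if "x \<in> {-1..1}" for x
    using d1[OF that] that by (rule dI_eqI)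
  show "(f has_real_derivative dI f x) (at x within {-1..1})" if "x \<in> {-1..1}" for x
    using d1[OF that] e1[OF that] by simp
  have D: "(dI f has_real_derivative f2 x) (at x within {-1..1})" if "x \<in> {-1..1}" for x
    using d2[OF that] that e1 unfolding has_field_derivative_def
    by (rule_tac has_derivative_transform) auto
  have e2: "dI (dI f) x = f2 x" if "x \<in> {-1..1}" for x
    using D[OF that] that by (rule dI_eqI)
  show "(dI f has_real_derivative dI (dI f) x) (at x within {-1..1})" if "x \<in> {-1..1}" for x
    using D[OF that] e2[OF that] by simp
  show "continuous_on {-1..1} (dI (dI f))"
    using continuous_on_eq[OF c2, of "dI (dI f)"] e2 by simp
qed

lemma C2_I_continuous:
  assumes "C2_I f"
  shows "continuous_on {-1..1} f" "continuous_on {-1..1} (dI f)"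
  using C2_I_dI[OF assms] DERIV_continuous_on by blast+

definition prolate_sol :: "real \<Rightarrow> real \<Rightarrow> (real \<Rightarrow> real) \<Rightarrow> bool" where
  "prolate_sol c X f \<longleftrightarrow> C2_I f \<and>
     (\<forall>x\<in>{-1..1}. (1 - x^2) * dI (dI f) x - 2 * x * dI f x + (X - c^2 * x^2) * f x = 0)"

lemma prolate_solI:
  assumes "C2_I f" "\<And>x. x \<in> {-1..1} \<Longrightarrow> prolate_op c f x = X * f x"
  shows "prolate_sol c X f"
  unfolding prolate_sol_def
proof (intro conjI ballI)
  fix x :: real assume x: "x \<in> {-1..1}"
  have "((\<lambda>t. (1 - t^2) * dI f t) has_real_derivative (1 - x^2) * dI (dI f) x - 2 * x * dI f x)
      (at x within {-1..1})"
    by (auto intro!: derivative_eq_intros has_dI2[OF assms(1) x])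
  then have "dI (\<lambda>t. (1 - t^2) * dI f t) x = (1 - x^2) * dI (dI f) x - 2 * x * dI f x"
    using x by (rule dI_eqI)
  then show "(1 - x^2) * dI (dI f) x - 2 * x * dI f x + (X - c^2 * x^2) * f x = 0"
    using assms(2)[OF x] unfolding prolate_op_def dI_def[symmetric] by (simp add: algebra_simps)
qed (use assms in auto)

lemma pswf_prolate_sol:
  assumes "pswf_system c \<psi> \<mu> chi"
  shows "prolate_sol c (chi k) (\<psi> k)"
  using assms by (intro prolate_solI) (auto simp: pswf_system_def)

lemma at_within_I: "-1 < x \<Longrightarrow> x < 1 \<Longrightarrow> at x within {-1..1::real} = at x"
  by (rule at_within_Icc_at)

text \<open>
  The equation is singular at \<open>1\<close>, where vanishing of the value alone forces a
  regular solution to vanish. The energy \<open>f\<^sup>2 + (1 - x\<^sup>2) f'\<^sup>2\<close>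
  covers regular points and the end point together: its derivative contains \<open>2 x
  f'\<^sup>2\<close>, without the factor \<open>1 - x\<^sup>2\<close>, but near \<open>1\<close>
  this term is positive and only helps. So the energy times a growing exponential increases, and
  is zero to the left of a zero of the energy.
\<close>

lemma prolate_sol_unique:
  assumes sol: "prolate_sol c X f" and x0: "-1 < x0" "x0 \<le> 1"
    and z: "f x0 = 0" "(1 - x0^2) * (dI f x0)^2 = 0"
    and x: "x \<in> {-1..x0}"
  shows "f x = 0"
proof -
  have C2: "C2_I f" using sol by (simp add: prolate_sol_def)
  have ode: "(1 - y^2) * dI (dI f) y = 2 * y * dI f y - (X - c^2 * y^2) * f y" if "y \<in> {-1..1}" for y
    using sol that unfolding prolate_sol_def by (simp add: algebra_simps)
  define E where "E y = (f y)^2 + (1 - y^2) * (dI f y)^2" for y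
  define B where "B = 1 + \<bar>X\<bar> + c^2"
  have cont: "continuous_on {-1..1} E"
    unfolding E_def using C2_I_continuous[OF C2] by (intro continuous_intros)
  have vanish: "f e = 0" if e: "-1 < e" "e < x0" for e
  proof -
    define p0 where "p0 = min (1 - e^2) (3/4)"
    have "e^2 < 1" using e x0 by (simp add: abs_square_less_1)
    then have p0: "p0 > 0" by (simp add: p0_def)
    define K where "K = B^2 + 3 / p0"
    define H where "H y = E y * exp (K * y)" for y
    have "H e \<le> H x0"
    proof (rule DERIV_nonneg_imp_increasing_open[of e x0 H])
      show "e \<le> x0" using e by simp
      show "continuous_on {e..x0} H" unfolding H_def
        by (intro continuous_intros continuous_on_subset[OF cont]) (use e x0 in auto)
      fix y assume y: "e < y" "y < x0"
      then have yI: "y \<in> {-1..1}" "-1 < y" "y < 1" using e x0 by auto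
      have d1: "(f has_real_derivative dI f y) (at y)"
        using has_dI[OF C2 yI(1)] at_within_I[OF yI(2,3)] by simp
      have d2: "(dI f has_real_derivative dI (dI f) y) (at y)"
        using has_dI2[OF C2 yI(1)] at_within_I[OF yI(2,3)] by simp
      define a b p q where "a = f y" and "b = dI f y" and "p = 1 - y^2" and "q = X - c^2 * y^2"
      define E' where "E' = 2 * y * b^2 + 2 * (1 - q) * a * b"
      have "(E has_real_derivative 2 * f y * dI f y - 2 * y * (dI f y)^2 + (1 - y^2) * (2 * dI f y * dI (dI f) y)) (at y)"
        unfolding E_def by (auto intro!: derivative_eq_intros d1 d2)
      also have "2 * f y * dI f y - 2 * y * (dI f y)^2 + (1 - y^2) * (2 * dI f y * dI (dI f) y) =
          2 * a * b - 2 * y * b^2 + 2 * b * ((1 - y^2) * dI (dI f) y)"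
        by (simp add: a_def b_def)
      also have "\<dots> = E'" unfolding ode[OF yI(1)] E'_def
        by (simp add: a_def b_def q_def power2_eq_square algebra_simps)
      finally have dE: "(E has_real_derivative E') (at y)" .
      have dH: "(H has_real_derivative (E' + K * E y) * exp (K * y)) (at y)"
        unfolding H_def by (auto intro!: derivative_eq_intros dE simp: algebra_simps)
      have p: "p > 0" using yI abs_square_less_1[of y] by (auto simp: p_def)
      have "y^2 \<le> 1" using p by (simp add: p_def)
      then have "c^2 * y^2 \<le> c^2 * 1" by (intro mult_left_mono) auto
      moreover have "0 \<le> c^2 * y^2" by simp
      ultimately have qB: "\<bar>1 - q\<bar> \<le> B" unfolding q_def B_def by linarith
      have B: "B \<ge> 0" by (simp add: B_def)
      have "(1 - q)^2 \<le> B^2" using qB B by (metis abs_le_square_iff abs_of_nonneg)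
      then have aB: "(1 - q)^2 * a^2 \<le> B^2 * a^2" by (intro mult_right_mono) auto
      have sq: "((1 - q) * a + b)^2 \<ge> 0" by simp
      then have key: "2 * (1 - q) * a * b \<ge> - (B^2 * a^2) - b^2"
        using aB by (simp add: power2_eq_square algebra_simps)
      have Ey: "E y = a^2 + p * b^2" by (simp add: E_def a_def b_def p_def)
      have "K * E y = B^2 * a^2 + B^2 * p * b^2 + 3 / p0 * a^2 + 3 / p0 * p * b^2"
        unfolding Ey K_def by (simp add: algebra_simps)
      then have KE: "K * E y \<ge> B^2 * a^2 + 3 / p0 * p * b^2"
        using p p0 by simp
      have "E' + K * E y \<ge> 0"
      \<comment> \<open>To the right of \<open>1/2\<close> the term \<open>2 y b\<^sup>2\<close> absorbs the mixed term; to the left, \<open>p\<close> is bounded below.\<close>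
      proof (cases "y \<ge> 1/2")
        case True
        have "2 * y * b^2 \<ge> 1 * b^2" using True by (intro mult_right_mono) auto
        moreover have "3 / p0 * p * b^2 \<ge> 0" using p p0 by simp
        ultimately show ?thesis using key KE unfolding E'_def by linarith
      next
        case False
        have "2 * y * b^2 \<ge> (-2) * b^2" using yI by (intro mult_right_mono) auto
        moreover have "p \<ge> p0"
        proof (cases "y \<ge> 0")
          case True
          then have "y^2 \<le> (1/2)^2" using False by (intro power_mono) auto
          then show ?thesis by (simp add: p_def p0_def power2_eq_square)
        next
          case neg: False
          then have "y^2 \<le> e^2" using y by (metis abs_le_square_iff abs_of_neg linorder_not_le less_eq_real_def neg_le_iff_le order_less_trans)
          then show ?thesis by (simp add: p_def p0_def)
        qed
        then have "3 / p0 * p * b^2 \<ge> 3 * b^2" using p0 by (intro mult_right_mono) (auto simp: field_simps)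
        ultimately show ?thesis using key KE unfolding E'_def by linarith
      qed
      then show "\<exists>d. (H has_real_derivative d) (at y) \<and> 0 \<le> d" using dH by (meson exp_ge_zero mult_nonneg_nonneg)
    qed
    also have "H x0 = 0" using z by (simp add: H_def E_def)
    finally have "E e \<le> 0" by (simp add: H_def mult_le_0_iff)
    moreover have "(1 - e^2) * (dI f e)^2 \<ge> 0" using \<open>e^2 < 1\<close> by simp
    ultimately have "(f e)^2 \<le> 0" unfolding E_def by linarith
    then show ?thesis by simp
  qed
  show ?thesis
  proof (cases "x = -1")
    case True
    have "continuous_on (closure {-1<..<x0}) f"
      using C2_I_continuous(1)[OF C2] x0 by (auto intro: continuous_on_subset)
    then have "f (-1) = 0"
      by (rule continuous_constant_on_closure) (use x0 vanish in auto)
    then show ?thesis using True by simp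
  next
    case False
    then show ?thesis using x z vanish[of x] by (cases "x = x0") auto
  qed
qed

section \<open>Parseval identity and the Fourier operator\<close>

lemma finite_measure_leb_I: "finite_measure leb_I"
  by (rule finite_measure_lebesgue_on) simp

lemma ident_measurable_leb_I: "(\<lambda>x. x) \<in> borel_measurable leb_I"
  by (intro measurable_restrict_space1 measurable_completion) simp

lemma L2_I_mult_integrable:
  assumes "f \<in> L2_I" "g \<in> L2_I"
  shows "integrable leb_I (\<lambda>x. f x * g x)"
proof (rule Bochner_Integration.integrable_bound)
  show "integrable leb_I (\<lambda>x. (cmod (f x))^2 + (cmod (g x))^2)"
    using assms by (auto simp: L2_I_def)
  show "(\<lambda>x. f x * g x) \<in> borel_measurable leb_I" using assms by (auto simp: L2_I_def)
  show "AE x in leb_I. norm (f x * g x) \<le> norm ((cmod (f x))^2 + (cmod (g x))^2)"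
  proof (rule AE_I2)
    fix x
    have "2 * (cmod (f x) * cmod (g x)) \<le> (cmod (f x))^2 + (cmod (g x))^2"
      using sum_squares_bound[of "cmod (f x)" "cmod (g x)"] by simp
    moreover have "0 \<le> cmod (f x) * cmod (g x)" by simp
    ultimately have "cmod (f x) * cmod (g x) \<le> (cmod (f x))^2 + (cmod (g x))^2" by linarith
    then show "norm (f x * g x) \<le> norm ((cmod (f x))^2 + (cmod (g x))^2)"
      by (simp add: norm_mult)
  qed
qed

lemma L2_I_one: "(\<lambda>x. 1) \<in> L2_I"
  using finite_measure.integrable_const[OF finite_measure_leb_I] by (auto simp: L2_I_def)

lemma L2_I_integrable: "f \<in> L2_I \<Longrightarrow> integrable leb_I f"
  using L2_I_mult_integrable[OF _ L2_I_one, of f] by simp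

lemma L2_I_add_scaled:
  assumes f: "f \<in> L2_I" and g: "g \<in> L2_I"
  shows "(\<lambda>x. f x + a * g x) \<in> L2_I"
proof -
  have "integrable leb_I (\<lambda>x. (cmod (f x + a * g x))^2)"
  proof (rule Bochner_Integration.integrable_bound)
    show "integrable leb_I (\<lambda>x. 2 * (cmod (f x))^2 + 2 * (cmod a)^2 * (cmod (g x))^2)"
      using assms by (auto simp: L2_I_def)
    show "(\<lambda>x. (cmod (f x + a * g x))^2) \<in> borel_measurable leb_I" using assms by (auto simp: L2_I_def)
    show "AE x in leb_I. norm ((cmod (f x + a * g x))^2) \<le> norm (2 * (cmod (f x))^2 + 2 * (cmod a)^2 * (cmod (g x))^2)"
    proof (rule AE_I2)
      fix x
      have "(cmod (f x + a * g x))^2 \<le> (cmod (f x) + cmod (a * g x))^2"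
        by (intro power_mono norm_triangle_ineq) auto
      also have "\<dots> \<le> 2 * (cmod (f x))^2 + 2 * (cmod (a * g x))^2"
        using sum_squares_bound[of "cmod (f x)" "cmod (a * g x)"] by (simp add: power2_sum)
      finally show "norm ((cmod (f x + a * g x))^2) \<le> norm (2 * (cmod (f x))^2 + 2 * (cmod a)^2 * (cmod (g x))^2)"
        by (simp add: norm_mult power_mult_distrib)
    qed
  qed
  then show ?thesis using assms by (auto simp: L2_I_def)
qed

lemma L2_I_sum:
  assumes "finite J" "\<And>j. j \<in> J \<Longrightarrow> g j \<in> L2_I"
  shows "(\<lambda>x. \<Sum>j\<in>J. a j * g j x) \<in> L2_I"
  using assms
proof (induction J rule: finite_induct)
  case empty
  then show ?case using L2_I_add_scaled[OF L2_I_one L2_I_one, of "-1"] by simp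
next
  case (insert j J)
  then show ?case using L2_I_add_scaled[of "\<lambda>x. \<Sum>j\<in>J. a j * g j x" "g j" "a j"] by (simp add: add.commute)
qed

lemma pairing_add_scaled:
  assumes "(\<lambda>x. of_real (\<phi> x)) \<in> L2_I" "f \<in> L2_I" "g \<in> L2_I"
  shows "pairing \<phi> (\<lambda>x. f x + a * g x) = pairing \<phi> f + a * pairing \<phi> g"
proof -
  have "pairing \<phi> (\<lambda>x. f x + a * g x) = (\<integral>x. of_real (\<phi> x) * f x + a * (of_real (\<phi> x) * g x) \<partial>leb_I)"
    unfolding pairing_def by (simp add: algebra_simps)
  also have "\<dots> = pairing \<phi> f + a * pairing \<phi> g"
    unfolding pairing_def
    using L2_I_mult_integrable[OF assms(1,2)] L2_I_mult_integrable[OF assms(1,3)] by simp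
  finally show ?thesis .
qed

lemma pairing_sum:
  assumes \<phi>: "(\<lambda>x. of_real (\<phi> x)) \<in> L2_I" and "finite J" "\<And>j. j \<in> J \<Longrightarrow> g j \<in> L2_I"
  shows "pairing \<phi> (\<lambda>x. \<Sum>j\<in>J. a j * g j x) = (\<Sum>j\<in>J. a j * pairing \<phi> (g j))"
  using assms(2,3)
proof (induction J rule: finite_induct)
  case empty
  then show ?case by (simp add: pairing_def)
next
  case (insert j J)
  then show ?case
    using pairing_add_scaled[OF \<phi> L2_I_sum[of J g a], of "g j" "a j"] by (simp add: add.commute)
qed

lemma basis_L2: "orthonormal_basis_I \<psi> \<Longrightarrow> (\<lambda>x. of_real (\<psi> j x)) \<in> L2_I"
  by (simp add: orthonormal_basis_I_def)

lemma basis_orthonormal: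
  "orthonormal_basis_I \<psi> \<Longrightarrow> pairing (\<psi> i) (\<lambda>x. of_real (\<psi> j x)) = (if i = j then 1 else 0)"
  by (simp add: orthonormal_basis_I_def)

lemma L2_norm_nonneg: "0 \<le> L2_norm f"
  by (simp add: L2_norm_def)

lemma L2_norm_sq: "(L2_norm f)^2 = (\<integral>x. (cmod (f x))^2 \<partial>leb_I)"
  by (simp add: L2_norm_def)

text \<open>
  Each step of the partial sum removes a component orthogonal to the new remainder, so that the
  squared norm drops by exactly the square of the new coefficient.
\<close>

lemma L2_norm_remainder:
  assumes b: "orthonormal_basis_I \<psi>" and f: "f \<in> L2_I"
  shows "(L2_norm (\<lambda>x. f x - (\<Sum>j<N. pairing (\<psi> j) f * of_real (\<psi> j x))))^2
    = (L2_norm f)^2 - (\<Sum>j<N. (cmod (pairing (\<psi> j) f))^2)"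
proof (induction N)
  case 0
  then show ?case by simp
next
  case (Suc N)
  define r where "r x = f x - (\<Sum>j<N. pairing (\<psi> j) f * of_real (\<psi> j x))" for x
  define a where "a = pairing (\<psi> N) f"
  define p where "p x = complex_of_real (\<psi> N x)" for x
  have pL: "p \<in> L2_I" unfolding p_def by (rule basis_L2[OF b])
  have sL: "(\<lambda>x. \<Sum>j<N. pairing (\<psi> j) f * of_real (\<psi> j x)) \<in> L2_I"
    by (rule L2_I_sum) (auto intro: basis_L2[OF b])
  have rL: "r \<in> L2_I" unfolding r_def using L2_I_add_scaled[OF f sL, of "-1"] by simp
  have "pairing (\<psi> N) r = pairing (\<psi> N) f + (-1) * pairing (\<psi> N) (\<lambda>x. \<Sum>j<N. pairing (\<psi> j) f * of_real (\<psi> j x))"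
    unfolding r_def using pairing_add_scaled[OF basis_L2[OF b] f sL, of N "-1"] by simp
  also have "pairing (\<psi> N) (\<lambda>x. \<Sum>j<N. pairing (\<psi> j) f * of_real (\<psi> j x)) = 0"
    by (subst pairing_sum) (auto intro: basis_L2[OF b] simp: basis_orthonormal[OF b])
  finally have pr: "pairing (\<psi> N) r = a" by (simp add: a_def)
  have i1: "integrable leb_I (\<lambda>x. (cmod (r x))^2)" "integrable leb_I (\<lambda>x. (cmod (p x))^2)"
    using rL pL by (auto simp: L2_I_def)
  have i2: "integrable leb_I (\<lambda>x. p x * r x)" by (rule L2_I_mult_integrable[OF pL rL])
  have pt: "(cmod (r x - a * p x))^2 = (cmod (r x))^2 - 2 * Re (cnj a * (p x * r x)) + (cmod a)^2 * (cmod (p x))^2" for x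
    unfolding cmod_power2 p_def by (simp add: power2_eq_square algebra_simps)
  have "(\<integral>x. p x * p x \<partial>leb_I) = 1"
    using basis_orthonormal[OF b, of N N] by (simp add: pairing_def p_def)
  then have "(\<integral>x. complex_of_real ((\<psi> N x)^2) \<partial>leb_I) = 1" by (simp add: p_def power2_eq_square)
  then have n1: "(\<integral>x. (cmod (p x))^2 \<partial>leb_I) = 1"
  proof -
    have "complex_of_real (\<integral>x. (\<psi> N x)^2 \<partial>leb_I) = 1"
      using \<open>(\<integral>x. complex_of_real ((\<psi> N x)^2) \<partial>leb_I) = 1\<close> by (simp only: integral_complex_of_real)
    then have "(\<integral>x. (\<psi> N x)^2 \<partial>leb_I) = 1" by (simp only: of_real_eq_1_iff)
    then show ?thesis by (simp add: p_def)
  qed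
  have "(L2_norm (\<lambda>x. r x - a * p x))^2
     = (\<integral>x. (cmod (r x))^2 - 2 * Re (cnj a * (p x * r x)) + (cmod a)^2 * (cmod (p x))^2 \<partial>leb_I)"
    unfolding L2_norm_sq pt ..
  also have "\<dots> = (L2_norm r)^2 - 2 * Re (cnj a * pairing (\<psi> N) r) + (cmod a)^2"
  proof -
    define q where "q x = cnj a * (p x * r x)" for x
    have qi: "integrable leb_I q" unfolding q_def using i2 by simp
    have "integral\<^sup>L leb_I q = cnj a * pairing (\<psi> N) r"
      unfolding q_def pairing_def p_def[symmetric] by (rule integral_mult_right_zero)
    then have "(\<integral>x. Re (q x) \<partial>leb_I) = Re (cnj a * pairing (\<psi> N) r)"
      using integral_Re[OF qi] by simp
    then show ?thesis using i1 qi n1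
      unfolding q_def[symmetric] by (simp add: L2_norm_sq)
  qed
  also have "\<dots> = (L2_norm r)^2 - (cmod a)^2"
    unfolding pr cmod_power2 by (simp add: power2_eq_square)
  finally show ?case using Suc by (simp add: r_def[symmetric] a_def[symmetric] p_def[symmetric] diff_diff_eq)
     (simp add: r_def a_def p_def algebra_simps)
qed

lemma parseval:
  assumes b: "orthonormal_basis_I \<psi>" and f: "f \<in> L2_I"
  shows "(\<lambda>j. (cmod (pairing (\<psi> j) f))^2) sums (L2_norm f)^2"
proof -
  have "(\<lambda>N. (L2_norm (\<lambda>x. f x - (\<Sum>j<N. pairing (\<psi> j) f * of_real (\<psi> j x))))^2) \<longlonglongrightarrow> 0^2"
    using b f by (intro tendsto_power) (simp add: orthonormal_basis_I_def)
  then have "(\<lambda>N. (L2_norm f)^2 - ((L2_norm f)^2 - (\<Sum>j<N. (cmod (pairing (\<psi> j) f))^2))) \<longlonglongrightarrow> (L2_norm f)^2 - 0"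
    unfolding L2_norm_remainder[OF b f] by (intro tendsto_intros) simp
  then show ?thesis by (simp add: sums_def)
qed

lemma bessel:
  assumes b: "orthonormal_basis_I \<psi>" and f: "f \<in> L2_I" and "finite J"
  shows "(\<Sum>j\<in>J. (cmod (pairing (\<psi> j) f))^2) \<le> (L2_norm f)^2"
  using sum_le_suminf[OF sums_summable[OF parseval[OF b f]] assms(3)] sums_unique[OF parseval[OF b f]]
  by simp

lemma fourier_kernel_measurable:
  "(\<lambda>(x, y). exp (\<i> * of_real (c * x * y))) \<in> borel_measurable (leb_I \<Otimes>\<^sub>M leb_I)"
proof -
  have 1: "(\<lambda>z. fst z) \<in> borel_measurable (leb_I \<Otimes>\<^sub>M leb_I)" "(\<lambda>z. snd z) \<in> borel_measurable (leb_I \<Otimes>\<^sub>M leb_I)"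
    using measurable_compose[OF measurable_fst ident_measurable_leb_I]
      measurable_compose[OF measurable_snd ident_measurable_leb_I] by auto
  have "(\<lambda>z. c * fst z * snd z) \<in> borel_measurable (leb_I \<Otimes>\<^sub>M leb_I)" using 1 by measurable
  then have "(\<lambda>z. cis (c * fst z * snd z)) \<in> borel_measurable (leb_I \<Otimes>\<^sub>M leb_I)"
    by (rule measurable_compose) (intro borel_measurable_continuous_onI continuous_intros)
  then show ?thesis by (simp add: cis_conv_exp case_prod_unfold)
qed

lemma fourier_op_L2:
  assumes f: "f \<in> L2_I"
  shows "fourier_op c f \<in> L2_I"
proof -
  interpret finite_measure leb_I by (rule finite_measure_leb_I)
  have fm: "f \<in> borel_measurable leb_I" using f by (simp add: L2_I_def)
  have "(\<lambda>(x, y). exp (\<i> * of_real (c * x * y)) * f y) \<in> borel_measurable (leb_I \<Otimes>\<^sub>M leb_I)"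
    using borel_measurable_times[OF fourier_kernel_measurable measurable_compose[OF measurable_snd fm]]
    by (simp add: case_prod_unfold)
  then have m: "fourier_op c f \<in> borel_measurable leb_I"
    unfolding fourier_op_def by (rule borel_measurable_lebesgue_integral)
  have bd: "cmod (fourier_op c f x) \<le> (\<integral>y. cmod (f y) \<partial>leb_I)" for x
  proof -
    have "cmod (fourier_op c f x) \<le> (\<integral>y. cmod (exp (\<i> * of_real (c * x * y)) * f y) \<partial>leb_I)"
      unfolding fourier_op_def by (rule integral_norm_bound)
    then show ?thesis by (simp add: norm_mult cis_conv_exp[symmetric])
  qed
  have "integrable leb_I (\<lambda>x. (cmod (fourier_op c f x))^2)"
  proof (rule integrable_const_bound[where B = "(\<integral>y. cmod (f y) \<partial>leb_I)^2"])
    show "AE x in leb_I. norm ((cmod (fourier_op c f x))^2) \<le> (\<integral>y. cmod (f y) \<partial>leb_I)^2"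
      using bd by (intro AE_I2) (auto intro!: power_mono)
  qed (use m in measurable)
  then show ?thesis using m by (simp add: L2_I_def)
qed

text \<open>
  The Fourier kernel is symmetric in \<open>x\<close> and \<open>y\<close>, so the operator can
  be moved to the other argument of the pairing.
\<close>

lemma pairing_fourier_op:
  assumes sys: "pswf_system c \<psi> \<mu> chi" and f: "f \<in> L2_I"
  shows "pairing (\<psi> j) (fourier_op c f) = \<mu> j * pairing (\<psi> j) f"
proof -
  interpret finite_measure leb_I by (rule finite_measure_leb_I)
  interpret P: pair_sigma_finite leb_I leb_I by unfold_locales
  define p where "p x = complex_of_real (\<psi> j x)" for x
  have b: "orthonormal_basis_I \<psi>" using sys by (simp add: pswf_system_def)
  have pL: "p \<in> L2_I" unfolding p_def by (rule basis_L2[OF b])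
  have pm: "p \<in> borel_measurable leb_I" and fm: "f \<in> borel_measurable leb_I"
    using pL f by (auto simp: L2_I_def)
  define k where "k x y = p x * (exp (\<i> * of_real (c * x * y)) * f y)" for x y
  have nk: "cmod (k x y) = cmod (p x) * cmod (f y)" for x y
    by (simp add: k_def norm_mult cis_conv_exp[symmetric])
  have meas: "(\<lambda>(x, y). k x y) \<in> borel_measurable (leb_I \<Otimes>\<^sub>M leb_I)"
    unfolding k_def using borel_measurable_times[OF measurable_compose[OF measurable_fst pm]
      borel_measurable_times[OF fourier_kernel_measurable measurable_compose[OF measurable_snd fm]]]
    by (simp add: case_prod_unfold)
  have fi: "integrable leb_I (\<lambda>y. cmod (f y))" "integrable leb_I (\<lambda>x. cmod (p x))"
    using L2_I_integrable[OF f] L2_I_integrable[OF pL] by auto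
  have int: "integrable (leb_I \<Otimes>\<^sub>M leb_I) (\<lambda>(x, y). k x y)"
  proof (rule P.Fubini_integrable[OF meas])
    show "integrable leb_I (\<lambda>x. \<integral>y. norm (case (x, y) of (x, y) \<Rightarrow> k x y) \<partial>leb_I)"
      using fi by (simp add: nk)
    show "AE x in leb_I. integrable leb_I (\<lambda>y. case (x, y) of (x, y) \<Rightarrow> k x y)"
    proof (rule AE_I2)
      fix x assume "x \<in> space leb_I"
      then have "(\<lambda>y. k x y) \<in> borel_measurable leb_I"
        using measurable_compose[OF measurable_Pair1' meas] by simp
      moreover have "integrable leb_I (\<lambda>y. cmod (k x y))" using fi by (simp add: nk)
      ultimately show "integrable leb_I (\<lambda>y. case (x, y) of (x, y) \<Rightarrow> k x y)"
        by (simp add: integrable_norm_iff)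
    qed
  qed
  have "pairing (\<psi> j) (fourier_op c f) = (\<integral>x. (\<integral>y. k x y \<partial>leb_I) \<partial>leb_I)"
    unfolding pairing_def fourier_op_def k_def p_def[symmetric] by simp
  also have "\<dots> = (\<integral>y. (\<integral>x. k x y \<partial>leb_I) \<partial>leb_I)"
    by (rule P.Fubini_integral[OF int, symmetric])
  also have "\<dots> = (\<integral>y. \<mu> j * (p y * f y) \<partial>leb_I)"
  proof (rule Bochner_Integration.integral_cong)
    fix y assume y: "y \<in> space leb_I"
    have "(\<integral>x. k x y \<partial>leb_I) = (\<integral>x. f y * (exp (\<i> * of_real (c * y * x)) * p x) \<partial>leb_I)"
      by (simp add: k_def mult_ac)
    also have "\<dots> = f y * fourier_op c (\<lambda>y. of_real (\<psi> j y)) y"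
      unfolding fourier_op_def p_def[symmetric] by simp
    also have "\<dots> = \<mu> j * (p y * f y)"
      using sys y unfolding pswf_system_def p_def by simp
    finally show "(\<integral>x. k x y \<partial>leb_I) = \<mu> j * (p y * f y)" .
  qed simp
  also have "\<dots> = \<mu> j * pairing (\<psi> j) f" by (simp add: pairing_def p_def)
  finally show ?thesis .
qed

section \<open>Lower bound for the eigenvalues of the differential operator\<close>

text \<open>
  Integration by parts of the equation against \<open>g\<close>, with the boundary terms kept
  for later use on subintervals.
\<close>

lemma energy_identity:
  assumes sol: "prolate_sol c X f" and ab: "-1 \<le> a" "a \<le> b" "b \<le> 1"
    and g: "\<And>x. x \<in> {a..b} \<Longrightarrow> (g has_real_derivative g' x) (at x within {a..b})"
  shows "((\<lambda>x. (1 - x^2) * g' x * dI f x + (c^2 * x^2 - X) * g x * f x) has_integral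
     ((1 - b^2) * dI f b * g b - (1 - a^2) * dI f a * g a)) {a..b}"
proof (rule fundamental_theorem_of_calculus[OF ab(2)])
  fix x assume x: "x \<in> {a..b}"
  then have xI: "x \<in> {-1..1}" using ab by auto
  have C2: "C2_I f" using sol by (simp add: prolate_sol_def)
  have o: "(1 - x^2) * dI (dI f) x = 2 * x * dI f x - (X - c^2 * x^2) * f x"
    using sol xI by (auto simp: prolate_sol_def algebra_simps)
  have d2: "(dI f has_real_derivative dI (dI f) x) (at x within {a..b})"
    using has_dI2[OF C2 xI] ab by (rule_tac DERIV_subset) auto
  have dp: "((\<lambda>y. 1 - y^2) has_real_derivative - 2 * x) (at x within {a..b})"
    by (auto intro!: derivative_eq_intros)
  have "((\<lambda>x. (1 - x^2) * dI f x * g x) has_real_derivative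
     ((- 2 * x) * dI f x + dI (dI f) x * (1 - x^2)) * g x + g' x * ((1 - x^2) * dI f x)) (at x within {a..b})"
    by (rule DERIV_mult[OF DERIV_mult[OF dp d2] g[OF x]])
  also have "((- 2 * x) * dI f x + dI (dI f) x * (1 - x^2)) * g x + g' x * ((1 - x^2) * dI f x)
     = ((- 2 * x) * dI f x + (1 - x^2) * dI (dI f) x) * g x + (1 - x^2) * g' x * dI f x"
    by (simp add: algebra_simps)
  also have "\<dots> = (1 - x^2) * g' x * dI f x + (c^2 * x^2 - X) * g x * f x"
    unfolding o by (simp add: algebra_simps)
  finally show "((\<lambda>x. (1 - x^2) * dI f x * g x) has_vector_derivative
     (1 - x^2) * g' x * dI f x + (c^2 * x^2 - X) * g x * f x) (at x within {a..b})"
    by (simp only: has_real_derivative_iff_has_vector_derivative)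
qed

lemma pairing_real:
  assumes "integrable leb_I (\<lambda>x. \<phi> x * v x)"
  shows "pairing \<phi> (\<lambda>x. of_real (v x)) = of_real (integral {-1..1} (\<lambda>x. \<phi> x * v x))"
proof -
  have "pairing \<phi> (\<lambda>x. of_real (v x)) = (\<integral>x. complex_of_real (\<phi> x * v x) \<partial>leb_I)"
    by (simp add: pairing_def)
  also have "\<dots> = of_real (\<integral>x. \<phi> x * v x \<partial>leb_I)" by (rule integral_complex_of_real)
  also have "(\<integral>x. \<phi> x * v x \<partial>leb_I) = integral {-1..1} (\<lambda>x. \<phi> x * v x)"
    by (rule lebesgue_integral_eq_integral[OF assms]) simp
  finally show ?thesis .
qed

lemma pswf_orthonormal_integral:
  assumes sys: "pswf_system c \<psi> \<mu> chi"
  shows "((\<lambda>x. \<psi> i x * \<psi> j x) has_integral (if i = j then 1 else 0)) {-1..1}"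
proof -
  have C2: "C2_I (\<psi> k)" for k using sys by (simp add: pswf_system_def)
  have cont: "continuous_on {-1..1} (\<lambda>x. \<psi> i x * \<psi> j x)"
    by (intro continuous_intros C2_I_continuous[OF C2])
  have "complex_of_real (integral {-1..1} (\<lambda>x. \<psi> i x * \<psi> j x)) = (if i = j then 1 else 0)"
    using pairing_real[OF continuous_imp_integrable_real[OF cont]] basis_orthonormal[of \<psi> i j] sys
    by (simp add: pswf_system_def)
  then have "integral {-1..1} (\<lambda>x. \<psi> i x * \<psi> j x) = (if i = j then 1 else 0)"
    by (metis of_real_eq_1_iff of_real_eq_0_iff)
  then show ?thesis using integrable_integral[OF integrable_continuous_interval[OF cont]] by simp
qed

text \<open>
  The basis is orthogonal both in \<open>L\<^sup>2\<close> and for the energy form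
  \<open>\<integral> (1 - x\<^sup>2) v'\<^sup>2 + c\<^sup>2 x\<^sup>2 v\<^sup>2\<close>; hence
  both quadratic forms are diagonal on finite combinations.
\<close>

lemma pswf_combination:
  fixes s :: "nat \<Rightarrow> real"
  assumes sys: "pswf_system c \<psi> \<mu> chi" and J: "finite J"
  defines "v \<equiv> \<lambda>x. \<Sum>j\<in>J. s j * \<psi> j x" and "v' \<equiv> \<lambda>x. \<Sum>j\<in>J. s j * dI (\<psi> j) x"
  shows pswf_combination_deriv: "\<And>x. x \<in> {-1..1} \<Longrightarrow> (v has_real_derivative v' x) (at x within {-1..1})"
    and pswf_combination_cont: "continuous_on {-1..1} v'"
    and pswf_combination_norm: "((\<lambda>x. (v x)^2) has_integral (\<Sum>j\<in>J. (s j)^2)) {-1..1}"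
    and pswf_combination_energy: "((\<lambda>x. (1 - x^2) * (v' x)^2 + c^2 * x^2 * (v x)^2) has_integral
      (\<Sum>j\<in>J. chi j * (s j)^2)) {-1..1}"
proof -
  have C2: "C2_I (\<psi> k)" for k using sys by (simp add: pswf_system_def)
  show dv: "(v has_real_derivative v' x) (at x within {-1..1})" if "x \<in> {-1..1}" for x
    unfolding v_def v'_def by (intro DERIV_sum DERIV_cmult has_dI[OF C2 that])
  show "continuous_on {-1..1} v'"
    unfolding v'_def by (intro continuous_intros C2_I_continuous[OF C2])
  have vj: "((\<lambda>x. v x * \<psi> j x) has_integral s j) {-1..1}" if "j \<in> J" for j
  proof -
    have "((\<lambda>x. \<Sum>i\<in>J. s i * (\<psi> i x * \<psi> j x)) has_integral (\<Sum>i\<in>J. s i * (if i = j then 1 else 0))) {-1..1}"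
      by (intro has_integral_sum[OF J] has_integral_mult_right pswf_orthonormal_integral[OF sys])
    moreover have "(\<Sum>i\<in>J. s i * (if i = j then 1 else 0)) = (\<Sum>i\<in>J. if i = j then s i else 0)"
      by (intro sum.cong) auto
    then have "(\<Sum>i\<in>J. s i * (if i = j then 1 else 0)) = s j" using J that by simp
    ultimately show ?thesis by (simp add: v_def sum_distrib_right mult.assoc)
  qed
  have "((\<lambda>x. \<Sum>j\<in>J. s j * (v x * \<psi> j x)) has_integral (\<Sum>j\<in>J. s j * s j)) {-1..1}"
    by (intro has_integral_sum[OF J] has_integral_mult_right vj)
  moreover have "(\<Sum>j\<in>J. s j * (v x * \<psi> j x)) = (v x)^2" for x
    by (simp add: v_def power2_eq_square sum_distrib_left sum_distrib_right mult_ac)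
  ultimately show "((\<lambda>x. (v x)^2) has_integral (\<Sum>j\<in>J. (s j)^2)) {-1..1}"
    by (simp add: power2_eq_square)
  have ej: "((\<lambda>x. (1 - x^2) * v' x * dI (\<psi> j) x + c^2 * x^2 * v x * \<psi> j x) has_integral chi j * s j) {-1..1}"
    if "j \<in> J" for j
  proof -
    have "((\<lambda>x. (1 - x^2) * v' x * dI (\<psi> j) x + (c^2 * x^2 - chi j) * v x * \<psi> j x) has_integral 0) {-1..1}"
      using energy_identity[OF pswf_prolate_sol[OF sys, of j], of "-1" 1 v v'] dv by simp
    from has_integral_add[OF this has_integral_mult_right[OF vj[OF that], of "chi j"]]
    show ?thesis by (simp add: algebra_simps)
  qed
  have "((\<lambda>x. \<Sum>j\<in>J. s j * ((1 - x^2) * v' x * dI (\<psi> j) x + c^2 * x^2 * v x * \<psi> j x)) has_integral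
      (\<Sum>j\<in>J. s j * (chi j * s j))) {-1..1}"
    by (intro has_integral_sum[OF J] has_integral_mult_right ej)
  moreover have "(\<Sum>j\<in>J. s j * ((1 - x^2) * v' x * dI (\<psi> j) x + c^2 * x^2 * v x * \<psi> j x))
      = (1 - x^2) * (v' x)^2 + c^2 * x^2 * (v x)^2" for x
  proof -
    have "(\<Sum>j\<in>J. s j * ((1 - x^2) * v' x * dI (\<psi> j) x + c^2 * x^2 * v x * \<psi> j x))
      = (1 - x^2) * v' x * (\<Sum>j\<in>J. s j * dI (\<psi> j) x) + c^2 * x^2 * v x * (\<Sum>j\<in>J. s j * \<psi> j x)"
      unfolding sum_distrib_left sum.distrib[symmetric] by (intro sum.cong) (auto simp: algebra_simps)
    also have "\<dots> = (1 - x^2) * (v' x)^2 + c^2 * x^2 * (v x)^2"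
    proof -
      have "(\<Sum>j\<in>J. s j * dI (\<psi> j) x) = v' x" "(\<Sum>j\<in>J. s j * \<psi> j x) = v x" by (simp_all add: v_def v'_def)
      then show ?thesis by (simp only: power2_eq_square mult.assoc)
    qed
    finally show ?thesis .
  qed
  ultimately show "((\<lambda>x. (1 - x^2) * (v' x)^2 + c^2 * x^2 * (v x)^2) has_integral
      (\<Sum>j\<in>J. chi j * (s j)^2)) {-1..1}"
    by (simp add: power2_eq_square mult_ac)
qed

lemma prolate_sol_fromI:
  assumes d1: "\<And>x. x \<in> {-1..1} \<Longrightarrow> (f has_real_derivative f1 x) (at x within {-1..1})"
    and d2: "\<And>x. x \<in> {-1..1} \<Longrightarrow> (f1 has_real_derivative f2 x) (at x within {-1..1})"
    and c2: "continuous_on {-1..1} f2"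
    and ode: "\<And>x. x \<in> {-1..1} \<Longrightarrow> (1 - x^2) * f2 x - 2 * x * f1 x + (X - c^2 * x^2) * f x = 0"
  shows "prolate_sol c X f" "\<And>x. x \<in> {-1..1} \<Longrightarrow> dI f x = f1 x"
proof -
  have C2: "C2_I f" using d1 d2 c2 unfolding C2_I_def by blast
  show e1: "dI f x = f1 x" if "x \<in> {-1..1}" for x using d1[OF that] that by (rule dI_eqI)
  have e2: "dI (dI f) x = f2 x" if "x \<in> {-1..1}" for x
  proof (rule dI_eqI[OF _ that])
    show "(dI f has_real_derivative f2 x) (at x within {-1..1})"
      using d2[OF that] that e1 unfolding has_field_derivative_def
      by (rule_tac has_derivative_transform) auto
  qed
  show "prolate_sol c X f" unfolding prolate_sol_def using C2 ode e1 e2 by auto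
qed

text \<open>
  Coefficients of the Legendre polynomial in powers of \<open>1 - x\<close>. At the singular
  point \<open>x = 1\<close> the equation is a two-term recursion, which stops at the degree
  \<open>n\<close>.
\<close>

fun legendre_coeff :: "nat \<Rightarrow> nat \<Rightarrow> real" where
  "legendre_coeff n 0 = 1"
| "legendre_coeff n (Suc k) = legendre_coeff n k * (real k * (real k + 1) - real n * (real n + 1)) / (2 * (real k + 1)^2)"

definition legendre_poly :: "nat \<Rightarrow> real poly" where
  "legendre_poly n = Poly (map (legendre_coeff n) [0..<Suc n])"

lemma legendre_coeff_zero: "k > n \<Longrightarrow> legendre_coeff n k = 0"
proof (induction k)
  case (Suc k)
  then show ?case by (cases "k = n") auto
qed simp

lemma coeff_legendre_poly: "coeff (legendre_poly n) k = legendre_coeff n k"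
  unfolding legendre_poly_def coeff_Poly_eq
  by (cases "k < Suc n") (auto simp: nth_default_def legendre_coeff_zero simp del: upt_Suc)

lemma legendre_poly_ode:
  fixes n :: nat
  defines "q \<equiv> legendre_poly n"
  shows "t * (2 - t) * poly (pderiv (pderiv q)) t + 2 * (1 - t) * poly (pderiv q) t + real n * (real n + 1) * poly q t = 0"
proof -
  have "[:0, 2, -1:] * pderiv (pderiv q) + [:2, -2:] * pderiv q + smult (real n * (real n + 1)) q = 0"
  proof (rule poly_eqI)
    fix k
    have rec: "2 * (real k + 1)^2 * legendre_coeff n (Suc k)
       = (real k * (real k + 1) - real n * (real n + 1)) * legendre_coeff n k"
      by simp
    show "coeff ([:0, 2, -1:] * pderiv (pderiv q) + [:2, -2:] * pderiv q + smult (real n * (real n + 1)) q) k = coeff 0 k"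
    proof (cases k)
      case 0
      then show ?thesis using rec by (simp add: q_def coeff_legendre_poly coeff_pderiv)
    next
      case (Suc k')
      have "coeff ([:0, 2, -1:] * pderiv (pderiv q)) (Suc k')
         = 2 * coeff (pderiv (pderiv q)) k' - (case k' of 0 \<Rightarrow> 0 | Suc i \<Rightarrow> coeff (pderiv (pderiv q)) i)"
        by (simp add: coeff_pCons split: nat.splits)
      also have "\<dots> = 2 * real (Suc k) * real k * legendre_coeff n (Suc k) - real k * (real k - 1) * legendre_coeff n k"
        using Suc by (cases k') (simp_all add: coeff_pderiv q_def coeff_legendre_poly algebra_simps
          del: legendre_coeff.simps)
      finally have e1: "coeff ([:0, 2, -1:] * pderiv (pderiv q)) k
         = 2 * real (Suc k) * real k * legendre_coeff n (Suc k) - real k * (real k - 1) * legendre_coeff n k"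
        using Suc by simp
      have e2: "coeff ([:2, -2:] * pderiv q) k = 2 * real (Suc k) * legendre_coeff n (Suc k) - 2 * real k * legendre_coeff n k"
        using Suc by (simp add: coeff_pCons coeff_pderiv q_def coeff_legendre_poly algebra_simps del: legendre_coeff.simps)
      show ?thesis
        unfolding coeff_add coeff_smult e1 e2 using rec
        by (simp add: q_def coeff_legendre_poly power2_eq_square algebra_simps del: legendre_coeff.simps)
    qed
  qed
  then have "poly ([:0, 2, -1:] * pderiv (pderiv q) + [:2, -2:] * pderiv q + smult (real n * (real n + 1)) q) t = 0"
    by simp
  then show ?thesis by (simp add: algebra_simps)
qed

text \<open>
  The sign \<open>\<sigma>\<close> provides the reflected polynomial as well, so that the
  uniqueness theorem, which starts at the right end point, can be applied at \<open>-1\<close>.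
\<close>

lemma legendre_sol:
  assumes "\<sigma>\<^sup>2 = (1::real)"
  shows "prolate_sol 0 (real n * (real n + 1)) (\<lambda>x. poly (legendre_poly n) (1 - \<sigma> * x))"
    and "x \<in> {-1..1} \<Longrightarrow> dI (\<lambda>x. poly (legendre_poly n) (1 - \<sigma> * x)) x = - \<sigma> * poly (pderiv (legendre_poly n)) (1 - \<sigma> * x)"
proof -
  define q where "q = legendre_poly n"
  have d1: "((\<lambda>x. poly q (1 - \<sigma> * x)) has_real_derivative - \<sigma> * poly (pderiv q) (1 - \<sigma> * x)) (at x within {-1..1})" for x
    by (rule DERIV_cong, rule DERIV_chain2[OF poly_DERIV]) (auto intro!: derivative_eq_intros)
  have d2: "((\<lambda>x. - \<sigma> * poly (pderiv q) (1 - \<sigma> * x)) has_real_derivative poly (pderiv (pderiv q)) (1 - \<sigma> * x)) (at x within {-1..1})" for x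
    by (rule DERIV_cong, rule DERIV_cmult[OF DERIV_chain2[OF poly_DERIV]])
       (use assms in \<open>auto intro!: derivative_eq_intros simp: power2_eq_square\<close>)
  have ode: "(1 - x^2) * poly (pderiv (pderiv q)) (1 - \<sigma> * x) - 2 * x * (- \<sigma> * poly (pderiv q) (1 - \<sigma> * x))
     + (real n * (real n + 1) - 0^2 * x^2) * poly q (1 - \<sigma> * x) = 0" for x
  proof -
    have "(1 - \<sigma> * x) * (2 - (1 - \<sigma> * x)) = 1 - x^2"
      using assms by (simp add: algebra_simps power2_eq_square)
    then show ?thesis using legendre_poly_ode[of "1 - \<sigma> * x" n] by (simp add: q_def algebra_simps)
  qed
  note R = prolate_sol_fromI[of "\<lambda>x. poly q (1 - \<sigma> * x)" _ "\<lambda>x. poly (pderiv (pderiv q)) (1 - \<sigma> * x)", OF d1 d2 _ ode]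
  show "prolate_sol 0 (real n * (real n + 1)) (\<lambda>x. poly (legendre_poly n) (1 - \<sigma> * x))"
    unfolding q_def[symmetric] by (rule R(1)) (intro continuous_intros)
  show "dI (\<lambda>x. poly (legendre_poly n) (1 - \<sigma> * x)) x = - \<sigma> * poly (pderiv (legendre_poly n)) (1 - \<sigma> * x)"
    if "x \<in> {-1..1}"
    unfolding q_def[symmetric] by (rule R(2)) (intro continuous_intros, rule that)
qed

lemma legendre_poly_nonzero: "legendre_poly n \<noteq> 0"
  using coeff_legendre_poly[of n 0] by auto

text \<open>
  What the cutting argument needs to know about the zeros: there are at most \<open>n\<close> of
  them, they are simple, and they avoid the end points. A multiple zero or a zero at an end
  point would make the polynomial vanish on an interval.
\<close>

lemma legendre_zeros:
  fixes n :: nat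
  defines "w \<equiv> \<lambda>x. poly (legendre_poly n) (1 - x)"
  shows "finite {x. w x = 0}" "card {x. w x = 0} \<le> n"
    and "\<And>x. -1 < x \<Longrightarrow> x \<le> 1 \<Longrightarrow> w x = 0 \<Longrightarrow> (1 - x^2) * (dI w x)^2 \<noteq> 0" and "w (-1) \<noteq> 0"
proof -
  define q where "q = legendre_poly n"
  have im: "{x. w x = 0} = (\<lambda>t. 1 - t) ` {t. poly q t = 0}"
    unfolding w_def q_def by (auto simp: image_iff intro: exI[of _ "1 - x" for x])
       (metis diff_diff_eq2 add_diff_cancel_left' mem_Collect_eq)
  have fin: "finite {t. poly q t = 0}" using legendre_poly_nonzero q_def poly_roots_finite by blast
  then show "finite {x. w x = 0}" unfolding im by simp
  have "card {x. w x = 0} \<le> card {t. poly q t = 0}" unfolding im by (rule card_image_le[OF fin])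
  also have "\<dots> \<le> degree q" using legendre_poly_nonzero q_def by (intro card_poly_roots_bound) auto
  also have "degree q \<le> n" unfolding q_def
    by (rule degree_le) (auto simp: coeff_legendre_poly legendre_coeff_zero)
  finally show "card {x. w x = 0} \<le> n" .
  have no: False if "-1 < x0" "\<And>x. x \<in> {-1..x0} \<Longrightarrow> poly q (1 - \<sigma> * x) = 0" "\<sigma> \<noteq> 0" for x0 \<sigma> :: real
  proof -
    have "inj_on (\<lambda>x. 1 - \<sigma> * x) {-1..x0}" using that(3) by (auto simp: inj_on_def)
    moreover have "finite ((\<lambda>x. 1 - \<sigma> * x) ` {-1..x0})"
      by (rule finite_subset[OF _ fin]) (use that(2) in auto)
    ultimately have "finite {-1..x0}" using finite_imageD by blast
    then show False using that(1) by (simp add: infinite_Icc)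
  qed
  show "(1 - x^2) * (dI w x)^2 \<noteq> 0" if x: "-1 < x" "x \<le> 1" "w x = 0" for x
  proof
    assume "(1 - x^2) * (dI w x)^2 = 0"
    then have "w y = 0" if "y \<in> {-1..x}" for y
      using prolate_sol_unique[OF legendre_sol(1)[of 1 n], of x y] x that by (simp add: w_def)
    then show False using no[of x 1] x by (simp add: w_def q_def)
  qed
  show "w (-1) \<noteq> 0"
  proof
    assume "w (-1) = 0"
    then have "poly q (1 - (-1) * y) = 0" if "y \<in> {-1..1}" for y
      using prolate_sol_unique[OF legendre_sol(1)[of "-1" n], of 1 y] that by (simp add: w_def q_def)
    then show False using no[of 1 "-1"] by simp
  qed
qed

text \<open>
  Picone's identity: with \<open>F = (1 - x\<^sup>2) w' v\<^sup>2 / w\<close> the difference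
  \<open>(1 - x\<^sup>2) v'\<^sup>2 - X v\<^sup>2 - F'\<close> is the square \<open>(1 -
  x\<^sup>2) (v' - v w' / w)\<^sup>2\<close>, and \<open>F\<close> vanishes at the end points.
  As \<open>v\<close> vanishes at the simple zeros of \<open>w\<close>, \<open>F\<close> extends
  continuously by \<open>0\<close> there; the convention \<open>x / 0 = 0\<close> gives exactly
  this value.
\<close>

lemma picone_inequality:
  assumes w: "prolate_sol 0 X w"
    and fin: "finite {x. w x = 0}"
    and simple: "\<And>x. -1 < x \<Longrightarrow> x < 1 \<Longrightarrow> w x = 0 \<Longrightarrow> dI w x \<noteq> 0"
    and ends: "w 1 \<noteq> 0" "w (-1) \<noteq> 0"
    and v: "\<And>x. x \<in> {-1..1} \<Longrightarrow> (v has_real_derivative v' x) (at x within {-1..1})"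
    and vz: "\<And>x. x \<in> {-1..1} \<Longrightarrow> w x = 0 \<Longrightarrow> v x = 0"
    and I1: "((\<lambda>x. (1 - x^2) * (v' x)^2) has_integral I1) {-1..1}"
    and I2: "((\<lambda>x. (v x)^2) has_integral I2) {-1..1}"
  shows "X * I2 \<le> I1"
proof -
  have C2: "C2_I w" using w by (simp add: prolate_sol_def)
  define F where "F x = (1 - x^2) * dI w x * (v x)^2 / w x" for x
  define F' where "F' x = - X * (v x)^2 + 2 * (1 - x^2) * (dI w x / w x) * v x * v' x
     - (1 - x^2) * (dI w x / w x)^2 * (v x)^2" for x
  have dF: "(F has_real_derivative F' x) (at x within {-1..1})" if x: "x \<in> {-1..1}" "w x \<noteq> 0" for x
  proof -
    have o: "(1 - x^2) * dI (dI w) x = 2 * x * dI w x - X * w x"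
      using w x by (auto simp: prolate_sol_def algebra_simps)
    have dp: "((\<lambda>y. 1 - y^2) has_real_derivative - 2 * x) (at x within {-1..1})"
      by (auto intro!: derivative_eq_intros)
    have "((\<lambda>x. (1 - x^2) * dI w x) has_real_derivative (- 2 * x) * dI w x + dI (dI w) x * (1 - x^2)) (at x within {-1..1})"
      by (rule DERIV_mult[OF dp has_dI2[OF C2 x(1)]])
    also have "(- 2 * x) * dI w x + dI (dI w) x * (1 - x^2) = - X * w x"
      using o by (simp add: mult.commute)
    finally have d1: "((\<lambda>x. (1 - x^2) * dI w x) has_real_derivative - X * w x) (at x within {-1..1})" .
    have "(F has_real_derivative ((- X * w x * (v x)^2 + (2 * v x * v' x) * ((1 - x^2) * dI w x)) * w x
        - ((1 - x^2) * dI w x * (v x)^2) * dI w x) / (w x * w x)) (at x within {-1..1})"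
      unfolding F_def
      by (rule DERIV_cong[OF DERIV_divide[OF DERIV_mult[OF d1 DERIV_power[OF v[OF x(1)], of 2]] has_dI[OF C2 x(1)] x(2)]])
         (simp add: mult_ac)
    also have "((- X * w x * (v x)^2 + (2 * v x * v' x) * ((1 - x^2) * dI w x)) * w x
        - ((1 - x^2) * dI w x * (v x)^2) * dI w x) / (w x * w x) = F' x"
      unfolding F'_def using x(2) by (simp add: divide_simps power2_eq_square)
    finally show ?thesis .
  qed
  have cF: "continuous_on {-1..1} F"
    unfolding continuous_on_eq_continuous_within
  proof
    fix x :: real assume x: "x \<in> {-1..1}"
    show "continuous (at x within {-1..1}) F"
    proof (cases "w x = 0")
      case False
      then show ?thesis using dF[OF x] DERIV_continuous by blast
    next
      case True
      then have xi: "-1 < x" "x < 1" using x ends by (auto simp: order.strict_iff_order)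
      have vx: "v x = 0" using vz[OF x True] .
      have "((\<lambda>y. (v y - v x) / (y - x)) \<longlongrightarrow> v' x) (at x within {-1..1})"
        using v[OF x] unfolding has_field_derivative_iff .
      moreover have "((\<lambda>y. (w y - w x) / (y - x)) \<longlongrightarrow> dI w x) (at x within {-1..1})"
        using has_dI[OF C2 x] unfolding has_field_derivative_iff .
      ultimately have "((\<lambda>y. ((v y - v x) / (y - x)) / ((w y - w x) / (y - x))) \<longlongrightarrow> v' x / dI w x) (at x within {-1..1})"
        using simple[OF xi True] by (rule tendsto_divide)
      then have l1: "((\<lambda>y. (v y) / (w y)) \<longlongrightarrow> v' x / dI w x) (at x within {-1..1})"
        by (rule Lim_transform_eventually) (auto simp: eventually_at_filter vx True)
      have l2: "((\<lambda>y. (1 - y^2) * dI w y * v y) \<longlongrightarrow> (1 - x^2) * dI w x * v x) (at x within {-1..1})"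
        using has_dI2[OF C2 x] v[OF x]
        by (intro tendsto_intros) (auto dest!: DERIV_continuous simp: continuous_within)
      from tendsto_mult[OF l2 l1] show ?thesis
          unfolding continuous_within F_def using vx by (simp add: power2_eq_square mult.assoc)
    qed
  qed
  have "(F' has_integral (F 1 - F (-1))) {-1..1}"
  proof (rule fundamental_theorem_of_calculus_interior_strong[OF fin _ _ cF])
    fix x assume x: "x \<in> {-1<..<1} - {x. w x = 0}"
    then have "(F has_real_derivative F' x) (at x)" using dF[of x] by (simp add: at_within_I)
    then show "(F has_vector_derivative F' x) (at x)"
      by (simp only: has_real_derivative_iff_has_vector_derivative)
  qed simp
  then have IF: "(F' has_integral 0) {-1..1}" by (simp add: F_def)
  have "((\<lambda>x. (1 - x^2) * (v' x)^2 - X * (v x)^2 - F' x) has_integral (I1 - X * I2 - 0)) {-1..1}"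
    by (intro has_integral_diff has_integral_mult_right I1 I2 IF)
  moreover have "0 \<le> (1 - x^2) * (v' x)^2 - X * (v x)^2 - F' x" if "x \<in> {-1..1}" for x
  proof -
    have "(1 - x^2) * (v' x)^2 - X * (v x)^2 - F' x = (1 - x^2) * (v' x - dI w x / w x * v x)^2"
    proof -
      define r where "r = dI w x / w x"
      show ?thesis
        unfolding F'_def r_def[symmetric] by (simp add: power2_diff power_mult_distrib) (simp add: algebra_simps)
    qed
    moreover have "x^2 \<le> 1" using that by (simp add: abs_square_le_1 abs_le_iff)
    ultimately show ?thesis by simp
  qed
  ultimately have "0 \<le> I1 - X * I2 - 0" by (rule has_integral_nonneg)
  then show ?thesis by simp
qed

lemma chi_strict_mono: "pswf_system c \<psi> \<mu> chi \<Longrightarrow> strict_mono chi"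
  by (intro strict_monoI_Suc) (simp add: pswf_system_def)

text \<open>
  Among the combinations of \<open>\<psi> 0, \<dots>, \<psi> n\<close> there is a nonzero one
  that vanishes at the at most \<open>n\<close> zeros of the Legendre polynomial. Its energy is
  at most \<open>chi n\<close> times its squared norm, and by Picone's inequality at least
  \<open>n (n + 1)\<close> times.
\<close>

lemma chi_lower_bound:
  assumes sys: "pswf_system c \<psi> \<mu> chi"
  shows "real n * (real n + 1) \<le> chi n"
proof -
  define w where "w = (\<lambda>x. poly (legendre_poly n) (1 - x))"
  define X where "X = real n * (real n + 1)"
  have lz: "finite {x. w x = 0}" "card {x. w x = 0} \<le> n" "w (-1) \<noteq> 0"
    unfolding w_def by (rule legendre_zeros)+
  have lz3: "(1 - x^2) * (dI w x)^2 \<noteq> 0" if "-1 < x" "x \<le> 1" "w x = 0" for x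
    using legendre_zeros(3)[of x n] that unfolding w_def by blast
  define Z where "Z = {x. w x = 0}"
  have Z: "finite Z" "card Z < card {..n}" using lz(1,2) by (auto simp: Z_def)
  obtain s where s: "\<exists>j\<in>{..n}. s j \<noteq> 0" and sz: "\<forall>x\<in>Z. (\<Sum>j\<le>n. \<psi> j x * s j) = 0"
    using exists_nontrivial_kernel_vector[OF Z(1) finite_atMost Z(2), of "\<lambda>x j. \<psi> j x"] by auto
  define v where "v = (\<lambda>x. \<Sum>j\<le>n. s j * \<psi> j x)"
  define v' where "v' = (\<lambda>x. \<Sum>j\<le>n. s j * dI (\<psi> j) x)"
  have dv: "(v has_real_derivative v' x) (at x within {-1..1})" if "x \<in> {-1..1}" for x
    unfolding v_def v'_def by (rule pswf_combination_deriv[OF sys finite_atMost that])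
  have cv: "continuous_on {-1..1} v'"
    unfolding v'_def by (rule pswf_combination_cont[OF sys finite_atMost])
  have nv: "((\<lambda>x. (v x)^2) has_integral (\<Sum>j\<le>n. (s j)^2)) {-1..1}"
    unfolding v_def by (rule pswf_combination_norm[OF sys finite_atMost])
  have ev: "((\<lambda>x. (1 - x^2) * (v' x)^2 + c^2 * x^2 * (v x)^2) has_integral (\<Sum>j\<le>n. chi j * (s j)^2)) {-1..1}"
    unfolding v_def v'_def by (rule pswf_combination_energy[OF sys finite_atMost])
  have sol: "prolate_sol 0 X w" using legendre_sol(1)[of 1 n] by (simp add: w_def X_def)
  have cv': "continuous_on {-1..1} (\<lambda>x. (1 - x^2) * (v' x)^2)" by (intro continuous_intros cv)
  define I1 where "I1 = integral {-1..1} (\<lambda>x. (1 - x^2) * (v' x)^2)"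
  have I1: "((\<lambda>x. (1 - x^2) * (v' x)^2) has_integral I1) {-1..1}"
    unfolding I1_def by (rule integrable_integral[OF integrable_continuous_interval[OF cv']])
  have "X * (\<Sum>j\<le>n. (s j)^2) \<le> I1"
  proof (rule picone_inequality[OF sol lz(1)])
    show "w 1 \<noteq> 0" using coeff_legendre_poly[of n 0] by (simp add: w_def poly_0_coeff_0)
    show "w (-1) \<noteq> 0" by (rule lz(3))
    show "dI w x \<noteq> 0" if "-1 < x" "x < 1" "w x = 0" for x using lz3[OF that(1) less_imp_le[OF that(2)] that(3)] by simp
    show "(v has_real_derivative v' x) (at x within {-1..1})" if "x \<in> {-1..1}" for x by (rule dv[OF that])
    show "v x = 0" if "x \<in> {-1..1}" "w x = 0" for x using sz that by (simp add: Z_def v_def mult.commute)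
  qed (rule I1 nv)+
  also have "I1 \<le> (\<Sum>j\<le>n. chi j * (s j)^2)"
    by (rule has_integral_le[OF I1 ev]) simp
  also have "\<dots> \<le> (\<Sum>j\<le>n. chi n * (s j)^2)"
    using chi_strict_mono[OF sys] by (intro sum_mono mult_right_mono) (auto simp: strict_mono_less_eq)
  also have "\<dots> = chi n * (\<Sum>j\<le>n. (s j)^2)" by (simp add: sum_distrib_left)
  finally have "X * (\<Sum>j\<le>n. (s j)^2) \<le> chi n * (\<Sum>j\<le>n. (s j)^2)" .
  moreover have "(\<Sum>j\<le>n. (s j)^2) > 0" using s by (auto intro!: sum_pos2)
  ultimately show ?thesis by (simp add: X_def)
qed

section \<open>Min-max with functions cut at their zeros\<close>

lemma nodes_less:
  fixes X :: "nat \<Rightarrow> real"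
  assumes "\<And>j. j \<le> n \<Longrightarrow> X j < X (Suc j)" "i \<le> j" "j \<le> Suc n"
  shows "X i \<le> X j"
  using assms(2,3)
proof (induction j rule: dec_induct)
  case (step k)
  then show ?case using assms(1)[of k] by simp
qed simp

lemma sum_node_integrals_le:
  fixes X :: "nat \<Rightarrow> real" and e :: "real \<Rightarrow> real"
  assumes X: "\<And>j. j \<le> n \<Longrightarrow> X j < X (Suc j)" and in01: "-1 \<le> X 0" "X (Suc n) \<le> 1"
    and e: "continuous_on {-1..1} e" and pos: "\<And>x. x \<in> {-1..1} \<Longrightarrow> 0 \<le> e x"
  shows "(\<Sum>j\<le>n. integral {X j..X (Suc j)} e) \<le> integral {-1..1} e"
proof -
  have le: "X 0 \<le> X k" "X k \<le> X (Suc n)" if "k \<le> Suc n" for k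
    using nodes_less[of n X, OF X] that by auto
  have "(\<Sum>j\<le>k. integral {X j..X (Suc j)} e) = integral {X 0..X (Suc k)} e" if "k \<le> n" for k
    using that
  proof (induction k)
    case 0
    then show ?case by simp
  next
    case (Suc k)
    have "e integrable_on {X 0..X (Suc (Suc k))}"
      by (intro integrable_continuous_interval continuous_on_subset[OF e])
         (use le[of "Suc (Suc k)"] Suc.prems in01 in auto)
    moreover have "X 0 \<le> X (Suc k)" "X (Suc k) \<le> X (Suc (Suc k))"
      using le[of "Suc k"] X[of "Suc k"] Suc.prems by auto
    ultimately show ?case using Suc by (simp add: Henstock_Kurzweil_Integration.integral_combine)
  qed
  then have "(\<Sum>j\<le>n. integral {X j..X (Suc j)} e) = integral {X 0..X (Suc n)} e" by simp
  also have "\<dots> \<le> integral {-1..1} e"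
    by (rule integral_subset_le)
       (use in01 pos in \<open>auto intro!: integrable_continuous_interval continuous_on_subset[OF e]\<close>)
  finally show ?thesis .
qed

text \<open>
  Min-max principle. The restrictions of \<open>w\<close> to the \<open>n + 1\<close> intervals
  between its zeros have disjoint supports, so both quadratic forms are diagonal on their span,
  with quotient at most \<open>L\<close>. Some nonzero \<open>V\<close> in the span is
  orthogonal to \<open>\<psi> 0, \<dots>, \<psi> (n - 1)\<close>, and its energy is at least
  \<open>chi n\<close> times its squared norm. The last point is a Bessel inequality for the
  energy form, obtained from the nonnegative energy of the difference between \<open>V\<close>
  and its partial expansions; since \<open>V\<close> has kinks, all energies are computed
  interval by interval.
\<close>

lemma chi_le_by_nodal_functions:
  fixes X :: "nat \<Rightarrow> real"
  assumes sys: "pswf_system c \<psi> \<mu> chi"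
    and X: "\<And>j. j \<le> n \<Longrightarrow> X j < X (Suc j)" and in01: "-1 \<le> X 0" "X (Suc n) \<le> 1"
    and w: "\<And>x. x \<in> {X 0..X (Suc n)} \<Longrightarrow> (w has_real_derivative w' x) (at x within {X 0..X (Suc n)})"
    and pw: "\<And>x. x \<in> {X 0..X (Suc n)} \<Longrightarrow>
       ((\<lambda>x. (1 - x^2) * w' x) has_real_derivative r x) (at x within {X 0..X (Suc n)})"
    and cw': "continuous_on {X 0..X (Suc n)} w'"
    and le: "\<And>x. x \<in> {X 0..X (Suc n)} \<Longrightarrow> c^2 * x^2 * (w x)^2 - r x * w x \<le> L * (w x)^2"
    and zero: "\<And>j. j \<le> Suc n \<Longrightarrow> w (X j) = 0"
    and nz: "\<And>j. j \<le> n \<Longrightarrow> \<exists>x\<in>{X j..X (Suc j)}. w x \<noteq> 0"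
  shows "chi n \<le> L"
proof -
  define I where "I j = {X j..X (Suc j)}" for j
  have b: "orthonormal_basis_I \<psi>" using sys by (simp add: pswf_system_def)
  have C2: "C2_I (\<psi> k)" for k using sys by (simp add: pswf_system_def)
  have le0: "X 0 \<le> X k" "X k \<le> X (Suc n)" if "k \<le> Suc n" for k
    using nodes_less[of n X, OF X] that by auto
  have Isub: "I j \<subseteq> {X 0..X (Suc n)}" if "j \<le> n" for j
    using le0[of j] le0[of "Suc j"] that by (auto simp: I_def)
  have Isub1: "I j \<subseteq> {-1..1}" if "j \<le> n" for j
    using Isub[OF that] in01 by auto
  have cw: "continuous_on {X 0..X (Suc n)} w" using w by (rule DERIV_continuous_on)
  have cwI: "continuous_on (I j) w" "continuous_on (I j) w'" if "j \<le> n" for j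
    using continuous_on_subset[OF cw Isub[OF that]] continuous_on_subset[OF cw' Isub[OF that]] .
  have c\<psi>I: "continuous_on (I j) (\<psi> k)" "continuous_on (I j) (dI (\<psi> k))" if "j \<le> n" for j k
    using continuous_on_subset[OF C2_I_continuous(1)[OF C2] Isub1[OF that]]
      continuous_on_subset[OF C2_I_continuous(2)[OF C2] Isub1[OF that]] .
  have wI: "(w has_real_derivative w' x) (at x within I j)" if "j \<le> n" "x \<in> I j" for j x
    using w[of x] Isub[OF that(1)] that(2) by (meson DERIV_subset subsetD)
  define a where "a j k = integral (I j) (\<lambda>x. w x * \<psi> k x)" for j k
  define N where "N j = integral (I j) (\<lambda>x. (w x)^2)" for j
  define En where "En j = integral (I j) (\<lambda>x. (1 - x^2) * (w' x)^2 + c^2 * x^2 * (w x)^2)" for j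
  have ha: "((\<lambda>x. w x * \<psi> k x) has_integral a j k) (I j)" if "j \<le> n" for j k
    unfolding a_def I_def
    by (intro integrable_integral integrable_continuous_interval continuous_intros cwI[OF that, unfolded I_def] c\<psi>I[OF that, unfolded I_def])
  have hN: "((\<lambda>x. (w x)^2) has_integral N j) (I j)" if "j \<le> n" for j
    unfolding N_def I_def
    by (intro integrable_integral integrable_continuous_interval continuous_intros cwI[OF that, unfolded I_def])
  have hE: "((\<lambda>x. (1 - x^2) * (w' x)^2 + c^2 * x^2 * (w x)^2) has_integral En j) (I j)" if "j \<le> n" for j
    unfolding En_def I_def
    by (intro integrable_integral integrable_continuous_interval continuous_intros cwI[OF that, unfolded I_def])
  have Npos: "N j > 0" if "j \<le> n" for j
  proof -
    have "N j \<ge> 0" using hN[OF that] by (rule has_integral_nonneg) simp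
    moreover have "N j \<noteq> 0"
    proof
      assume "N j = 0"
      then have "\<forall>x\<in>{X j..X (Suc j)}. (w x)^2 = 0"
        unfolding N_def I_def
        by (subst (asm) integral_eq_0_iff)
           (use X[OF that] cwI[OF that] in \<open>auto intro!: continuous_intros simp: I_def\<close>)
      then show False using nz[OF that] by auto
    qed
    ultimately show ?thesis by simp
  qed
  have EN: "En j \<le> L * N j" if "j \<le> n" for j
  proof -
    have "((\<lambda>x. r x * w x + w' x * ((1 - x^2) * w' x)) has_integral
       (1 - (X (Suc j))^2) * w' (X (Suc j)) * w (X (Suc j)) - (1 - (X j)^2) * w' (X j) * w (X j)) (I j)"
      unfolding I_def
    proof (rule fundamental_theorem_of_calculus)
      show "X j \<le> X (Suc j)" using X[OF that] by simp
      fix x assume x: "x \<in> {X j..X (Suc j)}"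
      have "((\<lambda>x. (1 - x^2) * w' x) has_real_derivative r x) (at x within I j)"
        using pw[of x] Isub[OF that] x by (metis DERIV_subset I_def subsetD)
      from DERIV_mult[OF this wI[OF that x[folded I_def]]]
      show "((\<lambda>x. (1 - x^2) * w' x * w x) has_vector_derivative r x * w x + w' x * ((1 - x^2) * w' x))
         (at x within {X j..X (Suc j)})"
        by (simp only: has_real_derivative_iff_has_vector_derivative I_def)
    qed
    then have "((\<lambda>x. r x * w x + w' x * ((1 - x^2) * w' x)) has_integral 0) (I j)"
      using zero[of j] zero[of "Suc j"] that by simp
    from has_integral_diff[OF hE[OF that] this]
    have "((\<lambda>x. c^2 * x^2 * (w x)^2 - r x * w x) has_integral En j) (I j)"
      by (simp add: power2_eq_square algebra_simps)
    from has_integral_le[OF this has_integral_mult_right[OF hN[OF that]]]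
    show ?thesis using le Isub[OF that] by blast
  qed
  obtain s where s: "\<exists>j\<in>{..n}. s j \<noteq> 0" and sz: "\<forall>k\<in>{..<n}. (\<Sum>j\<le>n. a j k * s j) = 0"
    using exists_nontrivial_kernel_vector[of "{..<n}" "{..n}" "\<lambda>k j. a j k"] by auto
  \<comment> \<open>Adjacent closed intervals overlap in a node, where \<open>w\<close> vanishes, so the products of different pieces are zero everywhere.\<close>
  define piece where "piece j x = (if x \<in> I j then w x else 0)" for j x
  define V where "V x = (\<Sum>j\<le>n. s j * piece j x)" for x
  define bb where "bb k = (\<Sum>j\<le>n. s j * a j k)" for k
  have bb0: "bb k = 0" if "k < n" for k using sz that by (simp add: bb_def mult.commute)
  have pieceL: "(\<lambda>x. complex_of_real (piece j x)) \<in> L2_I" if "j \<le> n" for j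
  proof -
    interpret finite_measure leb_I by (rule finite_measure_leb_I)
    have "w \<in> borel_measurable (lebesgue_on (I j))"
      by (rule continuous_imp_measurable_on_sets_lebesgue[OF cwI(1)[OF that]]) (simp add: I_def)
    then have "(\<lambda>x. if x \<in> I j then w x else 0) \<in> borel_measurable lebesgue"
      by (rule borel_measurable_if_I) (simp add: I_def)
    then have m: "piece j \<in> borel_measurable leb_I"
      unfolding piece_def by (rule measurable_restrict_space1)
    have "bounded (w ` I j)"
      using cwI(1)[OF that] by (intro compact_imp_bounded compact_continuous_image) (auto simp: I_def)
    then obtain B where B: "\<forall>v\<in>w ` I j. norm v \<le> B" unfolding bounded_iff by blast
    have "integrable leb_I (\<lambda>x. (cmod (complex_of_real (piece j x)))^2)"
    proof (rule integrable_const_bound[where B = "B^2"])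
      show "AE x in leb_I. norm ((cmod (complex_of_real (piece j x)))^2) \<le> B^2"
      proof (rule AE_I2)
        fix x
        show "norm ((cmod (complex_of_real (piece j x)))^2) \<le> B^2"
        proof (cases "x \<in> I j")
          case True
          then have "\<bar>w x\<bar> \<le> B" using B by auto
          then have "\<bar>w x\<bar>\<^sup>2 \<le> B^2" by (intro power_mono) auto
          then show ?thesis using True by (simp add: piece_def)
        qed (simp add: piece_def)
      qed
    qed (use m in measurable)
    then show ?thesis using m by (auto simp: L2_I_def)
  qed
  have VL: "(\<lambda>x. complex_of_real (V x)) \<in> L2_I"
    using L2_I_sum[of "{..n}" "\<lambda>j x. complex_of_real (piece j x)" "\<lambda>j. of_real (s j)"] pieceL
    by (simp add: V_def)
  have pV: "pairing (\<psi> k) (\<lambda>x. of_real (V x)) = of_real (bb k)" for k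
  proof -
    have "integrable leb_I (\<lambda>x. Re (complex_of_real (\<psi> k x) * complex_of_real (V x)))"
      by (rule integrable_Re[OF L2_I_mult_integrable[OF basis_L2[OF b] VL]])
    then have i: "integrable leb_I (\<lambda>x. \<psi> k x * V x)" by simp
    have "((\<lambda>x. \<Sum>j\<le>n. s j * (if x \<in> I j then w x * \<psi> k x else 0)) has_integral bb k) {-1..1}"
      unfolding bb_def
      by (intro has_integral_sum has_integral_mult_right finite_atMost)
         (subst has_integral_restrict, use Isub1 ha in auto)
    moreover have "(\<Sum>j\<le>n. s j * (if x \<in> I j then w x * \<psi> k x else 0)) = \<psi> k x * V x" for x
      unfolding V_def piece_def sum_distrib_left by (intro sum.cong) auto
    ultimately have "integral {-1..1} (\<lambda>x. \<psi> k x * V x) = bb k" by (simp add: integral_unique)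
    then show ?thesis using pairing_real[OF i] by simp
  qed
  have disj: "piece i x * piece j x = 0" if "i < j" "j \<le> n" for i j x
  proof (cases "x \<in> I i \<and> x \<in> I j")
    case True
    have "X (Suc i) \<le> X j" using nodes_less[of n X "Suc i" j, OF X] that by auto
    then have "x = X j" using True by (auto simp: I_def)
    then have "w x = 0" using zero[of j] that by simp
    then show ?thesis by (simp add: piece_def)
  qed (auto simp: piece_def)
  have V2: "(V x)^2 = (\<Sum>j\<le>n. (s j)^2 * (if x \<in> I j then (w x)^2 else 0))" for x
  proof -
    have "(V x)^2 = (\<Sum>i\<le>n. \<Sum>j\<le>n. s i * s j * (piece i x * piece j x))"
      unfolding V_def power2_eq_square sum_product by (intro sum.cong) auto
    also have "\<dots> = (\<Sum>i\<le>n. \<Sum>j\<le>n. if j = i then (s i)^2 * (piece i x)^2 else 0)"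
    proof (intro sum.cong refl)
      fix i j assume "i \<in> {..n}" "j \<in> {..n}"
      then show "s i * s j * (piece i x * piece j x) = (if j = i then (s i)^2 * (piece i x)^2 else 0)"
        using disj[of i j x] disj[of j i x] by (cases i j rule: linorder_cases) (auto simp: power2_eq_square)
    qed
    also have "\<dots> = (\<Sum>j\<le>n. (s j)^2 * (if x \<in> I j then (w x)^2 else 0))"
    proof -
      have "(piece i x)^2 = (if x \<in> I i then (w x)^2 else 0)" for i by (simp add: piece_def)
      then show ?thesis by simp
    qed
    finally show ?thesis .
  qed
  define S where "S = (\<Sum>j\<le>n. (s j)^2 * N j)"
  have nV: "(L2_norm (\<lambda>x. of_real (V x)))^2 = S"
  proof -
    have "((\<lambda>x. \<Sum>j\<le>n. (s j)^2 * (if x \<in> I j then (w x)^2 else 0)) has_integral S) {-1..1}"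
      unfolding S_def
      by (intro has_integral_sum has_integral_mult_right finite_atMost)
         (subst has_integral_restrict, use Isub1 hN in auto)
    then have "integral {-1..1} (\<lambda>x. (V x)^2) = S" by (simp add: V2 integral_unique)
    moreover have "integrable leb_I (\<lambda>x. (V x)^2)" using VL by (simp add: L2_I_def)
    ultimately show ?thesis by (simp add: L2_norm_sq lebesgue_integral_eq_integral)
  qed
  have Spos: "S > 0"
  proof -
    obtain j where j: "j \<le> n" "s j \<noteq> 0" using s by auto
    have "0 \<le> (s i)^2 * N i" if "i \<le> n" for i using Npos[OF that] by simp
    moreover have "0 < (s j)^2 * N j" using j Npos[of j] by simp
    ultimately show ?thesis unfolding S_def using j by (intro sum_pos2[of _ j]) auto
  qed
  have main: "(\<Sum>k<K. chi k * (bb k)^2) \<le> L * S" for K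
  proof -
    define \<sigma> where "\<sigma> = (\<lambda>x. \<Sum>k<K. bb k * \<psi> k x)"
    define \<sigma>' where "\<sigma>' = (\<lambda>x. \<Sum>k<K. bb k * dI (\<psi> k) x)"
    define e where "e x = (1 - x^2) * (\<sigma>' x)^2 + c^2 * x^2 * (\<sigma> x)^2" for x
    have ce: "continuous_on {-1..1} e"
      unfolding e_def \<sigma>_def \<sigma>'_def by (intro continuous_intros C2_I_continuous[OF C2])
    have ie: "integral {-1..1} e = (\<Sum>k<K. chi k * (bb k)^2)"
      unfolding e_def \<sigma>_def \<sigma>'_def
      by (rule integral_unique[OF pswf_combination_energy[OF sys finite_lessThan]])
    have p0: "0 \<le> 1 - x^2" if "x \<in> {-1..1}" for x :: real
      using that by (simp add: abs_square_le_1 abs_le_iff)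
    have cross: "((\<lambda>x. (1 - x^2) * w' x * \<sigma>' x + c^2 * x^2 * w x * \<sigma> x) has_integral
        (\<Sum>k<K. bb k * (chi k * a j k))) (I j)" if "j \<le> n" for j
    proof -
      have "((\<lambda>x. (1 - x^2) * w' x * dI (\<psi> k) x + c^2 * x^2 * w x * \<psi> k x) has_integral chi k * a j k) (I j)" for k
      proof -
        have "((\<lambda>x. (1 - x^2) * w' x * dI (\<psi> k) x + (c^2 * x^2 - chi k) * w x * \<psi> k x) has_integral
            ((1 - (X (Suc j))^2) * dI (\<psi> k) (X (Suc j)) * w (X (Suc j)) - (1 - (X j)^2) * dI (\<psi> k) (X j) * w (X j))) {X j..X (Suc j)}"
          by (rule energy_identity[OF pswf_prolate_sol[OF sys]])
             (use le0[of j] le0[of "Suc j"] in01 X[OF that] that wI[OF that] in \<open>auto simp: I_def\<close>)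
        then have "((\<lambda>x. (1 - x^2) * w' x * dI (\<psi> k) x + (c^2 * x^2 - chi k) * w x * \<psi> k x) has_integral 0) (I j)"
          using zero[of j] zero[of "Suc j"] that by (simp add: I_def)
        from has_integral_add[OF this has_integral_mult_right[OF ha[OF that, of k], of "chi k"]]
        show ?thesis by (simp add: algebra_simps)
      qed
      then have "((\<lambda>x. \<Sum>k<K. bb k * ((1 - x^2) * w' x * dI (\<psi> k) x + c^2 * x^2 * w x * \<psi> k x)) has_integral
        (\<Sum>k<K. bb k * (chi k * a j k))) (I j)"
        by (intro has_integral_sum has_integral_mult_right finite_lessThan)
      moreover have "(\<Sum>k<K. bb k * ((1 - x^2) * w' x * dI (\<psi> k) x + c^2 * x^2 * w x * \<psi> k x))
        = (1 - x^2) * w' x * \<sigma>' x + c^2 * x^2 * w x * \<sigma> x" for x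
        unfolding \<sigma>_def \<sigma>'_def sum_distrib_left sum.distrib[symmetric]
        by (intro sum.cong) (auto simp: algebra_simps)
      ultimately show ?thesis by simp
    qed
    have part: "0 \<le> (s j)^2 * En j - 2 * s j * (\<Sum>k<K. bb k * (chi k * a j k)) + integral (I j) e" if "j \<le> n" for j
    proof -
      have "(e has_integral integral (I j) e) (I j)"
        unfolding I_def
        by (intro integrable_integral integrable_continuous_interval continuous_on_subset[OF ce] Isub1[OF that, unfolded I_def])
      from has_integral_add[OF has_integral_diff[OF has_integral_mult_right[OF hE[OF that], of "(s j)^2"]
          has_integral_mult_right[OF cross[OF that], of "2 * s j"]] this]
      show ?thesis
      proof (rule has_integral_nonneg)
        fix x assume "x \<in> I j"
        then have p: "0 \<le> 1 - x^2" using Isub1[OF that] p0 by blast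
        have "(s j)^2 * ((1 - x^2) * (w' x)^2 + c^2 * x^2 * (w x)^2)
           - 2 * s j * ((1 - x^2) * w' x * \<sigma>' x + c^2 * x^2 * w x * \<sigma> x) + e x
           = (1 - x^2) * (s j * w' x - \<sigma>' x)^2 + c^2 * x^2 * (s j * w x - \<sigma> x)^2"
          unfolding e_def by (simp add: power2_eq_square algebra_simps)
        then show "0 \<le> (s j)^2 * ((1 - x^2) * (w' x)^2 + c^2 * x^2 * (w x)^2)
           - 2 * s j * ((1 - x^2) * w' x * \<sigma>' x + c^2 * x^2 * w x * \<sigma> x) + e x"
          using p by simp
      qed
    qed
    have "0 \<le> (\<Sum>j\<le>n. (s j)^2 * En j - 2 * s j * (\<Sum>k<K. bb k * (chi k * a j k)) + integral (I j) e)"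
      by (intro sum_nonneg part) simp
    also have "\<dots> = (\<Sum>j\<le>n. (s j)^2 * En j) - 2 * (\<Sum>j\<le>n. s j * (\<Sum>k<K. bb k * (chi k * a j k)))
        + (\<Sum>j\<le>n. integral (I j) e)"
      by (simp add: sum.distrib sum_subtractf sum_distrib_left mult.assoc)
    also have "(\<Sum>j\<le>n. s j * (\<Sum>k<K. bb k * (chi k * a j k))) = (\<Sum>k<K. chi k * (bb k)^2)"
    proof -
      have "(\<Sum>j\<le>n. s j * (\<Sum>k<K. bb k * (chi k * a j k))) = (\<Sum>k<K. \<Sum>j\<le>n. bb k * chi k * (s j * a j k))"
        unfolding sum_distrib_left by (subst sum.swap) (intro sum.cong; simp add: mult_ac)
      also have "\<dots> = (\<Sum>k<K. chi k * (bb k)^2)"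
        unfolding sum_distrib_left[symmetric] bb_def[symmetric] by (simp add: power2_eq_square mult_ac)
      finally show ?thesis .
    qed
    finally have "0 \<le> (\<Sum>j\<le>n. (s j)^2 * En j) - 2 * (\<Sum>k<K. chi k * (bb k)^2) + (\<Sum>j\<le>n. integral (I j) e)" .
    moreover have "(\<Sum>j\<le>n. integral (I j) e) \<le> (\<Sum>k<K. chi k * (bb k)^2)"
      unfolding ie[symmetric] I_def
      by (rule sum_node_integrals_le[OF X in01 ce]) (use p0 in \<open>auto simp: e_def\<close>)
    moreover have "(\<Sum>j\<le>n. (s j)^2 * En j) \<le> L * S"
      unfolding S_def sum_distrib_left
    proof (rule sum_mono)
      fix j assume "j \<in> {..n}"
      then have "(s j)^2 * En j \<le> (s j)^2 * (L * N j)" using EN[of j] by (intro mult_left_mono) auto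
      then show "(s j)^2 * En j \<le> L * ((s j)^2 * N j)" by (simp add: mult_ac)
    qed
    ultimately show ?thesis by linarith
  qed
  have lower: "chi n * (\<Sum>k<K. (bb k)^2) \<le> L * S" for K
  proof -
    have "chi n * (\<Sum>k<K. (bb k)^2) \<le> (\<Sum>k<K. chi k * (bb k)^2)"
      unfolding sum_distrib_left
    proof (rule sum_mono)
      fix k
      show "chi n * (bb k)^2 \<le> chi k * (bb k)^2"
        using chi_strict_mono[OF sys] bb0[of k]
        by (cases "k < n") (auto intro!: mult_right_mono simp: strict_mono_less_eq)
    qed
    then show ?thesis using main[of K] by linarith
  qed
  have "(\<lambda>k. (bb k)^2) sums S" using parseval[OF b VL] by (simp add: pV nV)
  then have "(\<lambda>K. chi n * (\<Sum>k<K. (bb k)^2)) \<longlonglongrightarrow> chi n * S"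
    unfolding sums_def by (rule tendsto_mult_left)
  then have "chi n * S \<le> L * S" by (rule LIMSEQ_le_const2) (use lower in blast)
  then show ?thesis using Spos by simp
qed

section \<open>Upper bound for the eigenvalues of the differential operator\<close>

text \<open>
  With \<open>x = cos \<theta>\<close>, the WKB trial function is \<open>sin \<Phi> / sqrt
  (\<Phi>' sin \<theta>)\<close> for the explicit phase \<open>\<Phi> = m \<theta> + b sin (2
  \<theta>)\<close>. Its phase velocity \<open>\<Phi>' = m + 2 b cos (2 \<theta>)\<close> is
  \<open>osc_rate\<close>. In terms of \<open>D = (1 - x\<^sup>2) d/dx\<close>,
  \<open>osc_density\<close> is \<open>- D \<Phi>\<close>, \<open>osc_logder\<close> is the
  logarithmic derivative of the density under \<open>D\<close>, and \<open>osc_flux\<close> is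
  \<open>D osc\<close>.
\<close>

definition osc_rate :: "real \<Rightarrow> real \<Rightarrow> real \<Rightarrow> real" where
  "osc_rate m b x = m + 2 * b * (2 * x^2 - 1)"

definition osc_phase :: "real \<Rightarrow> real \<Rightarrow> real \<Rightarrow> real" where
  "osc_phase m b x = m * arccos x + 2 * b * (x * sqrt (1 - x^2))"

definition osc_density :: "real \<Rightarrow> real \<Rightarrow> real \<Rightarrow> real" where
  "osc_density m b x = sqrt (1 - x^2) * osc_rate m b x"

definition osc_logder :: "real \<Rightarrow> real \<Rightarrow> real \<Rightarrow> real" where
  "osc_logder m b x = - x + 8 * b * (x * (1 - x^2)) / osc_rate m b x"

definition osc_logder' :: "real \<Rightarrow> real \<Rightarrow> real \<Rightarrow> real" where
  "osc_logder' m b x = - 1 + 8 * b * (1 - 3 * x^2) / osc_rate m b x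
     - 64 * b^2 * (x^2 * (1 - x^2)) / (osc_rate m b x)^2"

definition osc :: "real \<Rightarrow> real \<Rightarrow> real \<Rightarrow> real" where
  "osc m b x = osc_density m b x powr (- 1/2) * sin (osc_phase m b x)"

definition osc_flux :: "real \<Rightarrow> real \<Rightarrow> real \<Rightarrow> real" where
  "osc_flux m b x = osc_density m b x powr (- 1/2) *
     (- (1/2) * osc_logder m b x * sin (osc_phase m b x) - osc_density m b x * cos (osc_phase m b x))"

lemma one_minus_square_pos: "-1 < x \<Longrightarrow> x < 1 \<Longrightarrow> 0 < 1 - (x::real)^2"
  by (simp add: abs_square_less_1)

text \<open>
  The amplitude is the inverse square root of the density. Exactly this choice cancels the
  cosine terms in \<open>D (D osc)\<close>, so that \<open>osc\<close> solves a Sturm-Liouville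
  equation exactly, with an explicit potential.
\<close>

lemma osc_derivs:
  assumes x: "-1 < x" "x < 1" and rate: "0 < osc_rate m b x"
  shows osc_phase_deriv: "(osc_phase m b has_real_derivative - osc_density m b x / (1 - x^2)) (at x)"
    and osc_deriv: "(osc m b has_real_derivative osc_flux m b x / (1 - x^2)) (at x)"
    and osc_flux_deriv: "(osc_flux m b has_real_derivative
       ((osc_logder m b x)^2 / 4 - osc_logder' m b x * (1 - x^2) / 2 - (osc_density m b x)^2) / (1 - x^2) * osc m b x) (at x)"
proof -
  define p s f h g g1 A t where "p = 1 - x^2" and "s = sqrt p" and "f = osc_rate m b x"
    and "h = osc_density m b x" and "g = osc_logder m b x" and "g1 = osc_logder' m b x"
    and "A = osc_density m b x powr (- 1/2)" and "t = osc_phase m b x"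
  have p: "p > 0" using one_minus_square_pos[OF x] by (simp add: p_def)
  have s: "s > 0" "s * s = p" using p by (auto simp: s_def)
  have f: "f > 0" using rate by (simp add: f_def)
  have h: "h = s * f" "h > 0" using s f by (simp_all add: h_def osc_density_def s_def p_def f_def)
  have g: "g = - x + 8 * b * (x * p) / f" by (simp add: g_def osc_logder_def p_def f_def)
  have dp: "((\<lambda>x. 1 - x^2) has_real_derivative - 2 * x) (at x)" by (auto intro!: derivative_eq_intros)
  have ds: "((\<lambda>x. sqrt (1 - x^2)) has_real_derivative - x / s) (at x)"
    by (rule DERIV_cong[OF DERIV_chain2[OF DERIV_real_sqrt dp]])
       (use p s in \<open>auto simp: s_def p_def field_simps\<close>)
  have df: "(osc_rate m b has_real_derivative 8 * b * x) (at x)"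
    unfolding osc_rate_def by (auto intro!: derivative_eq_intros)
  have e1: "- x / s * f + 8 * b * x * s = h * g / p"
  proof -
    have "h * g / p = (s * f) * (- x) / (s * s) + (s * f) * (8 * b * (x * p) / f) / p"
      unfolding h(1) g distrib_left add_divide_distrib s(2) by simp
    also have "(s * f) * (8 * b * (x * p) / f) / p = 8 * b * x * s" using p f by simp
    also have "(s * f) * (- x) / (s * s) = - x / s * f" using s(1) by simp
    finally show ?thesis by simp
  qed
  have dh: "(osc_density m b has_real_derivative h * g / p) (at x)"
    unfolding osc_density_def e1[symmetric]
    by (rule DERIV_cong[OF DERIV_mult[OF ds df]]) (simp add: f_def s_def p_def)
  show dt: "(osc_phase m b has_real_derivative - osc_density m b x / (1 - x^2)) (at x)"
  proof -
    have dac: "(arccos has_real_derivative - 1 / s) (at x)"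
      using DERIV_arccos[OF x] by (simp add: s_def p_def inverse_eq_divide)
    have "(osc_phase m b has_real_derivative m * (- 1 / s) + 2 * b * (1 * s + (- x / s) * x)) (at x)"
      unfolding osc_phase_def
      by (rule DERIV_cong[OF DERIV_add[OF DERIV_cmult[OF dac] DERIV_cmult[OF DERIV_mult[OF DERIV_ident ds]]]])
         (simp add: s_def p_def)
    also have "m * (- 1 / s) + 2 * b * (1 * s + (- x / s) * x) = (- m + 2 * b * (s * s - x * x)) / s"
      using s(1) by (simp add: field_simps)
    also have "\<dots> = - f / s" unfolding s(2) f_def osc_rate_def p_def by (simp add: power2_eq_square algebra_simps)
    also have "\<dots> = - h / p" unfolding h(1) s(2)[symmetric] using s(1) by simp
    finally show ?thesis by (simp add: h_def p_def)
  qed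
  then have dt': "(osc_phase m b has_real_derivative - h / p) (at x)" by (simp add: h_def p_def)
  have dA: "((\<lambda>x. osc_density m b x powr (- 1/2)) has_real_derivative - (1/2) * A * g / p) (at x)"
  proof -
    define q where "q = h powr (- 1/2 - 1)"
    have "((\<lambda>x. osc_density m b x powr (- 1/2)) has_real_derivative (- 1/2) * q * (h * g / p)) (at x)"
      unfolding q_def
      by (rule DERIV_chain2[OF has_real_derivative_powr dh, of "- 1/2", folded h_def]) (use h in \<open>simp add: h_def\<close>)
    also have "(- 1/2) * q * (h * g / p) = - (1/2) * (q * h) * g / p" by simp
    also have "q * h = A"
      using h(2) powr_add[of h "- 1/2 - 1" 1] unfolding q_def A_def h_def by simp
    finally show ?thesis .
  qed
  have dsin: "((\<lambda>x. sin (osc_phase m b x)) has_real_derivative cos t * (- h / p)) (at x)"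
    unfolding t_def by (rule DERIV_chain2[OF DERIV_sin dt'])
  have dcos: "((\<lambda>x. cos (osc_phase m b x)) has_real_derivative - sin t * (- h / p)) (at x)"
    unfolding t_def by (rule DERIV_chain2[OF DERIV_cos dt'])
  have "(osc m b has_real_derivative - (1/2) * A * g / p * sin t + cos t * (- h / p) * A) (at x)"
    unfolding osc_def using DERIV_mult[OF dA dsin] by (simp add: A_def t_def)
  also have "- (1/2) * A * g / p * sin t + cos t * (- h / p) * A = A * (- (1/2) * g * sin t - h * cos t) / p"
    by (simp add: diff_divide_distrib algebra_simps)
  finally show "(osc m b has_real_derivative osc_flux m b x / (1 - x^2)) (at x)"
    by (simp add: osc_flux_def A_def g_def t_def h_def p_def)
  have dg: "(osc_logder m b has_real_derivative g1) (at x)"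
  proof -
    have "(osc_logder m b has_real_derivative - 1 + (8 * b * (1 * p + (- 2 * x) * x) * f - 8 * b * (x * p) * (8 * b * x)) / (f * f)) (at x)"
      unfolding osc_logder_def
      by (rule DERIV_cong[OF DERIV_add[OF DERIV_minus[OF DERIV_ident]
            DERIV_divide[OF DERIV_cmult[OF DERIV_mult[OF DERIV_ident dp]] df]]])
         (use f in \<open>auto simp: f_def p_def\<close>)
    also have "(8 * b * (1 * p + (- 2 * x) * x) * f - 8 * b * (x * p) * (8 * b * x)) / (f * f)
       = 8 * b * (1 * p + (- 2 * x) * x) / f - 64 * b^2 * (x^2 * p) / f^2"
      using f by (simp add: diff_divide_distrib power2_eq_square mult_ac)
    also have "1 * p + (- 2 * x) * x = 1 - 3 * x^2" by (simp add: p_def power2_eq_square)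
    also have "- 1 + (8 * b * (1 - 3 * x^2) / f - 64 * b^2 * (x^2 * p) / f^2) = g1"
      unfolding g1_def osc_logder'_def f_def[symmetric] p_def[symmetric] by linarith
    finally show ?thesis .
  qed
  have "((\<lambda>x. - (1/2) * osc_logder m b x * sin (osc_phase m b x) - osc_density m b x * cos (osc_phase m b x)) has_real_derivative
      ((- (1/2) * g1) * sin t + cos t * (- h / p) * (- (1/2) * g) - (h * g / p * cos t + - sin t * (- h / p) * h))) (at x)"
    by (rule DERIV_cong[OF DERIV_diff[OF DERIV_mult[OF DERIV_cmult[OF dg] dsin] DERIV_mult[OF dh dcos]]])
       (simp add: t_def h_def g_def)
  from DERIV_mult[OF dA this]
  have "(osc_flux m b has_real_derivative (- (1/2) * A * g / p) * (- (1/2) * g * sin t - h * cos t)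
      + ((- (1/2) * g1) * sin t + cos t * (- h / p) * (- (1/2) * g) - (h * g / p * cos t + - sin t * (- h / p) * h)) * A) (at x)"
    unfolding osc_flux_def by (simp add: A_def t_def h_def g_def)
  also have "(- (1/2) * A * g / p) * (- (1/2) * g * sin t - h * cos t)
      + ((- (1/2) * g1) * sin t + cos t * (- h / p) * (- (1/2) * g) - (h * g / p * cos t + - sin t * (- h / p) * h)) * A
      = (g^2 / 4 - g1 * p / 2 - h^2) / p * (A * sin t)"
    using p by (simp add: field_simps power2_eq_square)
  finally show "(osc_flux m b has_real_derivative
       ((osc_logder m b x)^2 / 4 - osc_logder' m b x * (1 - x^2) / 2 - (osc_density m b x)^2) / (1 - x^2) * osc m b x) (at x)"
    by (simp add: osc_def A_def g_def g1_def t_def h_def p_def)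
qed

lemma osc_rate_lower:
  assumes "0 < m" "b \<le> 0" "2 * \<bar>b\<bar> \<le> 9/16 * m" "-1 \<le> x" "x \<le> 1"
  shows "7/16 * m \<le> osc_rate m b x"
proof -
  have "x^2 \<le> 1" using assms by (simp add: abs_square_le_1 abs_le_iff)
  then have "2 * x^2 - 1 \<le> 1" by simp
  then have "2 * b * 1 \<le> 2 * b * (2 * x^2 - 1)" using assms by (intro mult_left_mono_neg) auto
  then show ?thesis using assms unfolding osc_rate_def by linarith
qed

text \<open>
  The choice \<open>b = - c\<^sup>2 / (8 m)\<close> makes the cross term of \<open>(m + 2 b cos
  (2 \<theta>))\<^sup>2\<close> cancel the oscillating half of \<open>c\<^sup>2 cos\<^sup>2
  \<theta> = c\<^sup>2 / 2 + (c\<^sup>2 / 2) cos (2 \<theta>)\<close>. The remainder \<open>4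
  b\<^sup>2 cos\<^sup>2 (2 \<theta>)\<close> is at most \<open>c\<^sup>4 / (16
  m\<^sup>2)\<close>, and the derivatives of the amplitude contribute a bounded amount.
\<close>

lemma osc_potential_bound:
  assumes m: "0 < m" and c: "c^2 \<le> 9/4 * m^2" and b: "b = - (c^2 / (8 * m))" and x: "-1 < x" "x < 1"
  shows "c^2 * x^2 - ((osc_logder m b x)^2 / 4 - osc_logder' m b x * (1 - x^2) / 2 - (osc_density m b x)^2) / (1 - x^2)
     \<le> m^2 + c^2 / 2 + c ^ 4 / (16 * m^2) + 6"
proof -
  define p f where "p = 1 - x^2" and "f = osc_rate m b x"
  have p: "p > 0" using one_minus_square_pos[OF x] by (simp add: p_def)
  have b0: "b \<le> 0" "2 * \<bar>b\<bar> \<le> 9/16 * m" using m c by (auto simp: b field_simps power2_eq_square)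
  have f: "7/16 * m \<le> f" unfolding f_def using osc_rate_lower[OF m b0] x by simp
  then have f0: "f > 0" using m by linarith
  have "((osc_logder m b x)^2 / 4 - osc_logder' m b x * p / 2 - (osc_density m b x)^2) / p
     = (osc_logder m b x)^2 / 4 / p - osc_logder' m b x / 2 - f^2"
    using p by (simp add: diff_divide_distrib osc_density_def p_def[symmetric] f_def[symmetric] power_mult_distrib)
  moreover have "0 \<le> (osc_logder m b x)^2 / 4 / p" using p by simp
  moreover have "osc_logder' m b x / 2 \<le> 6"
  proof -
    have "0 \<le> 64 * b^2 * (x^2 * p) / f^2" using p by simp
    then have "osc_logder' m b x \<le> 8 * b * (1 - 3 * x^2) / f"
      unfolding osc_logder'_def f_def[symmetric] p_def[symmetric] by linarith
    also have "\<dots> \<le> 16 * \<bar>b\<bar> / f"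
    proof (rule divide_right_mono)
      have "x^2 < 1" using p by (simp add: p_def)
      then have "\<bar>1 - 3 * x^2\<bar> \<le> 2" using zero_le_power2[of x] by linarith
      then have "\<bar>8 * b\<bar> * \<bar>1 - 3 * x^2\<bar> \<le> \<bar>8 * b\<bar> * 2" by (intro mult_left_mono) auto
      then have "\<bar>8 * b * (1 - 3 * x^2)\<bar> \<le> 16 * \<bar>b\<bar>" by (simp add: abs_mult)
      then show "8 * b * (1 - 3 * x^2) \<le> 16 * \<bar>b\<bar>" by linarith
    qed (use f0 in simp)
    also have "\<dots> \<le> 12" using b0(2) f f0 m by (simp add: field_simps)
    finally show ?thesis by simp
  qed
  moreover have "c^2 * x^2 + f^2 \<le> m^2 + c^2 / 2 + c ^ 4 / (16 * m^2)"
  proof -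
    have "x^2 < 1" using p by (simp add: p_def)
    then have "\<bar>2 * x^2 - 1\<bar> \<le> 1" using zero_le_power2[of x] by linarith
    then have y: "(2 * x^2 - 1)^2 \<le> 1" by (simp add: abs_square_le_1)
    have "f^2 = m^2 + 4 * (m * b) * (2 * x^2 - 1) + 4 * b^2 * (2 * x^2 - 1)^2"
      unfolding f_def osc_rate_def by (simp add: power2_eq_square algebra_simps)
    moreover have "4 * (m * b) * (2 * x^2 - 1) = c^2 / 2 - c^2 * x^2"
      using m by (simp add: b algebra_simps)
    moreover have "4 * b^2 * (2 * x^2 - 1)^2 \<le> 4 * b^2 * 1" using y by (intro mult_left_mono) auto
    moreover have "4 * b^2 = c ^ 4 / (16 * m^2)"
      using m by (simp add: b power_divide power_mult_distrib power2_eq_square power4_eq_xxxx)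
    ultimately show ?thesis by linarith
  qed
  ultimately show ?thesis unfolding p_def[symmetric] by linarith
qed

text \<open>
  The phase runs from \<open>0\<close> to \<open>m \<pi>\<close>, so with \<open>m = n +
  3\<close> there are \<open>n + 2\<close> interior zeros and \<open>n + 1\<close> intervals
  between them. The two outermost intervals are left out because the derivative of the trial
  function is unbounded at the end points.
\<close>

lemma chi_upper_bound:
  assumes sys: "pswf_system c \<psi> \<mu> chi" and m: "m = real n + 3" and c: "c^2 \<le> 9/4 * m^2"
  shows "chi n \<le> m^2 + c^2 / 2 + c ^ 4 / (16 * m^2) + 6"
proof -
  define b where "b = - (c^2 / (8 * m))"
  have m0: "m > 0" using m by simp
  have b0: "b \<le> 0" "2 * \<bar>b\<bar> \<le> 9/16 * m" using m0 c by (auto simp: b_def field_simps power2_eq_square)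
  have rate: "0 < osc_rate m b x" if "-1 < x" "x < 1" for x
    using osc_rate_lower[OF m0 b0, of x] that m0 by simp
  define F where "F = osc_phase m b"
  have cF: "continuous_on {-1..1} F"
    unfolding F_def osc_phase_def by (intro continuous_intros continuous_on_arccos') auto
  have F1: "F 1 = 0" "F (-1) = m * pi" by (simp_all add: F_def osc_phase_def)
  have dec: "F y < F x" if "-1 \<le> x" "x < y" "y \<le> 1" for x y
  proof (rule DERIV_neg_imp_decreasing_open[OF that(2)])
    fix z assume z: "x < z" "z < y"
    then have z1: "-1 < z" "z < 1" using that by auto
    have "osc_density m b z > 0" using rate[OF z1] one_minus_square_pos[OF z1] by (simp add: osc_density_def)
    then have "- osc_density m b z / (1 - z^2) < 0" using one_minus_square_pos[OF z1] by simp
    then show "\<exists>d. (F has_real_derivative d) (at z) \<and> d < 0"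
      using osc_phase_deriv[OF z1 rate[OF z1]] unfolding F_def by (intro exI conjI)
  qed (use that in \<open>auto intro: continuous_on_subset[OF cF]\<close>)
  have "\<exists>y. -1 < y \<and> y < 1 \<and> F y = real k * pi" if "1 \<le> k" "k \<le> n + 2" for k
  proof -
    have "real k \<le> m" using that m by simp
    then have "real k * pi \<le> m * pi" by (intro mult_right_mono) auto
    then obtain y where y: "-1 \<le> y" "y \<le> 1" "F y = real k * pi"
      using IVT2'[of F 1 "real k * pi" "-1"] cF F1 by auto
    moreover have "y \<noteq> 1" using y F1 that by auto
    moreover have "y \<noteq> -1" using y F1 that m by auto
    ultimately show ?thesis by (intro exI[of _ y]) auto
  qed
  then obtain Y where Y: "\<And>k. 1 \<le> k \<Longrightarrow> k \<le> n + 2 \<Longrightarrow> -1 < Y k \<and> Y k < 1 \<and> F (Y k) = real k * pi"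
    by metis
  \<comment> \<open>The phase decreases in \<open>x\<close>, so the node with phase \<open>k \<pi>\<close> moves to the left as \<open>k\<close> grows.\<close>
  define X where "X j = Y (n + 2 - j)" for j
  have X01: "-1 < X j" "X j < 1" and FX: "F (X j) = (real n + 2 - real j) * pi" if "j \<le> Suc n" for j
    using Y[of "n + 2 - j"] that by (auto simp: X_def of_nat_diff)
  have Xs: "X j < X (Suc j)" if "j \<le> n" for j
  proof (rule ccontr)
    assume "\<not> X j < X (Suc j)"
    then have "X (Suc j) = X j \<or> X (Suc j) < X j" by auto
    then have "F (X j) \<le> F (X (Suc j))"
      using dec[of "X (Suc j)" "X j"] X01[of j] X01[of "Suc j"] that by auto
    moreover have "F (X j) - F (X (Suc j)) = pi" using FX[of j] FX[of "Suc j"] that by (simp add: algebra_simps)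
    ultimately show False using pi_gt_zero by linarith
  qed
  define J where "J = {X 0..X (Suc n)}"
  have Jin: "-1 < x" "x < 1" if "x \<in> J" for x using that X01[of 0] X01[of "Suc n"] by (auto simp: J_def)
  define r where "r x = ((osc_logder m b x)^2 / 4 - osc_logder' m b x * (1 - x^2) / 2 - (osc_density m b x)^2) / (1 - x^2) * osc m b x" for x
  have dz: "(osc_flux m b has_real_derivative r x) (at x within J)" if "x \<in> J" for x
    unfolding r_def by (rule has_field_derivative_at_within[OF osc_flux_deriv[OF Jin[OF that] rate[OF Jin[OF that]]]])
  show ?thesis
  proof (rule chi_le_by_nodal_functions[OF sys, where X = X and w = "osc m b" and w' = "\<lambda>x. osc_flux m b x / (1 - x^2)" and r = r])
    show "X j < X (Suc j)" if "j \<le> n" for j by (rule Xs[OF that])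
    show "-1 \<le> X 0" "X (Suc n) \<le> 1" using X01[of 0] X01[of "Suc n"] by auto
    show "(osc m b has_real_derivative osc_flux m b x / (1 - x^2)) (at x within {X 0..X (Suc n)})"
      if "x \<in> {X 0..X (Suc n)}" for x
      using that by (intro has_field_derivative_at_within[OF osc_deriv] rate Jin) (auto simp: J_def)
    show "((\<lambda>x. (1 - x^2) * (osc_flux m b x / (1 - x^2))) has_real_derivative r x) (at x within {X 0..X (Suc n)})"
      if x: "x \<in> {X 0..X (Suc n)}" for x
    proof -
      have "(1 - y^2) * (osc_flux m b y / (1 - y^2)) = osc_flux m b y" if "y \<in> J" for y
        using one_minus_square_pos[OF Jin[OF that]] by simp
      then show ?thesis using dz[of x] x unfolding has_field_derivative_def J_def
        by (rule_tac has_derivative_transform) auto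
    qed
    show "continuous_on {X 0..X (Suc n)} (\<lambda>x. osc_flux m b x / (1 - x^2))"
      unfolding J_def[symmetric]
    proof (intro continuous_intros DERIV_continuous_on[OF dz] ballI)
      fix x assume "x \<in> J"
      then show "1 - x^2 \<noteq> 0" using one_minus_square_pos[OF Jin] by force
    qed
    show "c^2 * x^2 * (osc m b x)^2 - r x * osc m b x \<le> (m^2 + c^2 / 2 + c ^ 4 / (16 * m^2) + 6) * (osc m b x)^2"
      if x: "x \<in> {X 0..X (Suc n)}" for x
    proof -
      have xJ: "-1 < x" "x < 1" using Jin[of x] x by (auto simp: J_def)
      from mult_right_mono[OF osc_potential_bound[OF m0 c b_def xJ] zero_le_power2[of "osc m b x"]]
      show ?thesis unfolding r_def left_diff_distrib by (simp add: power2_eq_square mult.assoc)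
    qed
    show "osc m b (X j) = 0" if "j \<le> Suc n" for j
    proof -
      have "osc_phase m b (X j) = real (n + 2 - j) * pi" using FX[OF that] that by (simp add: F_def of_nat_diff)
      then show ?thesis by (simp add: osc_def sin_npi2 mult.commute)
    qed
    show "\<exists>x\<in>{X j..X (Suc j)}. osc m b x \<noteq> 0" if "j \<le> n" for j
    proof (intro bexI)
      define x where "x = (X j + X (Suc j)) / 2"
      have x: "X j < x" "x < X (Suc j)" using Xs[OF that] by (auto simp: x_def)
      have x1: "-1 < x" "x < 1" using x X01[of j] X01[of "Suc j"] that by auto
      define k where "k = n + 1 - j"
      have "F x < F (X j)" "F (X (Suc j)) < F x"
        using dec[of "X j" x] dec[of x "X (Suc j)"] x X01[of j] X01[of "Suc j"] that by auto
      then have Fx: "real k * pi < F x" "F x < (real k + 1) * pi"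
        using FX[of j] FX[of "Suc j"] that by (simp_all add: k_def of_nat_diff algebra_simps)
      have "sin (F x) \<noteq> 0"
      proof
        assume "sin (F x) = 0"
        then obtain i :: int where i: "F x = of_int i * pi" using sin_zero_iff_int2 by auto
        then have "real_of_int (int k) < of_int i" "real_of_int i < of_int (int k + 1)" using Fx by auto
        then have "int k < i" "i < int k + 1" by (simp_all only: of_int_less_iff)
        then show False by simp
      qed
      moreover have "osc_density m b x > 0" using rate[OF x1] one_minus_square_pos[OF x1] by (simp add: osc_density_def)
      ultimately show "osc m b x \<noteq> 0" by (simp add: osc_def F_def)
      show "x \<in> {X j..X (Suc j)}" using x by simp
    qed
  qed
qed

section \<open>Solutions outside the interval\<close>

text \<open>
  An antiderivative of \<open>sqrt (a\<^sup>2 - z\<^sup>2) / z\<close>, vanishing at \<open>z =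
  a\<close>.
\<close>

definition wkb_phase :: "real \<Rightarrow> real \<Rightarrow> real" where
  "wkb_phase a z = sqrt (a^2 - z^2) - a * (ln (a + sqrt (a^2 - z^2)) - ln z)"

lemma wkb_phase_deriv:
  assumes "0 < z" "z < a"
  shows "(wkb_phase a has_real_derivative sqrt (a^2 - z^2) / z) (at z)"
proof -
  define r where "r = sqrt (a^2 - z^2)"
  have "z^2 < a^2" using assms by (simp add: power_strict_mono)
  then have r: "r > 0" "r^2 = a^2 - z^2" by (auto simp: r_def)
  have dr: "((\<lambda>y. sqrt (a^2 - y^2)) has_real_derivative - z / r) (at z)"
    using \<open>z^2 < a^2\<close> by (auto intro!: derivative_eq_intros simp: r_def field_simps)
  have dl: "((\<lambda>y. ln (a + sqrt (a^2 - y^2))) has_real_derivative 1 / (a + r) * (- z / r)) (at z)"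
    by (rule DERIV_cong[OF DERIV_chain2[OF DERIV_ln_divide DERIV_add[OF DERIV_const dr]]])
       (use assms r in \<open>auto simp: r_def[symmetric]\<close>)
  have dp: "(wkb_phase a has_real_derivative - z / r - a * (1 / (a + r) * (- z / r) - 1 / z)) (at z)"
    unfolding wkb_phase_def
    by (intro DERIV_diff DERIV_cmult dr dl DERIV_ln_divide) (use assms in auto)
  have "z * z = (a - r) * (a + r)" using r(2) by (simp add: power2_eq_square algebra_simps)
  then have e1: "z / (a + r) = (a - r) / z" using assms r by (simp add: frac_eq_eq)
  have "- z / r - a * (1 / (a + r) * (- z / r)) = - (z / (a + r))"
    using assms r by (simp add: divide_simps) (simp add: algebra_simps)
  then have "- z / r - a * (1 / (a + r) * (- z / r) - 1 / z) = r / z"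
    unfolding right_diff_distrib e1 using assms by (simp add: diff_divide_distrib)
  then show ?thesis using dp by (simp add: r_def)
qed

lemma wkb_phase_nonpos:
  assumes "0 < z" "z \<le> a"
  shows "wkb_phase a z \<le> 0"
proof -
  have "wkb_phase a z \<le> wkb_phase a a"
  proof (rule DERIV_nonneg_imp_increasing_open[of z a])
    show "continuous_on {z..a} (wkb_phase a)"
      unfolding wkb_phase_def
    proof (intro continuous_intros ballI)
      fix y assume y: "y \<in> {z..a}"
      have "0 \<le> sqrt (a^2 - y^2)" using y assms by (simp add: power_mono)
      then show "a + sqrt (a^2 - y^2) \<noteq> 0" using assms by linarith
    qed (use assms in auto)
    fix y assume y: "z < y" "y < a"
    show "\<exists>d. (wkb_phase a has_real_derivative d) (at y) \<and> 0 \<le> d"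
      using wkb_phase_deriv[of y a] y assms by (intro exI conjI) (auto simp: power_mono)
  qed (use assms in auto)
  then show ?thesis using assms by (simp add: wkb_phase_def)
qed

lemma wkb_phase_lower:
  assumes "0 < c" "c / 2 \<le> a"
  shows "- wkb_phase a (c / 2) \<le> a * ln (4 * a / c) - a + c^2 / (4 * a)"
proof -
  define r where "r = sqrt (a^2 - (c/2)^2)"
  have a: "a > 0" using assms by simp
  have le: "(c/2)^2 \<le> a^2" using assms by (intro power_mono) auto
  have r0: "r \<ge> 0" "r^2 = a^2 - (c/2)^2" using le by (auto simp: r_def)
  have ra: "r \<le> a" using r0 a by (intro power2_le_imp_le[of r a]) auto
  have "a^2 - (c/2)^2 \<le> r * a" using r0 ra a by (metis mult_left_mono power2_eq_square)
  then have ra': "a - c^2 / (4 * a) \<le> r" using a by (simp add: field_simps power2_eq_square)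
  have "ln ((a + r) / (c/2)) \<le> ln (4 * a / c)"
    using assms a r0 ra by (intro ln_mono) (auto simp: field_simps)
  moreover have "ln ((a + r) / (c/2)) = ln (a + r) - ln (c/2)"
    using assms a r0 by (subst ln_div) auto
  ultimately have "ln (a + r) - ln (c/2) \<le> ln (4 * a / c)" by linarith
  then have "a * (ln (a + r) - ln (c/2)) \<le> a * ln (4 * a / c)" using a by (intro mult_left_mono) auto
  with ra' show ?thesis unfolding wkb_phase_def r_def[symmetric] by linarith
qed

text \<open>
  The prolate equation on the real line, with the sign arranged for \<open>x \<ge> 1\<close>; at
  the singular points \<open>x = 1\<close> and \<open>x = -1\<close> it is a regularity
  condition.
\<close>

definition prolate_line :: "real \<Rightarrow> real \<Rightarrow> (real \<Rightarrow> real) \<Rightarrow> (real \<Rightarrow> real) \<Rightarrow> (real \<Rightarrow> real) \<Rightarrow> bool" where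
  "prolate_line c X u u1 u2 \<longleftrightarrow>
     (\<forall>x. (u has_real_derivative u1 x) (at x)) \<and> (\<forall>x. (u1 has_real_derivative u2 x) (at x)) \<and>
     (\<forall>x. (x^2 - 1) * u2 x = (X - c^2 * x^2) * u x - 2 * x * u1 x)"

text \<open>
  The factor \<open>x\<^sup>2 - 1 = sinh\<^sup>2 t\<close> of the second derivative is supplied
  by the two factors \<open>sinh t\<close>, so that the derivative of the kinetic energy
  \<open>u_t\<^sup>2\<close> stays regular at the singular point \<open>t = 0\<close>.
\<close>

lemma cosh_substitution_deriv:
  assumes sol: "prolate_line c X u u1 u2"
  shows "((\<lambda>s. u (cosh s)) has_real_derivative sinh s * u1 (cosh s)) (at s)"
    and "((\<lambda>s. (sinh s * u1 (cosh s))^2) has_real_derivative 2 * (sinh s * u1 (cosh s)) *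
      ((X - c^2 * (cosh s)^2) * u (cosh s) - cosh s * u1 (cosh s))) (at s)"
proof -
  define C S where "C = cosh s" and "S = sinh s"
  have du: "(u has_real_derivative u1 y) (at y)" and du1: "(u1 has_real_derivative u2 y) (at y)"
    and ode: "(y^2 - 1) * u2 y = (X - c^2 * y^2) * u y - 2 * y * u1 y" for y
    using sol by (auto simp: prolate_line_def)
  have dC: "(cosh has_real_derivative S) (at s)" and dS: "(sinh has_real_derivative C) (at s)"
    unfolding C_def S_def by (auto intro!: derivative_eq_intros)
  show "((\<lambda>s. u (cosh s)) has_real_derivative sinh s * u1 (cosh s)) (at s)"
    using DERIV_chain2[OF du dC] by (simp add: S_def mult.commute)
  have "((\<lambda>s. u1 (cosh s)) has_real_derivative u2 C * S) (at s)"
    unfolding C_def by (rule DERIV_chain2[OF du1 dC])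
  from DERIV_power[OF DERIV_mult[OF dS this], of 2]
  have "((\<lambda>s. (sinh s * u1 (cosh s))^2) has_real_derivative 2 * (S * u1 C) * (C * u1 C + S^2 * u2 C)) (at s)"
    by (simp add: C_def S_def power2_eq_square mult_ac)
  also have "S^2 * u2 C = (X - c^2 * C^2) * u C - 2 * C * u1 C"
    using ode[of C] by (simp add: C_def S_def cosh_square_eq)
  finally show "((\<lambda>s. (sinh s * u1 (cosh s))^2) has_real_derivative 2 * (sinh s * u1 (cosh s)) *
      ((X - c^2 * (cosh s)^2) * u (cosh s) - cosh s * u1 (cosh s))) (at s)"
    by (simp add: C_def S_def algebra_simps)
qed

lemma flux_deriv:
  assumes sol: "prolate_line c X u u1 u2"
  shows "((\<lambda>y. y * u y + (y^2 - 1) * u1 y) has_real_derivative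
    u y + y * u1 y + (X - c^2 * y^2) * u y) (at y)"
proof -
  have du: "(u has_real_derivative u1 y) (at y)" "(u1 has_real_derivative u2 y) (at y)"
    and ode: "(y^2 - 1) * u2 y = (X - c^2 * y^2) * u y - 2 * y * u1 y"
    using sol by (auto simp: prolate_line_def)
  have "((\<lambda>y. y * u y + (y^2 - 1) * u1 y) has_real_derivative
      u y + y * u1 y + (2 * y * u1 y + (y^2 - 1) * u2 y)) (at y)"
    by (auto intro!: derivative_eq_intros du)
  then show ?thesis unfolding ode by (simp add: algebra_simps)
qed

text \<open>
  \<open>U = sqrt (x\<^sup>2 - 1) u\<close> satisfies \<open>U'' + R U = 0\<close> with \<open>R
  = c\<^sup>2 - D / P + 1 / P\<^sup>2\<close>, where \<open>P = x\<^sup>2 - 1\<close> and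
  \<open>D = X - c\<^sup>2\<close>. The amplitude \<open>U\<^sup>2 + U'\<^sup>2 / R\<close>
  decreases where \<open>R\<close> increases, that is, for \<open>D P \<ge> 2\<close>. In the
  formulas \<open>W = sqrt P U'\<close> and \<open>T = P R\<close>.
\<close>

lemma amplitude_outside:
  assumes sol: "prolate_line c X u u1 u2" and b: "1 < b" "b \<le> x"
    and pos: "\<And>y. b \<le> y \<Longrightarrow> 0 < c^2 * (y^2 - 1) - (X - c^2) + 1 / (y^2 - 1)"
    and inc: "\<And>y. b \<le> y \<Longrightarrow> (X - c^2) * (y^2 - 1) \<ge> 2"
  shows "(x^2 - 1) * (u x)^2 \<le> (b^2 - 1) * (u b)^2 +
    (b * u b + (b^2 - 1) * u1 b)^2 / (c^2 * (b^2 - 1) - (X - c^2) + 1 / (b^2 - 1))"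
proof -
  define T where "T y = c^2 * (y^2 - 1) - (X - c^2) + 1 / (y^2 - 1)" for y
  define W where "W y = y * u y + (y^2 - 1) * u1 y" for y
  define M where "M y = (y^2 - 1) * (u y)^2 + (W y)^2 / T y" for y
  have du: "(u has_real_derivative u1 y) (at y)" for y
    using sol by (auto simp: prolate_line_def)
  have "M x \<le> M b"
  proof (rule DERIV_nonpos_imp_nonincreasing[OF b(2)])
    fix y assume y: "b \<le> y" "y \<le> x"
    have P: "y^2 - 1 > 0" using y b by (simp add: power2_eq_square) (meson less_1_mult less_le_trans)
    have T: "T y > 0" using pos[OF y(1)] by (simp add: T_def)
    define p where "p = y^2 - 1"
    have dT: "(T has_real_derivative 2 * y * (c^2 - 1 / p^2)) (at y)"
      unfolding T_def using P
      by (auto intro!: derivative_eq_intros simp: p_def power2_eq_square field_simps)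
    have "(W has_real_derivative u y + y * u1 y + (X - c^2 * y^2) * u y) (at y)"
      unfolding W_def by (rule flux_deriv[OF sol])
    also have "u y + y * u1 y + (X - c^2 * y^2) * u y = - T y * u y + y * W y / p"
    proof -
      have "y * W y = (p + 1) * u y + p * (y * u1 y)"
        by (simp add: W_def p_def power2_eq_square algebra_simps)
      then have Weq: "y * W y / p = u y + u y / p + y * u1 y"
        using P by (simp add: p_def[symmetric] add_divide_distrib distrib_right)
      have Teq: "T y = c^2 * y^2 - X + 1 / p"
        by (simp add: T_def p_def algebra_simps)
      show ?thesis unfolding Weq Teq by (simp add: algebra_simps)
    qed
    finally have dW: "(W has_real_derivative - T y * u y + y * W y / p) (at y)" .
    have "(M has_real_derivative 2 * y * (u y)^2 + p * (2 * u y * u1 y) +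
        (2 * W y * (- T y * u y + y * W y / p) * T y - (W y)^2 * (2 * y * (c^2 - 1 / p^2))) / (T y * T y)) (at y)"
      unfolding M_def using T by (auto intro!: derivative_eq_intros du dW dT simp: p_def)
    also have "2 * y * (u y)^2 + p * (2 * u y * u1 y) +
        (2 * W y * (- T y * u y + y * W y / p) * T y - (W y)^2 * (2 * y * (c^2 - 1 / p^2))) / (T y * T y)
       = 2 * u y * W y + (2 * W y * (- T y * u y + y * W y / p) * T y - (W y)^2 * (2 * y * (c^2 - 1 / p^2))) / (T y * T y)"
      by (simp add: W_def p_def power2_eq_square algebra_simps)
    also have "\<dots> = (W y)^2 / (T y)^2 * (2 * y * T y / p - 2 * y * (c^2 - 1 / p^2))"
      using T by (simp add: field_simps power2_eq_square)
    also have "2 * y * T y / p - 2 * y * (c^2 - 1 / p^2) = 2 * y * (2 - (X - c^2) * p) / p^2"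
    proof -
      define D where "D = X - c^2"
      have "T y / p = c^2 - D / p + 1 / p^2"
        unfolding T_def p_def[symmetric] D_def[symmetric] using P unfolding p_def[symmetric]
        by (simp add: diff_divide_distrib add_divide_distrib power2_eq_square)
      moreover have "(2 - D * p) / p^2 = 2 / p^2 - D / p"
        using P unfolding p_def[symmetric] by (simp add: diff_divide_distrib power2_eq_square)
      ultimately show ?thesis unfolding D_def[symmetric]
        by (simp only: times_divide_eq_right[symmetric] right_diff_distrib[symmetric]) (simp add: algebra_simps)
    qed
    finally have dM: "(M has_real_derivative (W y)^2 / (T y)^2 * (2 * y * (2 - (X - c^2) * p) / p^2)) (at y)" .
    moreover have "(W y)^2 / (T y)^2 * (2 * y * (2 - (X - c^2) * p) / p^2) \<le> 0"
      using inc[OF y(1)] y b by (intro mult_nonneg_nonpos divide_nonpos_nonneg) (auto simp: p_def)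
    ultimately show "\<exists>d. (M has_real_derivative d) (at y) \<and> d \<le> 0" by blast
  qed
  moreover have "(x^2 - 1) * (u x)^2 \<le> M x"
    using pos[OF b(2)] unfolding M_def T_def by simp
  ultimately show ?thesis unfolding M_def W_def T_def by linarith
qed

text \<open>
  In the variable \<open>x = cosh t\<close> the equation reads \<open>u_t_t + coth t u_t = q
  u\<close> with \<open>q = X - c\<^sup>2 cosh\<^sup>2 t\<close>. The energy \<open>u_t\<^sup>2
  + q u\<^sup>2\<close> has the derivative \<open>4 q u u_t\<close> plus nonpositive terms,
  hence the logarithmic rate is at most \<open>2 sqrt q\<close>. With \<open>z = (c / 2) exp
  t\<close> one has \<open>q \<le> a\<^sup>2 - z\<^sup>2\<close>, and \<open>wkb_phase\<close>
  integrates the resulting rate.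
\<close>

lemma energy_to_turning_point:
  assumes sol: "prolate_line c X u u1 u2" and c: "0 < c"
    and a: "0 < a" "X - c^2 / 2 \<le> a^2" and t: "0 \<le> t" "c^2 * (cosh t)^2 \<le> X"
  shows "(sinh t * u1 (cosh t))^2 + (X - c^2 * (cosh t)^2) * (u (cosh t))^2
     \<le> (X - c^2) * (u 1)^2 * (exp (a * ln (4 * a / c) - a + c^2 / (4 * a)))^2"
proof -
  define E where "E s = (sinh s * u1 (cosh s))^2 + (X - c^2 * (cosh s)^2) * (u (cosh s))^2" for s
  define z where "z s = c / 2 * exp s" for s :: real
  define H where "H s = E s * exp (- 2 * wkb_phase a (z s))" for s
  have qs: "0 \<le> X - c^2 * (cosh s)^2" if "0 \<le> s" "s \<le> t" for s
  proof -
    have "cosh s \<le> cosh t" using that by (simp add: cosh_real_nonneg_le_iff)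
    then have "(cosh s)^2 \<le> (cosh t)^2" by (intro power_mono) auto
    then have "c^2 * (cosh s)^2 \<le> c^2 * (cosh t)^2" by (intro mult_left_mono) auto
    then show ?thesis using t by simp
  qed
  have zq: "X - c^2 * (cosh s)^2 < a^2 - (z s)^2" for s
  proof -
    have "c^2 * (cosh s)^2 = c^2 / 2 + (z s)^2 + c^2 / 4 * (exp (- s))^2"
    proof -
      define x y where "x = exp s" and "y = exp (- s)"
      have "x * y = 1" unfolding x_def y_def by (rule exp_minus_inverse)
      moreover have "cosh s = (x + y) / 2" by (simp add: cosh_field_def x_def y_def)
      ultimately show ?thesis
        unfolding z_def x_def[symmetric] y_def[symmetric]
        by (simp only: power_mult_distrib power_divide power2_sum) (simp add: field_simps power2_eq_square)
    qed
    moreover have "c^2 / 4 * (exp (- s))^2 > 0" using c by simp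
    ultimately show ?thesis using a by linarith
  qed
  have za: "0 < z s" "z s < a" if "0 \<le> s" "s \<le> t" for s
  proof -
    show "0 < z s" using c by (simp add: z_def)
    have "(z s)^2 < a^2" using zq[of s] qs[OF that] by linarith
    then show "z s < a" using a by (simp add: power2_less_imp_less)
  qed
  have "H t \<le> H 0"
  proof (rule DERIV_nonpos_imp_nonincreasing[OF t(1)])
    fix s assume s: "0 \<le> s" "s \<le> t"
    define C S q where "C = cosh s" and "S = sinh s" and "q = X - c^2 * C^2"
    define U V where "U = u C" and "V = u1 C"
    have Spos: "S \<ge> 0" "C > 0" using s by (auto simp: S_def C_def)
    have q0: "q \<ge> 0" using qs[OF s] by (simp add: q_def C_def)
    have dC: "(cosh has_real_derivative S) (at s)"
      unfolding S_def by (auto intro!: derivative_eq_intros)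
    have dE: "(E has_real_derivative 4 * q * U * (S * V) - 2 * (S * C * V^2) - 2 * (c^2 * (C * S * U^2))) (at s)"
      unfolding E_def
      by (rule DERIV_cong[OF DERIV_add[OF cosh_substitution_deriv(2)[OF sol]
            DERIV_mult[OF DERIV_diff[OF DERIV_const DERIV_cmult[OF DERIV_power[OF dC, of 2]]]
              DERIV_power[OF cosh_substitution_deriv(1)[OF sol], of 2]]]])
         (simp add: C_def S_def U_def V_def q_def algebra_simps power2_eq_square)
    define r where "r = sqrt (a^2 - (z s)^2)"
    have rq: "sqrt q \<le> r" unfolding r_def q_def C_def using zq[of s] by simp
    have dz: "(z has_real_derivative z s) (at s)" unfolding z_def by (auto intro!: derivative_eq_intros)
    have dph: "((\<lambda>s. wkb_phase a (z s)) has_real_derivative r) (at s)"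
      using DERIV_chain2[OF wkb_phase_deriv[OF za[OF s]] dz] za[OF s] by (simp add: r_def)
    define E' where "E' = 4 * q * U * (S * V) - 2 * (S * C * V^2) - 2 * (c^2 * (C * S * U^2))"
    have dH: "(H has_real_derivative (E' - 2 * r * E s) * exp (- 2 * wkb_phase a (z s))) (at s)"
      unfolding H_def
      by (rule DERIV_cong[OF DERIV_mult[OF dE[folded E'_def] DERIV_chain2[OF DERIV_exp DERIV_cmult[OF dph]]]])
         (simp add: algebra_simps)
    have "E s = (S * V)^2 + q * U^2"
      by (simp add: E_def C_def S_def U_def V_def q_def)
    also have "q * U^2 = (sqrt q * U)^2" using q0 by (simp add: power_mult_distrib)
    finally have Es: "E s = (S * V)^2 + (sqrt q * U)^2" .
    have "0 \<le> S * C * V^2" "0 \<le> c^2 * (C * S * U^2)" using Spos by auto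
    then have "E' \<le> 4 * q * U * (S * V)" unfolding E'_def by linarith
    also have "\<dots> = 4 * (sqrt q * sqrt q) * U * (S * V)" using q0 by simp
    also have "\<dots> = 2 * sqrt q * (2 * (sqrt q * U) * (S * V))" by (simp only: mult_ac)
    also have "\<dots> \<le> 2 * sqrt q * E s"
    proof (rule mult_left_mono)
      show "2 * (sqrt q * U) * (S * V) \<le> E s"
        unfolding Es using sum_squares_bound[of "sqrt q * U" "S * V"] by linarith
    qed (use q0 in simp)
    also have "\<dots> \<le> 2 * r * E s"
      using rq by (intro mult_right_mono) (simp_all add: Es)
    finally have "E' - 2 * r * E s \<le> 0" by simp
    then have "(E' - 2 * r * E s) * exp (- 2 * wkb_phase a (z s)) \<le> 0"
      by (rule mult_nonpos_nonneg) (rule exp_ge_zero)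
    with dH show "\<exists>d. (H has_real_derivative d) (at s) \<and> d \<le> 0" by (intro exI conjI)
  qed
  moreover have "E t \<ge> 0" using qs[OF t(1) order_refl] by (simp add: E_def)
  moreover have "wkb_phase a (z t) \<le> 0" using za[OF t(1) order_refl] by (intro wkb_phase_nonpos) simp_all
  then have "1 \<le> exp (- 2 * wkb_phase a (z t))" by simp
  ultimately have "E t * 1 \<le> H 0"
    using mult_left_mono[of 1 "exp (- 2 * wkb_phase a (z t))" "E t"] unfolding H_def by linarith
  then have "E t \<le> H 0" by simp
  also have "H 0 = (X - c^2) * (u 1)^2 * exp (2 * (- wkb_phase a (c / 2)))"
    by (simp add: H_def E_def z_def)
  also have "\<dots> = (X - c^2) * (u 1)^2 * (exp (- wkb_phase a (c / 2)))^2"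
    by (simp only: exp_double)
  also have "\<dots> \<le> (X - c^2) * (u 1)^2 * (exp (a * ln (4 * a / c) - a + c^2 / (4 * a)))^2"
  proof -
    have "c / 2 \<le> a" using za(2)[OF order_refl t(1)] by (simp add: z_def)
    from wkb_phase_lower[OF c this]
    have "exp (- wkb_phase a (c / 2)) \<le> exp (a * ln (4 * a / c) - a + c^2 / (4 * a))"
      by (simp only: exp_le_cancel_iff)
    then have "(exp (- wkb_phase a (c / 2)))^2 \<le> (exp (a * ln (4 * a / c) - a + c^2 / (4 * a)))^2"
      by (rule power_mono) (rule exp_ge_zero)
    moreover have "0 \<le> (X - c^2) * (u 1)^2" using qs[OF order_refl t(1)] by simp
    ultimately show ?thesis by (rule mult_left_mono)
  qed
  finally show ?thesis by (simp add: E_def)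
qed

section \<open>Growth factors\<close>

text \<open>
  The turning point \<open>b\<close> is matched crudely: the energy bounds the derivative there,
  the mean value theorem bounds the value, and \<open>L\<close> collects all powers of
  \<open>X\<close> and \<open>1 / c\<close>. The condition on \<open>X - c\<^sup>2\<close>
  guarantees that \<open>R\<close> in \<open>amplitude_outside\<close> increases from
  \<open>b\<close> on.
\<close>

lemma growth_elliptic:
  assumes sol: "prolate_line c X u u1 u2" and c: "0 < c"
    and a: "0 < a" "X - c^2 / 2 \<le> a^2" and D: "3 / 2 * c \<le> X - c^2" and x: "sqrt X / c \<le> x"
  shows "(x^2 - 1) * (u x)^2 \<le> 4 * ((1 + X) * (1 + 1 / c)^2) ^ 4 *
    (exp (a * ln (4 * a / c) - a + c^2 / (4 * a)))^2 * (u 1)^2"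
proof -
  define g where "g = exp (a * ln (4 * a / c) - a + c^2 / (4 * a))"
  define d where "d = X - c^2"
  define b where "b = sqrt X / c"
  define L where "L = (1 + X) * (1 + 1 / c)^2"
  have d: "d > 0" "d \<ge> 3 / 2 * c" using D c by (auto simp: d_def)
  have X: "X > 0" "d \<le> X" "c^2 < X" using d by (auto simp: d_def add_pos_nonneg) (smt (verit) zero_le_power2)
  have b2: "b^2 = X / c^2" using X by (simp add: b_def power_divide)
  have "c < sqrt X" using X c by (simp add: real_less_rsqrt)
  then have b1: "b > 1" using c by (simp add: b_def)
  have P: "b^2 - 1 = d / c^2" using c by (simp add: b2 d_def diff_divide_distrib)
  \<comment> \<open>The turning point in the variable \<open>t\<close>.\<close>
  obtain t where t: "0 \<le> t" "cosh t = b"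
    using that[of "arcosh b"] cosh_arcosh_real[of b] b1 arcosh_nonneg_real[of b] by simp
  have turn: "c^2 * (cosh s)^2 \<le> X" if "0 \<le> s" "s \<le> t" for s
  proof -
    have "cosh s \<le> b" using that t by (metis cosh_real_nonneg_le_iff order_trans)
    then have "(cosh s)^2 \<le> b^2" by (intro power_mono) auto
    then show ?thesis using c by (simp add: b2 field_simps)
  qed
  have du: "(u has_real_derivative u1 y) (at y)" for y using sol by (auto simp: prolate_line_def)
  define K where "K = sqrt d * (\<bar>u 1\<bar> * g)"
  have en: "(sinh s * u1 (cosh s))^2 \<le> K^2" if "0 \<le> s" "s \<le> t" for s
  proof -
    have "0 \<le> (X - c^2 * (cosh s)^2) * (u (cosh s))^2" using turn[OF that] by simp
    then have "(sinh s * u1 (cosh s))^2 \<le> d * (u 1)^2 * g^2"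
      using energy_to_turning_point[OF sol c a that(1) turn[OF that]] unfolding g_def d_def by linarith
    also have "\<dots> = K^2"
    proof -
      have "(sqrt d)^2 = d" using d by simp
      then show ?thesis unfolding K_def power_mult_distrib power2_abs by (simp only: mult.assoc)
    qed
    finally show ?thesis .
  qed
  have K0: "K \<ge> 0" using d by (simp add: K_def g_def)
  have g1: "g \<ge> 1"
  proof -
    have "c^2 / 4 < a^2" using a X zero_le_power2[of c] by linarith
    then have "(c/2)^2 < a^2" by (simp add: power_divide)
    then have "c / 2 \<le> a" using a by (meson less_imp_le power2_less_imp_less)
    then have "0 \<le> a * ln (4 * a / c) - a + c^2 / (4 * a)"
      using wkb_phase_lower[of c a] wkb_phase_nonpos[of "c/2" a] c by linarith
    then show ?thesis by (simp add: g_def)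
  qed
  have "norm (u (cosh t) - u (cosh 0)) \<le> K * norm (t - 0)"
  proof (rule field_differentiable_bound[of "{0..t}" _ "\<lambda>s. u1 (cosh s) * sinh s"])
    fix s assume s: "s \<in> {0..t}"
    show "((\<lambda>s. u (cosh s)) has_field_derivative u1 (cosh s) * sinh s) (at s within {0..t})"
      by (rule has_field_derivative_at_within, rule DERIV_chain2[OF du]) (auto intro!: derivative_eq_intros)
    show "norm (u1 (cosh s) * sinh s) \<le> K"
      using en[of s] s power2_le_iff_abs_le[OF K0] by (simp add: mult.commute)
  qed (use t in auto)
  then have "\<bar>u b\<bar> \<le> \<bar>u 1\<bar> + K * t" using t by simp
  also have "t \<le> exp t" using exp_ge_add_one_self[of t] by linarith
  also have "exp t \<le> 2 * b"
    using sinh_le_cosh_real[of t] cosh_plus_sinh[of t] t by linarith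
  finally have "\<bar>u b\<bar> \<le> \<bar>u 1\<bar> + K * (2 * b)" using K0 by (simp add: mult_left_mono)
  have "sqrt d * sqrt X \<le> X" using X d by (metis real_sqrt_le_iff mult_right_mono real_sqrt_ge_zero real_sqrt_mult_self abs_of_pos less_imp_le)
  then have "(sqrt d * sqrt X) * (2 / c * (\<bar>u 1\<bar> * g)) \<le> X * (2 / c * (\<bar>u 1\<bar> * g))"
    using c g1 by (intro mult_right_mono) auto
  then have "K * (2 * b) \<le> (2 * X / c) * (\<bar>u 1\<bar> * g)"
    unfolding K_def b_def by (simp only: times_divide_eq_right times_divide_eq_left mult_ac)
  have ub: "(u b)^2 \<le> (1 + 2 * X / c)^2 * (g^2 * (u 1)^2)"
  proof -
    have "\<bar>u 1\<bar> \<le> g * \<bar>u 1\<bar>" using g1 by (simp add: mult_le_cancel_right1)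
    then have "\<bar>u b\<bar> \<le> (1 + 2 * X / c) * (g * \<bar>u 1\<bar>)"
      using \<open>\<bar>u b\<bar> \<le> \<bar>u 1\<bar> + K * (2 * b)\<close> \<open>K * (2 * b) \<le> _\<close> by (simp add: algebra_simps)
    then have "\<bar>u b\<bar>\<^sup>2 \<le> ((1 + 2 * X / c) * (g * \<bar>u 1\<bar>))^2" by (intro power_mono) auto
    then show ?thesis by (simp add: power_mult_distrib)
  qed
  have u1b: "(b^2 - 1) * (u1 b)^2 \<le> d * (g^2 * (u 1)^2)"
    using en[OF t(1) order_refl] cosh_square_eq[of t] t d
    by (simp add: K_def power_mult_distrib algebra_simps)
  define p where "p = d / c^2"
  have p: "p > 0" "p \<le> b^2" using P d c by (auto simp: p_def)
  have dp: "d * p \<ge> 2"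
  proof -
    have "(3 / 2 * c)^2 \<le> d^2" using d c by (intro power_mono) auto
    then have "9 / 4 * c^2 \<le> d * d" by (simp add: power2_eq_square)
    then have "9 / 4 \<le> d * p" using c by (simp add: p_def field_simps)
    then show ?thesis by simp
  qed
  have grow: "p \<le> y^2 - 1" if "b \<le> y" for y
    using power_mono[OF that, of 2] b1 P by (simp add: p_def)
  have key: "(x^2 - 1) * (u x)^2 \<le> (b^2 - 1) * (u b)^2 +
    (b * u b + (b^2 - 1) * u1 b)^2 / (c^2 * (b^2 - 1) - (X - c^2) + 1 / (b^2 - 1))"
  proof (rule amplitude_outside[OF sol b1])
    show "b \<le> x" using x by (simp add: b_def)
    fix y assume y: "b \<le> y"
    have "c^2 * p \<le> c^2 * (y^2 - 1)" using grow[OF y] by (intro mult_left_mono) auto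
    moreover have "c^2 * p = d" using c by (simp add: p_def)
    moreover have "1 / (y^2 - 1) > 0" using grow[OF y] p by simp
    ultimately show "0 < c^2 * (y^2 - 1) - (X - c^2) + 1 / (y^2 - 1)" unfolding d_def by linarith
    have "d * p \<le> d * (y^2 - 1)" using grow[OF y] d by (intro mult_left_mono) auto
    then show "2 \<le> (X - c^2) * (y^2 - 1)" using dp unfolding d_def by linarith
  qed
  have "c^2 * (b^2 - 1) - (X - c^2) + 1 / (b^2 - 1) = 1 / p"
    unfolding P p_def d_def[symmetric] using c by simp
  then have key': "(x^2 - 1) * (u x)^2 \<le> p * (u b)^2 + p * (b * u b + p * u1 b)^2"
    using key unfolding P p_def[symmetric] by (simp add: mult.commute)
  define V where "V = g^2 * (u 1)^2"
  have "(b * u b + p * u1 b)^2 \<le> 2 * (b * u b)^2 + 2 * (p * u1 b)^2"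
    using sum_squares_bound[of "b * u b" "p * u1 b"] by (simp add: power2_sum)
  also have "\<dots> = 2 * b^2 * (u b)^2 + 2 * p * ((b^2 - 1) * (u1 b)^2)"
    unfolding P p_def[symmetric] by (simp add: power_mult_distrib power2_eq_square)
  also have "\<dots> \<le> 2 * b^2 * (u b)^2 + 2 * p * (d * V)"
    using u1b p by (simp add: V_def)
  finally have "(x^2 - 1) * (u x)^2 \<le> p * (u b)^2 + p * (2 * b^2 * (u b)^2 + 2 * p * (d * V))"
    using key' p by (smt (verit) mult_left_mono)
  also have "\<dots> = p * (1 + 2 * b^2) * (u b)^2 + 2 * p * p * d * V" by (simp add: algebra_simps)
  also have "\<dots> \<le> L * (2 * L) * (L^2 * V) + 2 * L * L * L * V"
  proof -
    have Lexp: "L = 1 + X + 2 / c + 2 * X / c + 1 / c^2 + X / c^2"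
      using c by (simp add: L_def power2_sum power_divide algebra_simps add_divide_distrib)
    have pos: "0 \<le> 2 / c" "0 \<le> 2 * X / c" "0 \<le> 1 / c^2" "0 \<le> X / c^2" "0 \<le> 2 * X / c^2" using c X by auto
    have V: "V \<ge> 0" by (simp add: V_def)
    have l0: "L \<ge> 1" using pos X unfolding Lexp by linarith
    have l1: "p \<le> L" using p pos X unfolding Lexp b2 by linarith
    have "2 * X / c^2 = X / c^2 + X / c^2" by simp
    then have l2: "1 + 2 * b^2 \<le> 2 * L" using pos X unfolding Lexp b2 distrib_left by linarith
    have l3: "1 + 2 * X / c \<le> L" using pos X unfolding Lexp by linarith
    have l4: "d \<le> L" using pos X unfolding Lexp by linarith
    have "(1 + 2 * X / c)^2 \<le> L^2" using l3 pos by (intro power_mono) auto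
    then have "(u b)^2 \<le> L^2 * V" using ub V unfolding V_def[symmetric]
      by (meson mult_right_mono order_trans)
    then have "p * (1 + 2 * b^2) * (u b)^2 \<le> L * (2 * L) * (L^2 * V)"
      using l0 l1 l2 p by (intro mult_mono) auto
    moreover have "2 * p * p * d * V \<le> 2 * L * L * L * V"
      using l0 l1 l4 p d V by (intro mult_mono) auto
    ultimately show ?thesis by linarith
  qed
  also have "\<dots> \<le> 4 * L ^ 4 * V"
  proof -
    have "1 \<le> L" unfolding L_def using c X by (intro mult_ge1_I[of "1 + X"]) auto
    then have "L ^ 3 \<le> L ^ 4" by (intro power_increasing) auto
    then have "L ^ 3 * V \<le> L ^ 4 * V" by (intro mult_right_mono) (auto simp: V_def)
    then show ?thesis by (simp add: power2_eq_square power3_eq_cube power4_eq_xxxx mult_ac)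
  qed
  finally show ?thesis by (simp add: V_def g_def L_def mult_ac)
qed

text \<open>
  Two Gronwall estimates. Up to \<open>x = 5/4 = cosh (ln 2)\<close> the energy
  \<open>u_t\<^sup>2 + c\<^sup>2 u\<^sup>2\<close> grows at most at the rate \<open>c +
  3/2\<close>. Beyond, \<open>c\<^sup>2 U\<^sup>2 + U'\<^sup>2\<close> for \<open>U = sqrt
  (x\<^sup>2 - 1) u\<close> grows at most at a rate \<open>L / (x\<^sup>2 - 1)\<close>, which is
  integrable at infinity. Up to constants, the exponents for these squares are \<open>0.70
  c\<close> and \<open>1.12 c\<close>, together less than \<open>2 c\<close>.
\<close>

lemma growth_near_critical:
  assumes sol: "prolate_line c X u u1 u2" and c: "1 \<le> c"
    and D: "- (5 / 9) * c^2 \<le> X - c^2" "X - c^2 \<le> 3 / 2 * c" and x: "5 / 4 \<le> x"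
  shows "(x^2 - 1) * (u x)^2 \<le> 9 * exp (2 * c + 8) * (u 1)^2"
proof -
  define d where "d = X - c^2"
  have du: "(u has_real_derivative u1 y) (at y)" for y
    using sol by (auto simp: prolate_line_def)
  have cc: "c \<le> c^2" using c by (simp add: power2_eq_square)
  define E where "E s = (sinh s * u1 (cosh s))^2 + (c * u (cosh s))^2" for s
  define H where "H s = E s * exp (- (c + 3/2) * s)" for s
  have ln2: "0 \<le> ln (2::real)" by simp
  have "H (ln 2) \<le> H 0"
  proof (rule DERIV_nonpos_imp_nonincreasing[OF ln2])
    fix s :: real assume s: "0 \<le> s" "s \<le> ln 2"
    define C S q where "C = cosh s" and "S = sinh s" and "q = X - c^2 * C^2"
    define U V where "U = u C" and "V = u1 C"
    have Spos: "S \<ge> 0" "C \<ge> 1" using s by (auto simp: S_def C_def cosh_real_ge_1)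
    have "C \<le> cosh (ln 2)" unfolding C_def using s by (metis cosh_real_nonneg_le_iff order_trans)
    also have "cosh (ln 2) = (5/4::real)" by (simp add: cosh_ln_real)
    finally have "C^2 \<le> (5/4)^2" using Spos by (intro power_mono) auto
    then have "C^2 \<le> 25/16" by (simp add: power2_eq_square)
    then have "c^2 * C^2 \<le> c^2 * (25/16)" by (intro mult_left_mono) auto
    moreover have "1 \<le> C^2" using Spos by simp
    then have "c^2 * 1 \<le> c^2 * C^2" by (intro mult_left_mono) auto
    ultimately have q: "\<bar>q + c^2\<bar> \<le> c^2 + 3/2 * c"
      using D c cc unfolding q_def by linarith
    have dE: "(E has_real_derivative 2 * (q + c^2) * U * (S * V) - 2 * (S * C * V^2)) (at s)"
      unfolding E_def
      by (rule DERIV_cong[OF DERIV_add[OF cosh_substitution_deriv(2)[OF sol]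
            DERIV_power[OF DERIV_cmult[OF cosh_substitution_deriv(1)[OF sol], of c], of 2]]])
         (simp add: C_def S_def U_def V_def q_def algebra_simps power2_eq_square)
    define E' where "E' = 2 * (q + c^2) * U * (S * V) - 2 * (S * C * V^2)"
    have dH: "(H has_real_derivative (E' - (c + 3/2) * E s) * exp (- (c + 3/2) * s)) (at s)"
      unfolding H_def
      by (rule DERIV_cong[OF DERIV_mult[OF dE[folded E'_def] DERIV_chain2[OF DERIV_exp DERIV_cmult[OF DERIV_ident]]]])
         (simp add: algebra_simps)
    have Es: "E s = (S * V)^2 + (c * U)^2"
      by (simp add: E_def C_def S_def U_def V_def)
    have "0 \<le> S * C * V^2" using Spos by auto
    then have "E' \<le> 2 * (q + c^2) * U * (S * V)" unfolding E'_def by linarith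
    also have "\<dots> \<le> \<bar>2 * (q + c^2) * U * (S * V)\<bar>" by simp
    also have "\<dots> = \<bar>q + c^2\<bar> * \<bar>2 * U * (S * V)\<bar>" by (simp only: abs_mult[symmetric] mult_ac)
    also have "\<dots> \<le> (c^2 + 3/2 * c) * \<bar>2 * U * (S * V)\<bar>" using q by (intro mult_right_mono) auto
    also have "\<dots> = (c + 3/2) * (2 * \<bar>c * U\<bar> * \<bar>S * V\<bar>)"
      using c by (simp add: abs_mult power2_eq_square algebra_simps)
    also have "\<dots> \<le> (c + 3/2) * E s"
    proof (rule mult_left_mono)
      show "2 * \<bar>c * U\<bar> * \<bar>S * V\<bar> \<le> E s"
        unfolding Es using sum_squares_bound[of "\<bar>c * U\<bar>" "\<bar>S * V\<bar>"] by (simp only: power2_abs add.commute)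
    qed (use c in simp)
    finally have "E' - (c + 3/2) * E s \<le> 0" by simp
    then have "(E' - (c + 3/2) * E s) * exp (- (c + 3/2) * s) \<le> 0"
      by (rule mult_nonpos_nonneg) (rule exp_ge_zero)
    with dH show "\<exists>d. (H has_real_derivative d) (at s) \<and> d \<le> 0" by (intro exI conjI)
  qed
  then have "E (ln 2) * inverse (exp ((c + 3/2) * ln 2)) \<le> E 0"
    unfolding H_def by (simp only: mult_minus_left exp_minus) simp
  then have "E (ln 2) \<le> E 0 * exp ((c + 3/2) * ln 2)"
    by (simp only: divide_inverse[symmetric] pos_divide_le_eq[OF exp_gt_zero])
  then have E1: "E (ln 2) \<le> c^2 * (u 1)^2 * exp ((c + 3/2) * ln 2)"
    by (simp add: E_def power_mult_distrib)
  have sc: "cosh (ln 2) = (5/4::real)" "sinh (ln 2) = (3/4::real)" by (simp_all add: cosh_ln_real sinh_ln_real)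
  define L where "L = (\<bar>d\<bar> + 16 / 9) / c"
  have L0: "L \<ge> 0" using c by (simp add: L_def)
  define W where "W y = y * u y + (y^2 - 1) * u1 y" for y
  define M where "M y = c^2 * ((y^2 - 1) * (u y)^2) + (W y)^2 / (y^2 - 1)" for y
  \<comment> \<open>\<open>(ln (y - 1) - ln (y + 1)) / 2\<close> is the antiderivative of \<open>1 / (y\<^sup>2 - 1)\<close> that vanishes at infinity.\<close>
  define N where "N y = M y * exp (- (L / 2) * (ln (y - 1) - ln (y + 1)))" for y
  have Pb: "9 / 16 \<le> y^2 - 1" if "5/4 \<le> y" for y :: real
    using power_mono[OF that, of 2] by (simp add: power2_eq_square)
  have "N x \<le> N (5/4)"
  proof (rule DERIV_nonpos_imp_nonincreasing[OF x])
    fix y assume y: "5/4 \<le> y" "y \<le> x"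
    define p where "p = y^2 - 1"
    have p: "p \<ge> 9 / 16" using Pb[OF y(1)] by (simp add: p_def)
    have dW: "(W has_real_derivative u y + y * u1 y + (X - c^2 * y^2) * u y) (at y)"
      unfolding W_def by (rule flux_deriv[OF sol])
    have dP: "((\<lambda>y. y^2 - 1) has_real_derivative 2 * y) (at y)" by (auto intro!: derivative_eq_intros)
    have "(M has_real_derivative c^2 * (2 * y * (u y)^2 + p * (2 * u y * u1 y)) +
       (2 * W y * (u y + y * u1 y + (X - c^2 * y^2) * u y) * p - (W y)^2 * (2 * y)) / (p * p)) (at y)"
      unfolding M_def
      by (rule DERIV_cong[OF DERIV_add[OF DERIV_cmult[OF DERIV_mult[OF dP DERIV_power[OF du, of 2]]]
           DERIV_divide[OF DERIV_power[OF dW, of 2] dP]]])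
         (use p in \<open>auto simp: p_def numeral_2_eq_2 algebra_simps\<close>)
    also have "c^2 * (2 * y * (u y)^2 + p * (2 * u y * u1 y)) +
       (2 * W y * (u y + y * u1 y + (X - c^2 * y^2) * u y) * p - (W y)^2 * (2 * y)) / (p * p)
       = 2 * u y * W y * (d / p - 1 / p^2)"
    proof -
      have yy: "y * y = p + 1" by (simp add: p_def power2_eq_square)
      have e1: "c^2 * (2 * y * (u y)^2 + p * (2 * u y * u1 y)) = 2 * u y * W y * c^2"
        by (simp add: W_def p_def power2_eq_square algebra_simps)
      have e2: "2 * W y * (u y + y * u1 y + (X - c^2 * y^2) * u y) * p - (W y)^2 * (2 * y)
        = 2 * W y * u y * ((d - c^2 * p) * p - 1)"
      proof -
        have "(u y + y * u1 y + (X - c^2 * y^2) * u y) * p - W y * y = u y * ((d - c^2 * p) * p + p - y * y)"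
          by (simp add: W_def d_def p_def power2_eq_square algebra_simps)
        then have "(u y + y * u1 y + (X - c^2 * y^2) * u y) * p - W y * y = u y * ((d - c^2 * p) * p - 1)"
          by (simp add: yy)
        then have "2 * W y * ((u y + y * u1 y + (X - c^2 * y^2) * u y) * p - W y * y)
          = 2 * W y * (u y * ((d - c^2 * p) * p - 1))" by simp
        then show ?thesis by (simp add: power2_eq_square algebra_simps)
      qed
      have e3: "((d - c^2 * p) * p - 1) / (p * p) = d / p - 1 / p^2 - c^2"
        using p by (simp add: field_simps power2_eq_square)
      show ?thesis unfolding e1 e2 times_divide_eq_right[symmetric] e3 by (simp add: algebra_simps)
    qed
    finally have dM: "(M has_real_derivative 2 * u y * W y * (d / p - 1 / p^2)) (at y)" .
    have dl: "((\<lambda>y. ln (y - 1) - ln (y + 1)) has_real_derivative 2 / p) (at y)"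
    proof -
      have "((\<lambda>y. ln (y - 1) - ln (y + 1)) has_real_derivative 1 / (y - 1) - 1 / (y + 1)) (at y)"
        using y by (auto intro!: derivative_eq_intros)
      moreover have "1 / (y - 1) - 1 / (y + 1) = 2 / p"
        using y p by (simp add: p_def field_simps power2_eq_square)
      ultimately show ?thesis by simp
    qed
    define M' where "M' = 2 * u y * W y * (d / p - 1 / p^2)"
    have dN: "(N has_real_derivative (M' - L / p * M y) * exp (- (L / 2) * (ln (y - 1) - ln (y + 1)))) (at y)"
      unfolding N_def
      by (rule DERIV_cong[OF DERIV_mult[OF dM[folded M'_def] DERIV_chain2[OF DERIV_exp DERIV_cmult[OF dl]]]])
         (simp add: algebra_simps)
    have M: "M y = (c * (sqrt p * u y))^2 + (W y / sqrt p)^2"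
      using p by (simp add: M_def p_def power_mult_distrib power_divide)
    have "\<bar>d / p - 1 / p^2\<bar> \<le> (\<bar>d\<bar> + 16 / 9) / p"
    proof -
      have "\<bar>d / p - 1 / p^2\<bar> \<le> \<bar>d\<bar> / p + 1 / p^2" using p abs_triangle_ineq4[of "d / p" "1 / p^2"] by simp
      moreover have "1 / p^2 \<le> 16 / 9 / p" using p by (simp add: field_simps power2_eq_square)
      ultimately show ?thesis by (simp add: add_divide_distrib)
    qed
    also have "\<dots> = c * (L / p)" using c by (simp add: L_def)
    finally have dd: "\<bar>d / p - 1 / p^2\<bar> \<le> c * (L / p)" .
    have "M' \<le> \<bar>M'\<bar>" by simp
    also have "\<dots> = \<bar>2 * u y * W y\<bar> * \<bar>d / p - 1 / p^2\<bar>" by (simp add: M'_def abs_mult)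
    also have "\<dots> \<le> \<bar>2 * u y * W y\<bar> * (c * (L / p))" using dd by (intro mult_left_mono) auto
    also have "\<dots> = L / p * (2 * \<bar>c * (sqrt p * u y)\<bar> * \<bar>W y / sqrt p\<bar>)"
      using c p by (simp add: abs_mult)
    also have "\<dots> \<le> L / p * M y"
    proof (rule mult_left_mono)
      show "2 * \<bar>c * (sqrt p * u y)\<bar> * \<bar>W y / sqrt p\<bar> \<le> M y"
        unfolding M using sum_squares_bound[of "\<bar>c * (sqrt p * u y)\<bar>" "\<bar>W y / sqrt p\<bar>"]
        by (simp only: power2_abs)
    qed (use L0 p in simp)
    finally have "M' - L / p * M y \<le> 0" by simp
    then have "(M' - L / p * M y) * exp (- (L / 2) * (ln (y - 1) - ln (y + 1))) \<le> 0"
      by (rule mult_nonpos_nonneg) (rule exp_ge_zero)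
    with dN show "\<exists>d. (N has_real_derivative d) (at y) \<and> d \<le> 0" by (intro exI conjI)
  qed
  have M0: "c^2 * ((x^2 - 1) * (u x)^2) \<le> M x" "0 \<le> M x" using Pb[OF x] by (auto simp: M_def)
  have "M x * 1 \<le> N x"
    unfolding N_def
  proof (rule mult_left_mono)
    have "ln (x - 1) - ln (x + 1) \<le> 0" using x by simp
    then have "0 \<le> - (L / 2) * (ln (x - 1) - ln (x + 1))" using L0 by (intro mult_nonpos_nonpos) auto
    then show "1 \<le> exp (- (L / 2) * (ln (x - 1) - ln (x + 1)))" by simp
  qed (use M0 in simp)
  also have "N x \<le> N (5/4)" by fact
  also have "N (5/4) = M (5/4) * exp (L * ln 3)"
  proof -
    have "ln (5/4 - 1 :: real) - ln (5/4 + 1) = - ln 9"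
      using ln_div[of "1/4::real" "9/4"] ln_inverse[of "9::real"] by simp
    also have "ln (9::real) = 2 * ln 3" using ln_realpow[of "3::real" 2] by simp
    finally show ?thesis by (simp add: N_def)
  qed
  also have "\<dots> \<le> 9 * E (ln 2) * exp (L * ln 3)"
  proof (rule mult_right_mono)
    define r s where "r = u (5/4)" and "s = u1 (5/4)"
    have E: "E (ln 2) = 9 / 16 * s^2 + c^2 * r^2"
      unfolding E_def sc r_def s_def by (simp add: power_mult_distrib power2_eq_square)
    define Q where "Q = (5/4 * r + 9/16 * s)^2"
    have W5: "W (5/4) = 5/4 * r + 9/16 * s" by (simp add: W_def r_def s_def power2_eq_square)
    have sq: "(5/4)^2 - 1 = (9/16::real)" by (simp add: power2_eq_square)
    have "M (5/4) = 9 / 16 * (c^2 * r^2) + 16/9 * Q"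
      unfolding M_def W5 sq r_def[symmetric] Q_def[symmetric] by simp
    moreover have "Q \<le> 2 * (5/4 * r)^2 + 2 * (9/16 * s)^2"
      unfolding Q_def using sum_squares_bound[of "5/4 * r" "9/16 * s"] by (simp only: power2_sum)
    then have "Q \<le> 25/8 * r^2 + 81/128 * s^2" by (simp add: power_mult_distrib power_divide)
    moreover have "1 * r^2 \<le> c^2 * r^2" using c cc by (intro mult_right_mono) auto
    moreover have "0 \<le> s^2" "0 \<le> r^2" by simp_all
    moreover have "9 * E (ln 2) = 81 / 16 * s^2 + 9 * (c^2 * r^2)" unfolding E by simp
    ultimately show "M (5/4) \<le> 9 * E (ln 2)" by linarith
  qed simp
  also have "\<dots> \<le> 9 * (c^2 * (u 1)^2 * exp ((c + 3/2) * ln 2)) * exp (L * ln 3)"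
    by (rule mult_right_mono[OF mult_left_mono[OF E1]]) simp_all
  also have "\<dots> = c^2 * (9 * (u 1)^2 * exp ((c + 3/2) * ln 2 + L * ln 3))"
    by (simp only: exp_add mult_ac)
  also have "\<dots> \<le> c^2 * (9 * (u 1)^2 * exp (2 * c + 8))"
  proof -
    have "\<bar>d\<bar> \<le> 5 / 9 * c^2 + 3 / 2 * c" using D c zero_le_power2[of c] unfolding d_def by linarith
    then have "L \<le> (5 / 9 * c^2 + 3 / 2 * c + 16 / 9) / c" unfolding L_def using c by (simp add: divide_right_mono)
    also have "\<dots> = 5 / 9 * c + 3 / 2 + 16 / 9 / c" using c by (simp add: field_simps power2_eq_square)
    also have "16 / 9 / c \<le> 16 / 9" using c by (simp add: field_simps)
    finally have L: "L \<le> 5 / 9 * c + 59 / 18" by simp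
    have "L * ln 3 \<le> L * 2" using L0 ln_le_minus_one[of "3::real"] by (intro mult_left_mono) auto
    moreover have "(c + 3/2) * ln 2 \<le> (c + 3/2) * (25/36)"
      using c ln2_le_25_over_36 by (intro mult_left_mono) auto
    ultimately have "(c + 3/2) * ln 2 + L * ln 3 \<le> 2 * c + 8" using L c by simp
    then show ?thesis by (intro mult_left_mono) auto
  qed
  finally have "c^2 * ((x^2 - 1) * (u x)^2) \<le> c^2 * (9 * (u 1)^2 * exp (2 * c + 8))" using M0 by linarith
  then show ?thesis using c by (simp add: mult_ac)
qed

section \<open>Fourier eigenvalues from growth outside the interval\<close>

text \<open>
  The phase \<open>b\<close> unifies the real part (\<open>b = 0\<close>) and the imaginary part
  (\<open>b = - \<pi> / 2\<close>) of the Fourier transform of a real function.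
\<close>

definition cos_transform :: "real \<Rightarrow> real \<Rightarrow> (real \<Rightarrow> real) \<Rightarrow> real \<Rightarrow> real" where
  "cos_transform c b f x = integral {-1..1} (\<lambda>y. cos (c * x * y + b) * f y)"

lemma transform_deriv:
  fixes f :: "real \<Rightarrow> real"
  assumes f: "continuous_on {-1..1} f" and h: "continuous_on UNIV h" and h': "continuous_on UNIV h'"
    and d: "\<And>s. (h has_real_derivative h' s) (at s)"
  shows "((\<lambda>x. integral {-1..1} (\<lambda>y. h (c * x * y + b) * f y)) has_real_derivative
     integral {-1..1} (\<lambda>y. h' (c * x * y + b) * (c * y * f y))) (at x)"
proof -
  have f2: "continuous_on (UNIV \<times> {-1..1::real}) (\<lambda>z. f (snd z))"
    by (rule continuous_on_compose2[OF f]) (auto intro!: continuous_intros)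
  have "((\<lambda>x. integral (cbox (-1) 1) (\<lambda>y. h (c * x * y + b) * f y)) has_real_derivative
     integral (cbox (-1) 1) (\<lambda>y. h' (c * x * y + b) * (c * y * f y))) (at x within UNIV)"
  proof (rule leibniz_rule_field_derivative)
    fix x y :: real
    show "((\<lambda>x. h (c * x * y + b) * f y) has_real_derivative h' (c * x * y + b) * (c * y * f y)) (at x within UNIV)"
      by (rule DERIV_cong[OF DERIV_cmult_right[OF DERIV_chain2[OF d]]])
         (auto intro!: derivative_eq_intros)
  next
    fix x :: real
    have "continuous_on {-1..1} (\<lambda>y. h (c * x * y + b) * f y)"
      by (intro continuous_intros f continuous_on_compose2[OF h]) auto
    then show "(\<lambda>y. h (c * x * y + b) * f y) integrable_on cbox (-1) 1"
      using integrable_continuous_interval by (simp add: cbox_interval)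
  next
    have "continuous_on (UNIV \<times> {-1..1}) (\<lambda>z. h' (c * fst z * snd z + b) * (c * snd z * f (snd z)))"
      by (intro continuous_intros f2 continuous_on_compose2[OF h']) auto
    then show "continuous_on (UNIV \<times> cbox (-1) 1) (\<lambda>(x, y). h' (c * x * y + b) * (c * y * f y))"
      by (simp add: case_prod_unfold cbox_interval)
  qed auto
  then show ?thesis by (simp add: cbox_interval)
qed

text \<open>
  The kernel \<open>k = cos (c x y + b)\<close> satisfies the same differential identity in
  \<open>x\<close> as in \<open>y\<close>: the difference of the two prolate operators
  annihilates it. So the equation in \<open>x\<close> can be moved onto \<open>f\<close>, and
  what remains is the integral of the derivative of \<open>T = (1 - y\<^sup>2) (k f' - k_y
  f)\<close>, which vanishes at the end points.
\<close>

lemma cos_transform_prolate_line: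
  assumes sol: "prolate_sol c X f"
  shows "\<exists>u1 u2. prolate_line c X (cos_transform c b f) u1 u2"
proof -
  have C2: "C2_I f" using sol by (simp add: prolate_sol_def)
  note cf = C2_I_continuous[OF C2]
  define u1 where "u1 x = integral {-1..1} (\<lambda>y. - sin (c * x * y + b) * (c * y * f y))" for x
  define u2 where "u2 x = integral {-1..1} (\<lambda>y. - cos (c * x * y + b) * (c * y * (c * y * f y)))" for x
  have d1: "(cos_transform c b f has_real_derivative u1 x) (at x)" for x
    unfolding cos_transform_def u1_def
    by (rule transform_deriv[OF cf(1)]) (auto intro!: continuous_intros derivative_eq_intros)
  have d2: "(u1 has_real_derivative u2 x) (at x)" for x
    unfolding u1_def u2_def
    by (rule transform_deriv) (auto intro!: continuous_intros derivative_eq_intros cf(1))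
  have ode: "(x^2 - 1) * u2 x = (X - c^2 * x^2) * cos_transform c b f x - 2 * x * u1 x" for x
  proof -
    define k s where "k y = cos (c * x * y + b)" and "s y = sin (c * x * y + b)" for y
    define T where "T y = (1 - y^2) * (k y * dI f y + c * x * s y * f y)" for y
    define T' where "T' y = (x^2 - 1) * (- k y * (c * y * (c * y * f y))) + ((c^2 * x^2 - X) * (k y * f y)
        + 2 * x * (- s y * (c * y * f y)))" for y
    have dT: "(T has_real_derivative T' y) (at y within {-1..1})" if y: "y \<in> {-1..1}" for y
    proof -
      have dk: "(k has_real_derivative - s y * (c * x)) (at y within {-1..1})"
        unfolding k_def s_def by (auto intro!: derivative_eq_intros)
      have ds: "(s has_real_derivative k y * (c * x)) (at y within {-1..1})"
        unfolding k_def s_def by (auto intro!: derivative_eq_intros)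
      have dp: "((\<lambda>y. 1 - y^2) has_real_derivative - 2 * y) (at y within {-1..1})"
        by (auto intro!: derivative_eq_intros)
      have "(1 - y^2) * dI (dI f) y - 2 * y * dI f y + (X - c^2 * y^2) * f y = 0"
        using sol y by (auto simp: prolate_sol_def)
      then have o: "(1 - y^2) * dI (dI f) y = 2 * y * dI f y - (X - c^2 * y^2) * f y" by linarith
      have "(T has_real_derivative (- 2 * y) * (k y * dI f y + c * x * s y * f y) +
         (- s y * (c * x) * dI f y + dI (dI f) y * k y + (c * x * (k y * (c * x)) * f y + dI f y * (c * x * s y))) * (1 - y^2))
          (at y within {-1..1})"
        unfolding T_def
        by (rule DERIV_mult[OF dp DERIV_add[OF DERIV_mult[OF dk has_dI2[OF C2 y]]
              DERIV_mult[OF DERIV_cmult[OF ds] has_dI[OF C2 y]]]])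
      also have "(- 2 * y) * (k y * dI f y + c * x * s y * f y) +
         (- s y * (c * x) * dI f y + dI (dI f) y * k y + (c * x * (k y * (c * x)) * f y + dI f y * (c * x * s y))) * (1 - y^2)
         = (- 2 * y) * (k y * dI f y + c * x * s y * f y) + k y * ((1 - y^2) * dI (dI f) y) + c^2 * x^2 * k y * f y * (1 - y^2)"
        by (simp add: algebra_simps power2_eq_square)
      also have "\<dots> = T' y"
        unfolding o T'_def by (simp add: algebra_simps power2_eq_square)
      finally show ?thesis .
    qed
    have "(T' has_integral (T 1 - T (-1))) {-1..1}"
      by (rule fundamental_theorem_of_calculus)
         (auto simp: has_real_derivative_iff_has_vector_derivative[symmetric] intro!: dT)
    then have T0: "(T' has_integral 0) {-1..1}" by (simp add: T_def)
    have T1: "(T' has_integral ((x^2 - 1) * u2 x + ((c^2 * x^2 - X) * cos_transform c b f x + 2 * x * u1 x))) {-1..1}"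
    proof -
      have i: "(\<lambda>y. - k y * (c * y * (c * y * f y))) integrable_on {-1..1}" "(\<lambda>y. k y * f y) integrable_on {-1..1}"
        "(\<lambda>y. - s y * (c * y * f y)) integrable_on {-1..1}"
        unfolding k_def s_def by (auto intro!: integrable_continuous_interval continuous_intros cf(1))
      show ?thesis
        unfolding T'_def u2_def u1_def cos_transform_def k_def[symmetric] s_def[symmetric]
        by (intro has_integral_add has_integral_mult_right integrable_integral i)
    qed
    show ?thesis using has_integral_unique[OF T0 T1] by (simp add: algebra_simps)
  qed
  show ?thesis using d1 d2 ode unfolding prolate_line_def by blast
qed

lemma cos_transform_by_parts:
  fixes f f' h h' :: "real \<Rightarrow> real"
  assumes f: "\<And>y. y \<in> {-1..1} \<Longrightarrow> (f has_real_derivative f' y) (at y within {-1..1})"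
    and f': "continuous_on {-1..1} f'"
    and h: "\<And>s. (h has_real_derivative h' s) (at s)" and h': "continuous_on UNIV h'"
  shows "z * integral {-1..1} (\<lambda>y. h' (z * y + b) * f y) =
     h (z + b) * f 1 - h (- z + b) * f (-1) - integral {-1..1} (\<lambda>y. h (z * y + b) * f' y)"
proof -
  have cf: "continuous_on {-1..1} f" using f by (rule DERIV_continuous_on)
  have ch: "continuous_on UNIV h" by (rule DERIV_continuous_on[OF has_field_derivative_at_within[OF h]])
  have d: "((\<lambda>y. h (z * y + b) * f y) has_real_derivative
      z * (h' (z * y + b) * f y) + h (z * y + b) * f' y) (at y within {-1..1})" if "y \<in> {-1..1}" for y
  proof -
    have "((\<lambda>y. h (z * y + b)) has_real_derivative h' (z * y + b) * z) (at y within {-1..1})"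
      by (rule has_field_derivative_at_within, rule DERIV_chain2[OF h]) (auto intro!: derivative_eq_intros)
    from DERIV_mult[OF this f[OF that]] show ?thesis by (simp add: mult_ac)
  qed
  have "((\<lambda>y. z * (h' (z * y + b) * f y) + h (z * y + b) * f' y) has_integral
      (h (z * 1 + b) * f 1 - h (z * (-1) + b) * f (-1))) {-1..1}"
    by (rule fundamental_theorem_of_calculus)
       (auto simp: has_real_derivative_iff_has_vector_derivative[symmetric] intro!: d)
  then have "integral {-1..1} (\<lambda>y. z * (h' (z * y + b) * f y) + h (z * y + b) * f' y) =
      h (z + b) * f 1 - h (- z + b) * f (-1)" by (simp add: integral_unique)
  moreover have "(\<lambda>y. h' (z * y + b) * f y) integrable_on {-1..1}" "(\<lambda>y. h (z * y + b) * f' y) integrable_on {-1..1}"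
    by (auto intro!: integrable_continuous_interval continuous_intros cf f' continuous_on_compose2[OF ch]
        continuous_on_compose2[OF h'])
  ultimately show ?thesis
    by (simp add: Henstock_Kurzweil_Integration.integral_add integrable_on_mult_right)
qed

lemma cos_transform_asymptotics:
  assumes C2: "C2_I f" and c: "0 < c"
  shows "\<exists>K. \<forall>x>0. \<bar>c * x * cos_transform c b f x - (sin (c * x + b) * f 1 - sin (- (c * x) + b) * f (-1))\<bar> \<le> K / (c * x)"
proof -
  note cf = C2_I_continuous[OF C2]
  have "bounded (dI (dI f) ` {-1..1})"
    using continuous_dI2[OF C2] by (intro compact_imp_bounded compact_continuous_image) auto
  then obtain B where "\<forall>v\<in>dI (dI f) ` {-1..1}. norm v \<le> B" unfolding bounded_iff by blast
  then have B: "\<bar>dI (dI f) y\<bar> \<le> B" if "y \<in> {-1..1}" for y using that by simp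
  define K where "K = \<bar>dI f 1\<bar> + \<bar>dI f (-1)\<bar> + 2 * B"
  have "\<bar>c * x * cos_transform c b f x - (sin (c * x + b) * f 1 - sin (- (c * x) + b) * f (-1))\<bar> \<le> K / (c * x)"
    if x: "x > 0" for x
  proof -
    define z where "z = c * x"
    have z: "z > 0" using c x by (simp add: z_def)
    have e1: "z * cos_transform c b f x = sin (z + b) * f 1 - sin (- z + b) * f (-1)
        - integral {-1..1} (\<lambda>y. sin (z * y + b) * dI f y)"
      unfolding cos_transform_def z_def[symmetric]
      by (rule cos_transform_by_parts[OF has_dI[OF C2] cf(2)]) (auto intro!: derivative_eq_intros continuous_intros)
    have e2: "z * integral {-1..1} (\<lambda>y. sin (z * y + b) * dI f y) = - cos (z + b) * dI f 1 - (- cos (- z + b)) * dI f (-1)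
        - integral {-1..1} (\<lambda>y. - cos (z * y + b) * dI (dI f) y)"
      by (rule cos_transform_by_parts[OF has_dI2[OF C2] continuous_dI2[OF C2]])
         (auto intro!: derivative_eq_intros continuous_intros)
    have ib: "norm (integral {-1..1} (\<lambda>y. - cos (z * y + b) * dI (dI f) y)) \<le> B * (1 - (-1))"
    proof (rule integral_bound)
      fix y :: real assume "y \<in> {-1..1}"
      then show "norm (- cos (z * y + b) * dI (dI f) y) \<le> B"
        using B[of y] mult_mono[of "\<bar>cos (z * y + b)\<bar>" 1 "\<bar>dI (dI f) y\<bar>" B] by (simp add: abs_mult)
    qed (auto intro!: continuous_intros continuous_dI2[OF C2])
    have "\<bar>integral {-1..1} (\<lambda>y. - cos (z * y + b) * dI (dI f) y)\<bar> \<le> 2 * B" using ib by simp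
    moreover have "\<bar>- cos (z + b) * dI f 1\<bar> \<le> \<bar>dI f 1\<bar>" "\<bar>- cos (- z + b) * dI f (-1)\<bar> \<le> \<bar>dI f (-1)\<bar>"
      by (simp_all add: abs_mult mult_left_le_one_le)
    ultimately have "\<bar>z * integral {-1..1} (\<lambda>y. sin (z * y + b) * dI f y)\<bar> \<le> K"
      unfolding e2 K_def by linarith
    then have "\<bar>integral {-1..1} (\<lambda>y. sin (z * y + b) * dI f y)\<bar> \<le> K / z"
      using z by (simp add: abs_mult field_simps)
    then show ?thesis using e1 unfolding z_def[symmetric] by simp
  qed
  then show ?thesis by blast
qed

text \<open>
  Along a sequence \<open>x k\<close> with \<open>c x k = \<theta> + 2 \<pi> k\<close> the
  leading boundary term of \<open>c x\<close> times the transform is constant, and the growth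
  bound passes to the limit.
\<close>

lemma boundary_value_bound:
  assumes C2: "C2_I f" and c: "0 < c" and G: "0 \<le> G"
    and growth: "\<And>x. x0 \<le> x \<Longrightarrow> (x^2 - 1) * (cos_transform c b f x)^2 \<le> G^2 * (cos_transform c b f 1)^2"
  shows "\<bar>sin (\<theta> + b) * f 1 - sin (- \<theta> + b) * f (-1)\<bar> \<le> c * G * \<bar>cos_transform c b f 1\<bar>"
proof -
  define x where "x k = (\<theta> + 2 * pi * real k) / c" for k :: nat
  define a where "a k = c * x k * cos_transform c b f (x k)" for k
  define S where "S = sin (\<theta> + b) * f 1 - sin (- \<theta> + b) * f (-1)"
  obtain K where K: "\<And>y. y > 0 \<Longrightarrow> \<bar>c * y * cos_transform c b f y - (sin (c * y + b) * f 1 - sin (- (c * y) + b) * f (-1))\<bar> \<le> K / (c * y)"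
    using cos_transform_asymptotics[OF C2 c] by blast
  have xlim: "filterlim x at_top sequentially"
    unfolding x_def using c by real_asymp
  have per: "sin (c * x k + b) = sin (\<theta> + b)" "sin (- (c * x k) + b) = sin (- \<theta> + b)" for k
  proof -
    have cx: "c * x k = \<theta> + 2 * pi * real k" using c by (simp add: x_def)
    have e: "c * x k + b = (\<theta> + b) + 2 * real k * pi" "- (c * x k) + b = (- \<theta> + b) - 2 * real k * pi"
      unfolding cx by simp_all
    show "sin (c * x k + b) = sin (\<theta> + b)" unfolding e using sin_2npi[of k] cos_2npi[of k] by (subst sin_add) simp
    show "sin (- (c * x k) + b) = sin (- \<theta> + b)" unfolding e using sin_2npi[of k] cos_2npi[of k] by (subst sin_diff) simp
  qed
  have inv0: "(\<lambda>k. 1 / x k) \<longlonglongrightarrow> 0" using tendsto_inverse_0_at_top[OF xlim] by (simp add: inverse_eq_divide)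
  have "a \<longlonglongrightarrow> S"
  proof (rule LIM_zero_cancel, rule Lim_null_comparison)
    have "\<forall>\<^sub>F k in sequentially. x k > 0" using xlim by (auto simp: filterlim_at_top_dense)
    then show "\<forall>\<^sub>F k in sequentially. norm (a k - S) \<le> K / c * (1 / x k)"
    proof eventually_elim
      case (elim k)
      then show ?case using K[OF elim] unfolding a_def S_def per by simp
    qed
    show "(\<lambda>k. K / c * (1 / x k)) \<longlonglongrightarrow> 0" using tendsto_mult_left[OF inv0, of "K / c"] by simp
  qed
  have l1: "(\<lambda>k. (a k)^2) \<longlonglongrightarrow> S^2" using \<open>a \<longlonglongrightarrow> S\<close> by (rule tendsto_power)
  have l2: "(\<lambda>k. c^2 * (G^2 * (cos_transform c b f 1)^2) + (a k)^2 * (1 / x k)^2) \<longlonglongrightarrow>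
      c^2 * (G^2 * (cos_transform c b f 1)^2) + S^2 * 0^2"
    by (intro tendsto_intros l1 inv0)
  have "\<forall>\<^sub>F k in sequentially. x k \<ge> max x0 1" using xlim unfolding filterlim_at_top by blast
  then have "\<forall>\<^sub>F k in sequentially. (a k)^2 \<le> c^2 * (G^2 * (cos_transform c b f 1)^2) + (a k)^2 * (1 / x k)^2"
  proof eventually_elim
    case (elim k)
    have "(a k)^2 = c^2 * (((x k)^2 - 1) * (cos_transform c b f (x k))^2) + (a k)^2 * (1 / x k)^2"
      using elim by (simp add: a_def power_mult_distrib power_divide field_simps)
    moreover have "c^2 * (((x k)^2 - 1) * (cos_transform c b f (x k))^2) \<le> c^2 * (G^2 * (cos_transform c b f 1)^2)"
      using growth[of "x k"] elim by (intro mult_left_mono) auto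
    ultimately show ?case by linarith
  qed
  then have "S^2 \<le> c^2 * (G^2 * (cos_transform c b f 1)^2) + S^2 * 0^2"
    using tendsto_le[OF _ l2 l1] by simp
  also have "\<dots> = (c * G * \<bar>cos_transform c b f 1\<bar>)^2" by (simp add: power_mult_distrib)
  finally have "\<bar>S\<bar> \<le> c * G * \<bar>cos_transform c b f 1\<bar>"
    using c G by (intro power2_le_iff_abs_le[THEN iffD1]) auto
  then show ?thesis by (simp add: S_def)
qed

lemma pswf_fourier_eigen:
  assumes "pswf_system c \<psi> \<mu> chi" "x \<in> {-1..1}"
  shows "fourier_op c (\<lambda>y. of_real (\<psi> j y)) x = \<mu> j * of_real (\<psi> j x)"
  using assms unfolding pswf_system_def by blast

text \<open>
  The growth bound is applied to the real and to the imaginary part of the Fourier transform of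
  \<open>\<psi> n\<close>, with the phases for which the boundary terms are \<open>f(1) +
  f(-1)\<close> and \<open>f(-1) - f(1)\<close>. Together they bound \<open>f(1)\<close>, which
  is nonzero by uniqueness at the singular end point, by \<open>c G cmod \<mu>\<close> times
  itself.
\<close>

lemma eigenvalue_lower_bound:
  assumes sys: "pswf_system c \<psi> \<mu> chi" and c: "0 < c" and G: "0 \<le> G"
    and growth: "\<And>u u1 u2 x. prolate_line c (chi n) u u1 u2 \<Longrightarrow> x0 \<le> x \<Longrightarrow>
       (x^2 - 1) * (u x)^2 \<le> G^2 * (u 1)^2"
  shows "1 \<le> c * G * cmod (\<mu> n)"
proof -
  define f where "f = \<psi> n"
  have sol: "prolate_sol c (chi n) f" unfolding f_def by (rule pswf_prolate_sol[OF sys])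
  then have C2: "C2_I f" by (simp add: prolate_sol_def)
  have f1: "f 1 \<noteq> 0"
  proof
    assume "f 1 = 0"
    then have z: "f x = 0" if "x \<in> {-1..1}" for x
      using prolate_sol_unique[OF sol, of 1 x] that by simp
    have "pairing f (\<lambda>x. of_real (f x)) = (\<integral>x. 0 \<partial>leb_I)"
      unfolding pairing_def by (rule Bochner_Integration.integral_cong) (auto simp: z)
    moreover have "pairing f (\<lambda>x. of_real (f x)) = 1"
      using sys unfolding f_def pswf_system_def orthonormal_basis_I_def by simp
    ultimately show False by simp
  qed
  define F where "F = (\<lambda>y. exp (\<i> * of_real (c * 1 * y)) * of_real (f y))"
  have F: "F y = cis (c * 1 * y) * of_real (f y)" for y unfolding F_def cis_conv_exp ..
  have cF: "continuous_on {-1..1} F"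
    unfolding F_def by (intro continuous_intros C2_I_continuous[OF C2])
  have iF: "integrable leb_I F" by (rule continuous_imp_integrable_real[OF cF])
  have eig: "integral\<^sup>L leb_I F = \<mu> n * of_real (f 1)"
    using pswf_fourier_eigen[OF sys, of 1 n] unfolding fourier_op_def F_def f_def by simp
  have "cos_transform c 0 f 1 = (\<integral>y. Re (F y) \<partial>leb_I)"
    unfolding cos_transform_def F
    by (subst lebesgue_integral_eq_integral)
       (auto intro!: continuous_imp_integrable_real continuous_intros C2_I_continuous[OF C2])
  also have "\<dots> = Re (\<mu> n * of_real (f 1))" using integral_Re[OF iF] eig by simp
  finally have u0: "\<bar>cos_transform c 0 f 1\<bar> \<le> cmod (\<mu> n) * \<bar>f 1\<bar>"
    using abs_Re_le_cmod[of "\<mu> n * of_real (f 1)"] by (simp add: norm_mult)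
  have "cos_transform c (- (pi / 2)) f 1 = (\<integral>y. Im (F y) \<partial>leb_I)"
    unfolding cos_transform_def F
    by (subst lebesgue_integral_eq_integral)
       (auto intro!: continuous_imp_integrable_real continuous_intros C2_I_continuous[OF C2] simp: cos_diff)
  also have "\<dots> = Im (\<mu> n * of_real (f 1))" using integral_Im[OF iF] eig by simp
  finally have u1: "\<bar>cos_transform c (- (pi / 2)) f 1\<bar> \<le> cmod (\<mu> n) * \<bar>f 1\<bar>"
    using abs_Im_le_cmod[of "\<mu> n * of_real (f 1)"] by (simp add: norm_mult)
  have gr: "(x^2 - 1) * (cos_transform c b f x)^2 \<le> G^2 * (cos_transform c b f 1)^2" if "x0 \<le> x" for b x
  proof -
    obtain u1 u2 where "prolate_line c (chi n) (cos_transform c b f) u1 u2"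
      using cos_transform_prolate_line[OF sol, of b] by auto
    from growth[OF this that] show ?thesis .
  qed
  \<comment> \<open>Phase \<open>\<theta> = \<pi> / 2\<close> for the real part, \<open>\<theta> = 0\<close> for the imaginary part.\<close>
  have "\<bar>sin (pi/2 + 0) * f 1 - sin (- (pi/2) + 0) * f (-1)\<bar> \<le> c * G * \<bar>cos_transform c 0 f 1\<bar>"
    by (rule boundary_value_bound[OF C2 c G gr])
  also have "\<dots> \<le> c * G * (cmod (\<mu> n) * \<bar>f 1\<bar>)" using u0 c G by (intro mult_left_mono) auto
  finally have a: "\<bar>f 1 + f (-1)\<bar> \<le> c * G * (cmod (\<mu> n) * \<bar>f 1\<bar>)" by simp
  have "\<bar>sin (0 + - (pi/2)) * f 1 - sin (- 0 + - (pi/2)) * f (-1)\<bar> \<le> c * G * \<bar>cos_transform c (- (pi/2)) f 1\<bar>"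
    by (rule boundary_value_bound[OF C2 c G gr])
  also have "\<dots> \<le> c * G * (cmod (\<mu> n) * \<bar>f 1\<bar>)" using u1 c G by (intro mult_left_mono) auto
  finally have b: "\<bar>f (-1) - f 1\<bar> \<le> c * G * (cmod (\<mu> n) * \<bar>f 1\<bar>)" by simp
  have "\<bar>f 1\<bar> \<le> c * G * (cmod (\<mu> n) * \<bar>f 1\<bar>)" using a b by linarith
  then show ?thesis using f1 by (simp add: mult.assoc[symmetric])
qed

section \<open>Explicit lower bound for the Fourier eigenvalues\<close>

lemma e_ge_8_3: "8/3 \<le> exp (1::real)"
proof -
  have "inverse (2 ^ 32) \<le> (1/100::real)" by simp
  then show ?thesis using e_approx_32 by linarith
qed

lemma slack_constant: "3/2 \<le> pi^2 / (2 * exp 1)"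
proof -
  have "3^2 \<le> pi^2" using pi_gt3 by (intro power_mono) auto
  then have "3/2 * (2 * exp 1) \<le> pi^2" using exp_le by simp
  then show ?thesis by (simp add: pos_le_divide_eq)
qed

text \<open>
  The first inequality holds since \<open>x ln x \<ge> x - 1\<close>; inserting it into
  \<open>\<tau> = \<rho> / ln \<tau>\<close> gives the second.
\<close>

lemma tau_le:
  assumes "1 \<le> \<tau>" "\<tau> * ln \<tau> = (\<rho>::real)" "0 < \<rho>"
  shows "\<tau> \<le> 1 + \<rho>" "1 / \<tau> \<le> ln (1 + \<rho>) / \<rho>"
proof -
  show le: "\<tau> \<le> 1 + \<rho>"
  proof (rule ccontr)
    assume "\<not> \<tau> \<le> 1 + \<rho>"
    then have t: "1 + \<rho> < \<tau>" by simp
    have "1 - inverse \<tau> \<le> ln \<tau>" using ln_le_minus_one[of "inverse \<tau>"] assms by (simp add: ln_inverse)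
    then have "\<tau> * (1 - inverse \<tau>) \<le> \<tau> * ln \<tau>" using assms by (intro mult_left_mono) auto
    then have "\<tau> - 1 \<le> \<rho>" using assms by (simp add: right_diff_distrib)
    then show False using t by simp
  qed
  have "ln \<tau> \<le> ln (1 + \<rho>)" using le assms by simp
  then have "\<tau> * ln \<tau> \<le> \<tau> * ln (1 + \<rho>)" using assms by (intro mult_left_mono) auto
  then show "1 / \<tau> \<le> ln (1 + \<rho>) / \<rho>" using assms by (simp add: field_simps)
qed

text \<open>
  At \<open>a = N\<close> the main part \<open>a ln (4 a / c) - a\<close> equals \<open>N ln
  \<tau>\<close> exactly. Passing from \<open>N\<close> to \<open>m\<close> and from
  \<open>m\<close> to \<open>a\<close> costs logarithms and multiples of \<open>c\<^sup>2 /
  m\<close>, and \<open>c\<^sup>2 / m\<close> is at most \<open>(3/2) c / \<tau>\<close>.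
\<close>

lemma wkb_exponent_bound:
  fixes N m c \<tau> \<rho> :: real
  assumes c: "0 < c" and \<tau>: "1 \<le> \<tau>" and N: "N = \<tau> * (exp 1 * c / 4)" and m: "N + 5 \<le> m" "m \<le> N + 6"
    and a: "a = m + c ^ 4 / (32 * m ^ 3) + 3 / m"
  shows "a * ln (4 * a / c) - a + c^2 / (4 * a)
    \<le> N * ln \<tau> + 6 * ln \<tau> + 6 + 6 * ln (m / N) + ln (6 * m / c) + 3/2 * (c / \<tau>)"
proof -
  have e: "8/3 \<le> exp (1::real)" by (rule e_ge_8_3)
  have Nc: "2/3 * (\<tau> * c) \<le> N"
  proof -
    have "2/3 * (\<tau> * c) = \<tau> * (8/3 * c / 4)" by simp
    also have "\<dots> \<le> N" unfolding N using e c \<tau> by (intro mult_left_mono divide_right_mono mult_right_mono) auto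
    finally show ?thesis .
  qed
  have "c \<le> \<tau> * c" using c \<tau> by simp
  then have Nc1: "2/3 * c \<le> N" using Nc by linarith
  have N0: "N > 0" using Nc1 c by linarith
  have m5: "m > 5" "N < m" using m N0 by auto
  have cm: "c \<le> 3/2 * m" using Nc1 m5 by linarith
  define e1 e2 where "e1 = c ^ 4 / (32 * m ^ 3)" and "e2 = 3 / m"
  have a': "a = m + (e1 + e2)" by (simp add: a e1_def e2_def)
  have e10: "e1 \<ge> 0" "e2 \<ge> 0" using m5 c by (auto simp: e1_def e2_def)
  have am: "m \<le> a" "a > 0" using e10 m5 by (auto simp: a')
  have e1c: "e1 = c^2 / m * ((c / m) * (c / m)) / 32"
    by (simp add: e1_def power2_eq_square power3_eq_cube power4_eq_xxxx)
  have cm1: "c / m \<le> 3/2" using cm m5 by (simp add: field_simps)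
  have "c^2 / m \<le> 9/4 * m"
  proof -
    have "c^2 \<le> (3/2 * m)^2" using cm c by (intro power_mono) auto
    then show ?thesis using m5 by (simp add: field_simps power2_eq_square)
  qed
  then have "c^2 / m * ((c / m) * (c / m)) \<le> 9/4 * m * (3/2 * (3/2))"
    using cm1 c m5 by (intro mult_mono) auto
  then have "e1 \<le> 9/4 * m * (3/2 * (3/2)) / 32" unfolding e1c by (rule divide_right_mono) simp
  moreover have "e2 \<le> 3 / 25 * m" using m5 mult_mono[of 5 m 5 m] by (simp add: e2_def field_simps)
  ultimately have a54: "a \<le> 3/2 * m" using m5 unfolding a' by linarith
  have l5: "ln (4 * a / c) \<le> ln (6 * m / c)" using a54 am c m5 by (intro ln_mono) (auto simp: field_simps)
  have x1: "1 \<le> 6 * m / c" using cm c m5 by (simp add: field_simps)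
  have lpos: "0 \<le> ln (6 * m / c)" using x1 by simp
  have "ln a - ln m \<le> a / m - 1"
    using ln_le_minus_one[of "a / m"] am m5 by (simp add: ln_div)
  then have "m * (ln a - ln m) \<le> m * (a / m - 1)" using m5 by (intro mult_left_mono) auto
  then have h1: "m * (ln a - ln m) \<le> a - m" using m5 by (simp add: right_diff_distrib)
  have la: "ln (4 * a / c) = ln 4 + ln a - ln c" "ln (4 * m / c) = ln 4 + ln m - ln c"
    using am c m5 by (simp_all add: ln_div ln_mult)
  have "a * ln (4 * a / c) - a = m * ln (4 * m / c) - m + (m * (ln a - ln m) - (a - m)) + (a - m) * ln (4 * a / c)"
    unfolding la by (simp add: algebra_simps)
  also have "\<dots> \<le> m * ln (4 * m / c) - m + (e1 + e2) * ln (6 * m / c)"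
  proof -
    have "(a - m) * ln (4 * a / c) \<le> (a - m) * ln (6 * m / c)" using l5 am by (intro mult_left_mono) auto
    then show ?thesis using h1 unfolding a' by simp
  qed
  finally have s1: "a * ln (4 * a / c) - a \<le> m * ln (4 * m / c) - m + (e1 * ln (6 * m / c) + e2 * ln (6 * m / c))"
    by (simp add: distrib_right)
  \<comment> \<open>The correction \<open>e1\<close> is multiplied by a logarithm that may be large; \<open>ln y \<le> y\<close> turns one factor \<open>c / m\<close> of \<open>e1\<close> into the room for it.\<close>
  have s2: "e1 * ln (6 * m / c) \<le> 1/3 * (c^2 / m)"
  proof -
    have "ln (6 * m / c) \<le> 6 * m / c" using ln_le_minus_one[of "6 * m / c"] x1 by linarith
    then have "e1 * ln (6 * m / c) \<le> e1 * (6 * m / c)" using e10 by (intro mult_left_mono) auto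
    also have "\<dots> = c^2 / m * (6/32 * (c / m))"
      using c m5 by (simp add: e1_def power2_eq_square power3_eq_cube power4_eq_xxxx)
    also have "\<dots> \<le> c^2 / m * (1/3)"
    proof (rule mult_left_mono)
      show "6/32 * (c / m) \<le> 1/3" using cm1 by linarith
    qed (use m5 in simp)
    finally show ?thesis by simp
  qed
  have s3: "e2 * ln (6 * m / c) \<le> ln (6 * m / c)"
    using lpos m5 by (simp add: e2_def mult_left_le_one_le field_simps mult_right_mono)
  have s4: "c^2 / (4 * a) \<le> 1/4 * (c^2 / m)"
    using divide_left_mono[of "4 * m" "4 * a" "c^2"] am m5 by simp
  have s5: "c^2 / m \<le> 3/2 * (c / \<tau>)"
  proof -
    have "c^2 / m \<le> c^2 / N" using m5 N0 by (intro divide_left_mono) auto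
    also have "\<dots> \<le> c^2 / (2/3 * (\<tau> * c))" using Nc N0 c \<tau> by (intro divide_left_mono) auto
    also have "\<dots> = 3/2 * (c / \<tau>)" using c \<tau> by (simp add: field_simps power2_eq_square)
    finally show ?thesis .
  qed
  have "4 * m / c = \<tau> * exp 1 * (m / N)" unfolding N using c \<tau> by (simp add: field_simps)
  moreover have lny: "ln (\<tau> * exp 1 * y) = ln \<tau> + 1 + ln y" if "y > 0" for y
    using \<tau> that by (simp add: ln_mult)
  have "m / N > 0" using m5 N0 by simp
  from lny[OF this] have "ln (\<tau> * exp 1 * (m / N)) = ln \<tau> + 1 + ln (m / N)" .
  ultimately have "ln (4 * m / c) = ln \<tau> + 1 + ln (m / N)" by (simp only:)
  then have "m * ln (4 * m / c) - m = m * ln \<tau> + m * ln (m / N)" by (simp add: algebra_simps)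
  moreover have "m * ln \<tau> \<le> (N + 6) * ln \<tau>" using m \<tau> by (intro mult_right_mono) auto
  moreover have "m * ln (m / N) \<le> 6 + 6 * ln (m / N)"
  proof -
    have l0: "0 \<le> ln (m / N)" using m5 N0 by simp
    have "ln (m / N) \<le> m / N - 1" using m5 N0 by (intro ln_le_minus_one) simp
    then have "N * ln (m / N) \<le> N * (m / N - 1)" using N0 by (intro mult_left_mono) auto
    also have "\<dots> = m - N" using N0 by (simp add: right_diff_distrib)
    finally have "N * ln (m / N) \<le> 6" using m by linarith
    moreover have "(m - N) * ln (m / N) \<le> 6 * ln (m / N)" using l0 m by (intro mult_right_mono) auto
    ultimately show ?thesis by (simp add: left_diff_distrib)
  qed
  moreover have "0 \<le> c / \<tau>" using c \<tau> by simp
  ultimately show ?thesis using s1 s2 s3 s4 s5 unfolding distrib_right by linarith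
qed

definition eig_const :: real where
  "eig_const = 2 * 180^2 * (exp 6 * 9 ^ 6 * 36)"

lemma eig_const_ge: "3 * exp 4 \<le> eig_const"
proof -
  have "exp 4 \<le> exp (6::real)" by simp
  then have "3 * exp 4 \<le> 3 * exp (6::real)" by simp
  also have "\<dots> \<le> eig_const" by (simp add: eig_const_def)
  finally show ?thesis .
qed

text \<open>
  The number \<open>a = m + c\<^sup>4 / (32 m\<^sup>3) + 3 / m\<close> is chosen so that the
  linear terms of \<open>a\<^sup>2\<close> reproduce the upper bound for \<open>chi n -
  c\<^sup>2 / 2\<close>.
\<close>

lemma eigenvalue_bound_elliptic:
  assumes sys: "pswf_system c \<psi> \<mu> chi" and c: "0 < c" and \<tau>: "1 \<le> \<tau>" "\<tau> * ln \<tau> = \<rho>" "0 < \<rho>"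
    and N: "N = \<tau> * (exp 1 * c / 4)" and n: "N + 2 < real n" "real n \<le> N + 3"
    and D: "3/2 * c \<le> chi n - c^2"
  shows "1 \<le> eig_const * (1 + \<rho>) ^ 11 * (1 + c) ^ 15 / c ^ 10 * exp (3/2 * (c / \<tau>)) * exp (N * ln \<tau>) * cmod (\<mu> n)" (is "1 \<le> ?B * _")
proof -
  define m where "m = real n + 3"
  have m: "N + 5 \<le> m" "m \<le> N + 6" using n by (auto simp: m_def)
  have N0: "N > 0" unfolding N using c \<tau> by simp
  have tc: "c \<le> \<tau> * c" using c \<tau> by simp
  have Nc: "2/3 * c \<le> N"
  proof -
    have "2/3 * c = 1 * (8/3 * c / 4)" by simp
    also have "\<dots> \<le> N" unfolding N using e_ge_8_3 c \<tau> by (intro mult_mono divide_right_mono mult_right_mono) auto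
    finally show ?thesis .
  qed
  have cm: "c \<le> 3/2 * m" using Nc m by linarith
  have c2: "c^2 \<le> 9/4 * m^2"
    using power_mono[OF cm, of 2] c by (simp add: power_mult_distrib power2_eq_square)
  define X where "X = chi n"
  have X: "X \<le> m^2 + c^2 / 2 + c ^ 4 / (16 * m^2) + 6"
    unfolding X_def by (rule chi_upper_bound[OF sys m_def c2])
  have m5: "m > 5" using m N0 by linarith
  define a where "a = m + c ^ 4 / (32 * m ^ 3) + 3 / m"
  have a0: "a > 0" unfolding a_def using m5 c by (intro add_pos_nonneg) auto
  have a2: "X - c^2 / 2 \<le> a^2"
  proof -
    have "m^2 + 2 * m * y \<le> (m + y)^2" for y
      by (simp add: power2_sum)
    from this[of "c ^ 4 / (32 * m ^ 3) + 3 / m"]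
    have "m^2 + 2 * m * (c ^ 4 / (32 * m ^ 3) + 3 / m) \<le> a^2"
      unfolding a_def by (simp only: add.assoc)
    moreover have "2 * m * (c ^ 4 / (32 * m ^ 3) + 3 / m) = c ^ 4 / (16 * m^2) + 6"
      using m5 by (simp add: distrib_left power2_eq_square power3_eq_cube)
    ultimately show ?thesis using X by linarith
  qed
  define g where "g = exp (a * ln (4 * a / c) - a + c^2 / (4 * a))"
  define L where "L = (1 + X) * (1 + 1 / c)^2"
  have c2n: "c^2 \<ge> 0" by simp
  have Xpos: "X > 0" using D c c2n unfolding X_def by linarith
  have L0: "L \<ge> 0" using Xpos by (simp add: L_def)
  have "1 \<le> c * (2 * L^2 * g) * cmod (\<mu> n)"
  proof (rule eigenvalue_lower_bound[OF sys c])
    show "0 \<le> 2 * L^2 * g" by (simp add: g_def)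
    fix u u1 u2 x
    assume sol: "prolate_line c (chi n) u u1 u2" and x: "sqrt X / c \<le> x"
    show "(x^2 - 1) * (u x)^2 \<le> (2 * L^2 * g)^2 * (u 1)^2"
      using growth_elliptic[OF sol c a0 a2[unfolded X_def] D x[unfolded X_def]]
      by (simp add: g_def L_def X_def power_mult_distrib)
  qed
  also have "c * (2 * L^2 * g) * cmod (\<mu> n) \<le>
     ?B * cmod (\<mu> n)"
  proof (rule mult_right_mono)
    define r d where "r = 1 + \<rho>" and "d = 1 + c"
    have r1: "r \<ge> 1" "d \<ge> 1" "d > c" using \<tau> c by (auto simp: r_def d_def)
    have \<tau>r: "\<tau> \<le> r" unfolding r_def by (rule tau_le(1)[OF \<tau>])
    have "N \<le> r * c"
    proof -
      have "exp 1 * c / 4 \<le> c" using exp_le c by simp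
      then have "\<tau> * (exp 1 * c / 4) \<le> r * c" using \<tau>r r1 c by (intro mult_mono) auto
      then show ?thesis by (simp add: N)
    qed
    moreover have "6 * r * d = 6 * r + 6 * (r * c)" by (simp add: d_def algebra_simps)
    moreover have "r * c > 0" using r1 c by simp
    ultimately have mr: "m \<le> 6 * r * d" using m r1 by linarith
    have "1 + X \<le> 5 * m^2"
    proof -
      have "c ^ 4 / (16 * m^2) \<le> m^2"
      proof -
        have "(c^2)^2 \<le> (9/4 * m^2)^2" using c2 by (intro power_mono) auto
        also have "\<dots> = 81/16 * (m^2 * m^2)" by (simp add: power2_eq_square)
        also have "\<dots> \<le> 16 * (m^2 * m^2)" by (intro mult_right_mono) simp_all
        finally have "c ^ 4 \<le> m^2 * (16 * m^2)" by (simp add: power2_eq_square power4_eq_xxxx mult_ac)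
        then show ?thesis using m5 by (simp add: pos_divide_le_eq)
      qed
      moreover have "25 \<le> m^2" using power_mono[of 5 m 2] m5 by simp
      ultimately show ?thesis using X c2 by linarith
    qed
    also have "5 * m^2 \<le> 5 * (6 * r * d)^2" using mr m5 by (intro mult_left_mono power_mono) auto
    finally have X1: "1 + X \<le> 180 * (r^2 * d^2)" by (simp add: power_mult_distrib)
    have "1 + 1 / c = d / c" using c by (simp add: d_def field_simps)
    then have "L \<le> 180 * (r^2 * d^2) * (d / c)^2" unfolding L_def using X1 by (simp add: mult_right_mono)
    also have "\<dots> = 180 * (r^2 * (d ^ 4 / c^2))" by (simp add: power_divide power2_eq_square power4_eq_xxxx)
    finally have "L^2 \<le> (180 * (r^2 * (d ^ 4 / c^2)))^2" using L0 by (intro power_mono) auto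
    also have "\<dots> = 180^2 * (r ^ 4 * (d ^ 8 / c ^ 4))"
      by (simp add: power_mult_distrib power_divide power_mult[symmetric])
    finally have L2: "L^2 \<le> 180^2 * (r ^ 4 * (d ^ 8 / c ^ 4))" .
    have mN: "m / N \<le> 9 * (d / c)"
    proof -
      have "m / N \<le> (N + 6) / N" using m N0 by (intro divide_right_mono) auto
      also have "\<dots> = 1 + 6 / N" using N0 by (simp add: add_divide_distrib)
      also have "6 / N \<le> 6 / (2/3 * c)" using Nc N0 c by (intro divide_left_mono) auto
      also have "1 + 6 / (2/3 * c) \<le> 9 * (d / c)" using c by (simp add: d_def field_simps)
      finally show ?thesis by simp
    qed
    have "6 * m / c \<le> 6 * (6 * r * d) / c"
      using c by (intro divide_right_mono mult_left_mono mr) simp_all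
    then have mc: "6 * m / c \<le> 36 * (r * (d / c))" by simp
    have "g \<le> exp (N * ln \<tau> + 6 * ln \<tau> + 6 + 6 * ln (m / N) + ln (6 * m / c) + 3/2 * (c / \<tau>))"
      unfolding g_def using wkb_exponent_bound[OF c \<tau>(1) N m a_def] by (simp only: exp_le_cancel_iff)
    also have "\<dots> = exp (N * ln \<tau>) * (exp (ln \<tau>)) ^ 6 * exp 6 * (exp (ln (m / N))) ^ 6 * exp (ln (6 * m / c)) * exp (3/2 * (c / \<tau>))"
    proof -
      have "exp (6 * ln \<tau>) = (exp (ln \<tau>)) ^ 6" "exp (6 * ln (m / N)) = (exp (ln (m / N))) ^ 6"
        using exp_of_nat_mult[of 6 "ln \<tau>"] exp_of_nat_mult[of 6 "ln (m / N)"] by simp_all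
      then show ?thesis by (simp only: exp_add)
    qed
    also have "\<dots> = exp (N * ln \<tau>) * \<tau> ^ 6 * exp 6 * (m / N) ^ 6 * (6 * m / c) * exp (3/2 * (c / \<tau>))"
    proof -
      have "exp (ln \<tau>) = \<tau>" "exp (ln (m / N)) = m / N" "exp (ln (6 * m / c)) = 6 * m / c"
        using \<tau> m5 N0 c by simp_all
      then show ?thesis by (simp only:)
    qed
    also have "\<dots> \<le> exp (N * ln \<tau>) * r ^ 6 * exp 6 * (9 * (d / c)) ^ 6 * (36 * (r * (d / c))) * exp (3/2 * (c / \<tau>))"
      using \<tau> \<tau>r mN mc m5 N0 c r1 by (intro mult_mono power_mono) auto
    finally have g: "g \<le> exp (N * ln \<tau>) * r ^ 6 * exp 6 * (9 * (d / c)) ^ 6 * (36 * (r * (d / c))) * exp (3/2 * (c / \<tau>))" .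
    have "c * (2 * L^2 * g) \<le> c * (2 * (180^2 * (r ^ 4 * (d ^ 8 / c ^ 4))) *
       (exp (N * ln \<tau>) * r ^ 6 * exp 6 * (9 * (d / c)) ^ 6 * (36 * (r * (d / c))) * exp (3/2 * (c / \<tau>))))"
      using L2 g c r1 by (intro mult_left_mono mult_mono) (auto simp: g_def)
    also have "\<dots> = eig_const * r ^ 11 * d ^ 15 / c ^ 10 * exp (3/2 * (c / \<tau>)) * exp (N * ln \<tau>)"
    proof -
      have e1: "c * (d ^ 8 / c ^ 4) * (d / c) ^ 6 * (d / c) = d ^ 15 / c ^ 10"
        using c by (simp add: power_divide field_simps flip: power_add power_Suc)
      have e2: "r ^ 4 * r ^ 6 * r = r ^ 11" by (simp flip: power_add power_Suc2)
      have "c * (2 * (180^2 * (r ^ 4 * (d ^ 8 / c ^ 4))) *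
         (exp (N * ln \<tau>) * r ^ 6 * exp 6 * (9 * (d / c)) ^ 6 * (36 * (r * (d / c))) * exp (3/2 * (c / \<tau>))))
         = 2 * 180^2 * (exp 6 * 9 ^ 6 * 36) * (r ^ 4 * r ^ 6 * r) * (c * (d ^ 8 / c ^ 4) * (d / c) ^ 6 * (d / c))
           * exp (3/2 * (c / \<tau>)) * exp (N * ln \<tau>)"
        unfolding power_mult_distrib by (simp only: mult_ac)
      then show ?thesis unfolding e1 e2 eig_const_def by simp
    qed
    finally show "c * (2 * L^2 * g) \<le> ?B"
      by (simp only: r_def d_def)
  qed simp
  finally show ?thesis .
qed

text \<open>
  The lower bound for \<open>chi n\<close> forces \<open>n < c + 3/4\<close>, hence
  \<open>\<tau> \<le> 3/2\<close> and \<open>c \<le> (3/2) c / \<tau>\<close>: the factor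
  \<open>exp c\<close> of \<open>growth_near_critical\<close> fits into the available
  exponential.
\<close>

lemma eigenvalue_bound_near_critical:
  assumes sys: "pswf_system c \<psi> \<mu> chi" and c: "0 < c" and \<tau>: "1 \<le> \<tau>" "\<tau> * ln \<tau> = \<rho>" "0 < \<rho>"
    and N: "N = \<tau> * (exp 1 * c / 4)" and n: "N + 2 < real n"
    and D: "chi n - c^2 < 3/2 * c"
  shows "1 \<le> eig_const * (1 + \<rho>) ^ 11 * (1 + c) ^ 15 / c ^ 10 * exp (3/2 * (c / \<tau>)) * exp (N * ln \<tau>) * cmod (\<mu> n)" (is "1 \<le> ?B * _")
proof -
  have N0: "N > 0" unfolding N using c \<tau> by simp
  have Nc: "2/3 * (\<tau> * c) \<le> N"
  proof -
    have "2/3 * (\<tau> * c) = \<tau> * (8/3 * c / 4)" by simp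
    also have "\<dots> \<le> N" unfolding N using e_ge_8_3 c \<tau> by (intro mult_left_mono divide_right_mono mult_right_mono) auto
    finally show ?thesis .
  qed
  have tc: "c \<le> \<tau> * c" using c \<tau> by simp
  have "real n * real n \<le> real n * (real n + 1)" by (intro mult_left_mono) auto
  then have n2: "(real n)^2 \<le> chi n" using chi_lower_bound[OF sys, of n] by (simp add: power2_eq_square)
  have "(c + 3/4)^2 = c^2 + 3/2 * c + 9/16" by (simp add: power2_eq_square algebra_simps)
  then have "(real n)^2 < (c + 3/4)^2" using n2 D by linarith
  from power2_less_imp_less[OF this] have nc: "real n < c + 3/4" using c by simp
  then have c1: "c \<ge> 1" "N \<le> c" using n N0 by auto
  have \<tau>2: "\<tau> \<le> 3/2"
  proof -
    have "\<tau> * c \<le> 3/2 * c" using Nc c1 by linarith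
    then show ?thesis using c by (simp only: mult_le_cancel_right_pos)
  qed
  have "2/3 * c \<le> real n" using n Nc tc by linarith
  then have "(2/3 * c)^2 \<le> (real n)^2" using c by (intro power_mono) auto
  then have D0: "- (5 / 9) * c^2 \<le> chi n - c^2" using n2 by (simp add: power_mult_distrib power2_eq_square)
  have "1 \<le> c * (3 * exp (c + 4)) * cmod (\<mu> n)"
  proof (rule eigenvalue_lower_bound[OF sys c])
    fix u u1 u2 x
    assume "prolate_line c (chi n) u u1 u2" and x: "5/4 \<le> (x::real)"
    from growth_near_critical[OF this(1) c1(1) D0 less_imp_le[OF D] x]
    have "(x^2 - 1) * (u x)^2 \<le> 9 * exp (2 * (c + 4)) * (u 1)^2" by simp
    then show "(x^2 - 1) * (u x)^2 \<le> (3 * exp (c + 4))^2 * (u 1)^2"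
      unfolding exp_double by (simp add: power_mult_distrib)
  qed simp
  also have "\<dots> \<le> ?B * cmod (\<mu> n)"
  proof (rule mult_right_mono)
    have "c * \<tau> \<le> c * (3/2)" using \<tau>2 c by (intro mult_left_mono) auto
    then have "c \<le> 3/2 * (c / \<tau>)" using \<tau> by (simp add: field_simps)
    then have ec: "exp c \<le> exp (3/2 * (c / \<tau>))" by simp
    have eN: "1 \<le> exp (N * ln \<tau>)" using N0 \<tau> by simp
    have "c ^ 11 \<le> (1 + c) ^ 11" using c by (intro power_mono) auto
    also have "\<dots> \<le> (1 + c) ^ 15" using c by (intro power_increasing) auto
    finally have "c ^ 10 * c \<le> (1 + c) ^ 15" by (simp add: power_Suc2[symmetric])
    then have cc: "c \<le> (1 + c) ^ 15 / c ^ 10" using c by (simp add: pos_le_divide_eq mult.commute)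
    have r1: "1 \<le> (1 + \<rho>) ^ 11" using \<tau> by (intro one_le_power) auto
    have k0: "0 \<le> eig_const" using eig_const_ge exp_gt_zero[of "4::real"] by linarith
    have "c * (3 * exp (c + 4)) = (3 * exp 4) * 1 * c * exp c * 1" by (simp add: exp_add)
    also have "\<dots> \<le> eig_const * (1 + \<rho>) ^ 11 * ((1 + c) ^ 15 / c ^ 10) * exp (3/2 * (c / \<tau>)) * exp (N * ln \<tau>)"
      using eig_const_ge r1 cc ec eN c k0 \<tau> by (intro mult_mono) auto
    finally show "c * (3 * exp (c + 4)) \<le> ?B"
      by simp
  qed simp
  finally show ?thesis .
qed

section \<open>The reconstruction error\<close>

lemma tau_equation_unique:
  assumes "(0::real) < \<rho>"
  shows "\<exists>!\<tau>. 1 \<le> \<tau> \<and> \<tau> * ln \<tau> = \<rho>"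
proof -
  have mono: "x * ln x < y * ln y" if "1 \<le> x" "x < y" for x y :: real
  proof -
    have "x * ln x \<le> x * ln y" using that by (intro mult_left_mono) auto
    also have "\<dots> < y * ln y" using that by (intro mult_strict_right_mono) auto
    finally show ?thesis .
  qed
  have "\<rho> \<le> (1 + \<rho>) * ln (1 + \<rho>)"
  proof -
    have "1 - inverse (1 + \<rho>) \<le> ln (1 + \<rho>)"
      using ln_le_minus_one[of "inverse (1 + \<rho>)"] assms by (simp add: ln_inverse)
    then have "(1 + \<rho>) * (1 - inverse (1 + \<rho>)) \<le> (1 + \<rho>) * ln (1 + \<rho>)"
      using assms by (intro mult_left_mono) auto
    then show ?thesis using assms by (simp add: right_diff_distrib)
  qed
  then have "\<exists>\<tau>. 1 \<le> \<tau> \<and> \<tau> \<le> 1 + \<rho> \<and> \<tau> * ln \<tau> = \<rho>"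
    using assms by (intro IVT') (auto intro!: continuous_intros)
  then obtain \<tau> where \<tau>: "1 \<le> \<tau>" "\<tau> * ln \<tau> = \<rho>" by blast
  show ?thesis
  proof (intro ex1I[of _ \<tau>] conjI \<tau>)
    fix t assume "1 \<le> t \<and> t * ln t = \<rho>"
    then show "t = \<tau>" using mono[of t \<tau>] mono[of \<tau> t] \<tau> by (cases t \<tau> rule: linorder_cases) auto
  qed
qed

lemma mu_pos: "pswf_system c \<psi> \<mu> chi \<Longrightarrow> 0 < cmod (\<mu> j)"
  unfolding pswf_system_def by (meson order_less_trans)

lemma mu_antimono:
  assumes "pswf_system c \<psi> \<mu> chi" "i \<le> j"
  shows "cmod (\<mu> j) \<le> cmod (\<mu> i)"
proof (rule lift_Suc_antimono_le[of "\<lambda>k. cmod (\<mu> k)", OF _ assms(2)])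
  show "cmod (\<mu> (Suc k)) \<le> cmod (\<mu> k)" for k
    using assms(1) unfolding pswf_system_def by (meson less_imp_le)
qed

text \<open>
  Up to index \<open>n\<close> the coefficients of the error are those of the noise divided by
  \<open>\<mu>\<close>, above they are those of \<open>f\<close>. By Parseval the squares of the
  two parts add up.
\<close>

lemma truncation_error:
  assumes sys: "pswf_system c \<psi> \<mu> chi" and f: "f \<in> L2_I" and w: "w \<in> L2_I" and T: "0 \<le> T"
    and tail: "\<And>K. (\<Sum>j\<in>{n<..<K}. (cmod (pairing (\<psi> j) f))^2) \<le> T^2"
  shows "L2_norm (\<lambda>y. f y - truncated_inverse \<psi> \<mu> n w y)
    \<le> L2_norm (\<lambda>x. fourier_op c f x - w x) / cmod (\<mu> n) + T"
proof -
  have b: "orthonormal_basis_I \<psi>" using sys by (simp add: pswf_system_def)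
  define d where "d x = fourier_op c f x - w x" for x
  have dL: "d \<in> L2_I" unfolding d_def using L2_I_add_scaled[OF fourier_op_L2[OF f] w, of c "-1"] by simp
  define t where "t y = (\<Sum>j\<le>n. (pairing (\<psi> j) w / \<mu> j) * of_real (\<psi> j y))" for y
  have t: "truncated_inverse \<psi> \<mu> n w y = t y" for y
    unfolding truncated_inverse_def t_def by (intro sum.cong) auto
  have tL: "t \<in> L2_I" unfolding t_def by (rule L2_I_sum) (auto intro: basis_L2[OF b])
  define e where "e y = f y - t y" for y
  have eL: "e \<in> L2_I" unfolding e_def using L2_I_add_scaled[OF f tL, of "-1"] by simp
  have pt: "pairing (\<psi> k) t = (if k \<le> n then pairing (\<psi> k) w / \<mu> k else 0)" for k
  proof -
    have "pairing (\<psi> k) t = (\<Sum>j\<le>n. (pairing (\<psi> j) w / \<mu> j) * (if k = j then 1 else 0))"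
      unfolding t_def
      by (subst pairing_sum) (auto intro: basis_L2[OF b] simp: basis_orthonormal[OF b])
    also have "\<dots> = (\<Sum>j\<le>n. if k = j then pairing (\<psi> j) w / \<mu> j else 0)"
      by (intro sum.cong) auto
    finally show ?thesis by simp
  qed
  have pe: "pairing (\<psi> k) e = pairing (\<psi> k) f - pairing (\<psi> k) t" for k
    unfolding e_def using pairing_add_scaled[OF basis_L2[OF b] f tL, of k "-1"] by simp
  have pd: "pairing (\<psi> k) d = \<mu> k * pairing (\<psi> k) f - pairing (\<psi> k) w" for k
    unfolding d_def
    using pairing_add_scaled[OF basis_L2[OF b] fourier_op_L2[OF f] w, of k c "-1"] pairing_fourier_op[OF sys f, of k]
    by simp
  define E where "E = L2_norm d / cmod (\<mu> n)"
  have E0: "0 \<le> E" by (simp add: E_def L2_norm_nonneg)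
  have head: "(cmod (pairing (\<psi> k) e))^2 \<le> (cmod (pairing (\<psi> k) d))^2 / (cmod (\<mu> n))^2" if "k \<le> n" for k
  proof -
    have "\<mu> k \<noteq> 0" using mu_pos[OF sys, of k] by auto
    then have "pairing (\<psi> k) e = pairing (\<psi> k) d / \<mu> k"
      using that by (simp add: pe pt pd diff_divide_distrib)
    then have "(cmod (pairing (\<psi> k) e))^2 = (cmod (pairing (\<psi> k) d))^2 / (cmod (\<mu> k))^2"
      by (simp add: norm_divide power_divide)
    also have "\<dots> \<le> (cmod (pairing (\<psi> k) d))^2 / (cmod (\<mu> n))^2"
      using mu_antimono[OF sys that] mu_pos[OF sys, of n]
      by (intro divide_left_mono power_mono mult_pos_pos) auto
    finally show ?thesis .
  qed
  have "(\<Sum>k<K. (cmod (pairing (\<psi> k) e))^2) \<le> E^2 + T^2" for K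
  proof -
    have "(\<Sum>k<K. (cmod (pairing (\<psi> k) e))^2) \<le> (\<Sum>k\<in>{..n} \<union> {n<..<K}. (cmod (pairing (\<psi> k) e))^2)"
      by (rule sum_mono2) auto
    also have "\<dots> = (\<Sum>k\<le>n. (cmod (pairing (\<psi> k) e))^2) + (\<Sum>k\<in>{n<..<K}. (cmod (pairing (\<psi> k) e))^2)"
      by (rule sum.union_disjoint) auto
    also have "(\<Sum>k\<le>n. (cmod (pairing (\<psi> k) e))^2) \<le> (\<Sum>k\<le>n. (cmod (pairing (\<psi> k) d))^2 / (cmod (\<mu> n))^2)"
      by (intro sum_mono head) simp
    also have "\<dots> = (\<Sum>k\<le>n. (cmod (pairing (\<psi> k) d))^2) / (cmod (\<mu> n))^2"
      by (rule sum_divide_distrib[symmetric])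
    also have "\<dots> \<le> (L2_norm d)^2 / (cmod (\<mu> n))^2"
      by (intro divide_right_mono bessel[OF b dL]) auto
    also have "\<dots> = E^2" by (simp add: E_def power_divide)
    also have "(\<Sum>k\<in>{n<..<K}. (cmod (pairing (\<psi> k) e))^2) = (\<Sum>k\<in>{n<..<K}. (cmod (pairing (\<psi> k) f))^2)"
      by (intro sum.cong) (auto simp: pe pt)
    also have "\<dots> \<le> T^2" by (rule tail)
    finally show ?thesis by simp
  qed
  then have "(L2_norm e)^2 \<le> E^2 + T^2"
    using parseval[OF b eL] unfolding sums_def by (intro LIMSEQ_le_const2) auto
  also have "\<dots> \<le> (E + T)^2" using E0 T by (simp add: power2_sum)
  finally have "(L2_norm e)^2 \<le> (E + T)^2" .
  from power2_le_imp_le[OF this] have "L2_norm e \<le> E + T" using E0 T by simp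
  moreover have "(\<lambda>y. f y - truncated_inverse \<psi> \<mu> n w y) = e" by (rule ext) (simp only: e_def t)
  moreover have "(\<lambda>x. fourier_op c f x - w x) = d" by (rule ext) (simp only: d_def)
  ultimately show ?thesis by (simp only: E_def)
qed

text \<open>
  Above index \<open>n\<close> the weights \<open>chi j powr \<nu>\<close> are at least \<open>r
  powr (2 \<nu>)\<close>.
\<close>

lemma Htilde_tail:
  assumes sys: "pswf_system c \<psi> \<mu> chi" and f: "f \<in> Htilde \<psi> chi \<nu>" and \<nu>: "0 < \<nu>"
    and r: "0 < r" "r^2 \<le> chi (Suc n)"
  shows "(\<Sum>j\<in>{n<..<K}. (cmod (pairing (\<psi> j) f))^2) \<le> (Htilde_norm \<psi> chi \<nu> f * r powr (- \<nu>))^2"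
proof -
  define q where "q j = chi j powr \<nu> * (cmod (pairing (\<psi> j) f))^2" for j
  have q: "summable q" "\<And>j. 0 \<le> q j" using f by (auto simp: q_def[abs_def] Htilde_def)
  have H: "(Htilde_norm \<psi> chi \<nu> f)^2 = suminf q"
    unfolding Htilde_norm_def q_def[symmetric] using suminf_nonneg[OF q] by simp
  have "(cmod (pairing (\<psi> j) f))^2 \<le> (r powr (- \<nu>))^2 * q j" if "j \<in> {n<..<K}" for j
  proof -
    have "r^2 \<le> chi j"
      using r(2) strict_mono_less_eq[OF chi_strict_mono[OF sys], of "Suc n" j] that by auto
    then have "(r^2) powr \<nu> \<le> chi j powr \<nu>" using \<nu> r by (intro powr_mono2) auto
    then have "(r powr (- \<nu>))^2 * (r^2) powr \<nu> \<le> (r powr (- \<nu>))^2 * chi j powr \<nu>"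
      by (rule mult_left_mono) (rule zero_le_power2)
    moreover have "(r powr (- \<nu>))^2 * (r^2) powr \<nu> = 1"
    proof -
      have "(r^2) powr \<nu> = r powr \<nu> * r powr \<nu>" using r unfolding power2_eq_square by (intro powr_mult)
      moreover have "r powr (- \<nu>) * r powr \<nu> = 1" using r powr_add[of r "- \<nu>" \<nu>] by simp
      then have "(r powr (- \<nu>) * r powr \<nu>) * (r powr (- \<nu>) * r powr \<nu>) = 1" by simp
      ultimately show ?thesis by (simp only: power2_eq_square mult_ac)
    qed
    ultimately have "1 \<le> (r powr (- \<nu>))^2 * chi j powr \<nu>" by simp
    then have "1 * (cmod (pairing (\<psi> j) f))^2 \<le> ((r powr (- \<nu>))^2 * chi j powr \<nu>) * (cmod (pairing (\<psi> j) f))^2"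
      by (intro mult_right_mono) auto
    then show ?thesis by (simp add: q_def mult.assoc)
  qed
  then have "(\<Sum>j\<in>{n<..<K}. (cmod (pairing (\<psi> j) f))^2) \<le> (\<Sum>j\<in>{n<..<K}. (r powr (- \<nu>))^2 * q j)"
    by (intro sum_mono) auto
  also have "\<dots> = (r powr (- \<nu>))^2 * (\<Sum>j\<in>{n<..<K}. q j)" by (rule sum_distrib_left[symmetric])
  also have "\<dots> \<le> (r powr (- \<nu>))^2 * suminf q"
    using q by (intro mult_left_mono sum_le_suminf) auto
  finally show ?thesis unfolding H[symmetric] by (simp add: power_mult_distrib mult.commute)
qed

theorem theorem3p1:
  "\<exists>\<gamma>1>0. \<exists>\<gamma>2>0. \<exists>\<gamma>3>0. \<exists>\<gamma>4>0.
     \<forall>(\<psi> :: real \<Rightarrow> nat \<Rightarrow> real \<Rightarrow> real) (\<mu> :: real \<Rightarrow> nat \<Rightarrow> complex) (chi :: real \<Rightarrow> nat \<Rightarrow> real).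
       (\<forall>c>0. pswf_system c (\<psi> c) (\<mu> c) (chi c)) \<longrightarrow>
       (\<forall>c0>0. \<forall>\<nu>>0. \<forall>C. embedding_constant \<psi> chi c0 \<nu> C \<longrightarrow>
         (\<forall>c\<ge>c0. \<forall>\<alpha>\<in>{0<..<1}. \<forall>\<delta>\<in>{0<..<1}. \<forall>f\<in>L2_I. \<forall>w\<in>L2_I. \<forall>\<rho>.
            L2_norm (\<lambda>x. fourier_op c f x - w x) \<le> \<delta> \<longrightarrow>
            f \<in> sobolev \<nu> \<longrightarrow>
            \<rho> = 4 / (exp 1 * c) * \<alpha> * ln (inverse \<delta>) \<longrightarrow>
            L2_norm (\<lambda>y. f y - truncated_inverse (\<psi> c) (\<mu> c) (n_star c \<alpha> \<delta>) w y)
            \<le> \<gamma>1 * c powr (- \<gamma>2) * (1 + c) powr \<gamma>3 * (1 + \<rho>) powr \<gamma>4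
                * exp (pi\<^sup>2 * c * ln (1 + \<rho>) / (2 * exp 1 * \<rho>)) * \<delta> powr (1 - \<alpha>)
              + C * (1 + c\<^sup>2) powr (\<nu> / 2) * sobolev_norm \<nu> f
                * (2 + exp 1 * c / 4 * (\<rho> / ln (1 + \<rho>))) powr (- \<nu>)))"
proof (rule exI[of _ eig_const], intro conjI, goal_cases)
  case 1
  show ?case using eig_const_ge exp_gt_zero[of "4::real"] by linarith
next
  case 2
  show ?case
  \<comment> \<open>The exponents are those of \<open>1 / c\<close>, \<open>1 + c\<close> and \<open>1 + \<rho>\<close> in the lower bound for \<open>cmod (\<mu> n)\<close>.\<close>
  proof (rule exI[of _ 10], intro conjI, simp, rule exI[of _ 15], intro conjI, simp, rule exI[of _ 11],
      intro conjI allI impI ballI, simp)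
    fix \<psi> :: "real \<Rightarrow> nat \<Rightarrow> real \<Rightarrow> real" and \<mu> :: "real \<Rightarrow> nat \<Rightarrow> complex"
      and chi :: "real \<Rightarrow> nat \<Rightarrow> real" and c0 \<nu> C c \<alpha> \<delta> \<rho> :: real and f w :: "real \<Rightarrow> complex"
    assume all: "\<forall>c>0. pswf_system c (\<psi> c) (\<mu> c) (chi c)"
      and c0: "0 < c0" and \<nu>: "0 < \<nu>" and emb: "embedding_constant \<psi> chi c0 \<nu> C" and cc0: "c0 \<le> c"
      and \<alpha>: "\<alpha> \<in> {0<..<1}" and \<delta>: "\<delta> \<in> {0<..<1}" and f: "f \<in> L2_I" and w: "w \<in> L2_I"
      and noise: "L2_norm (\<lambda>x. fourier_op c f x - w x) \<le> \<delta>" and sob: "f \<in> sobolev \<nu>"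
      and \<rho>: "\<rho> = 4 / (exp 1 * c) * \<alpha> * ln (inverse \<delta>)"
    have c: "0 < c" using c0 cc0 by simp
    have sys: "pswf_system c (\<psi> c) (\<mu> c) (chi c)" using all c by blast
    have ld: "0 < ln (inverse \<delta>)" using \<delta> by (simp add: ln_inverse)
    have \<rho>0: "0 < \<rho>" unfolding \<rho> using c \<alpha> ld by simp
    define \<tau> where "\<tau> = tau c \<alpha> \<delta>"
    have "1 \<le> \<tau> \<and> \<tau> * ln \<tau> = \<rho>"
      unfolding \<tau>_def tau_def \<rho>[symmetric] by (rule theI'[OF tau_equation_unique[OF \<rho>0]])
    then have \<tau>: "1 \<le> \<tau>" "\<tau> * ln \<tau> = \<rho>" by auto
    define N where "N = \<tau> * (exp 1 * c / 4)"
    define n where "n = n_star c \<alpha> \<delta>"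
    have N0: "0 < N" unfolding N_def using c \<tau> by simp
    have n: "N + 2 < real n" "real n \<le> N + 3"
    proof -
      have "real n = of_int \<lfloor>3 + N\<rfloor>" using N0 by (simp add: n_def n_star_def N_def \<tau>_def)
      then show "N + 2 < real n" "real n \<le> N + 3" by linarith+
    qed
    have "1 \<le> eig_const * (1 + \<rho>) ^ 11 * (1 + c) ^ 15 / c ^ 10 * exp (3/2 * (c / \<tau>)) * exp (N * ln \<tau>) * cmod (\<mu> c n)"
    proof (cases "3/2 * c \<le> chi c n - c^2")
      case True
      then show ?thesis by (rule eigenvalue_bound_elliptic[OF sys c \<tau> \<rho>0 N_def n])
    next
      case False
      then show ?thesis by (intro eigenvalue_bound_near_critical[OF sys c \<tau> \<rho>0 N_def n(1)]) simp
    qed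
    then have inv: "1 / cmod (\<mu> c n) \<le> eig_const * (1 + \<rho>) ^ 11 * (1 + c) ^ 15 / c ^ 10 * exp (3/2 * (c / \<tau>)) * exp (N * ln \<tau>)"
      using mu_pos[OF sys, of n] by (simp add: pos_divide_le_eq)
    have slack: "exp (3/2 * (c / \<tau>)) \<le> exp (pi^2 * c * ln (1 + \<rho>) / (2 * exp 1 * \<rho>))"
    proof -
      have "3/2 * (c * (1 / \<tau>)) \<le> pi^2 / (2 * exp 1) * (c * (ln (1 + \<rho>) / \<rho>))"
        using slack_constant tau_le(2)[OF \<tau> \<rho>0] c \<tau> by (intro mult_mono mult_left_mono) auto
      then show ?thesis by simp
    qed
    \<comment> \<open>The definition of \<open>\<tau>\<close> makes the WKB factor equal to \<open>\<delta> powr (- \<alpha>)\<close>.\<close>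
    have "N * ln \<tau> = exp 1 * c / 4 * \<rho>" using \<tau> by (simp add: N_def mult_ac)
    also have "\<dots> = \<alpha> * ln (inverse \<delta>)" unfolding \<rho> using c by simp
    also have "\<dots> = - \<alpha> * ln \<delta>" using \<delta> by (simp add: ln_inverse)
    finally have "exp (N * ln \<tau>) = \<delta> powr (- \<alpha>)" using \<delta> by (simp add: powr_def)
    then have dd: "exp (N * ln \<tau>) * \<delta> = \<delta> powr (1 - \<alpha>)"
      using \<delta> powr_add[of \<delta> "- \<alpha>" 1] by simp
    have k0: "0 \<le> eig_const" by (simp add: eig_const_def)
    have "L2_norm (\<lambda>x. fourier_op c f x - w x) / cmod (\<mu> c n) \<le> 1 / cmod (\<mu> c n) * \<delta>"
      using noise mu_pos[OF sys, of n] by (simp add: divide_right_mono)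
    also have "\<dots> \<le> (eig_const * (1 + \<rho>) ^ 11 * (1 + c) ^ 15 / c ^ 10 * exp (3/2 * (c / \<tau>)) * exp (N * ln \<tau>)) * \<delta>"
      using inv \<delta> by (intro mult_right_mono) auto
    also have "\<dots> = eig_const * (1 + \<rho>) ^ 11 * (1 + c) ^ 15 / c ^ 10 * exp (3/2 * (c / \<tau>)) * \<delta> powr (1 - \<alpha>)"
      unfolding dd[symmetric] by simp
    also have "\<dots> \<le> eig_const * (1 + \<rho>) ^ 11 * (1 + c) ^ 15 / c ^ 10
        * exp (pi^2 * c * ln (1 + \<rho>) / (2 * exp 1 * \<rho>)) * \<delta> powr (1 - \<alpha>)"
      using slack k0 \<rho>0 c by (intro mult_right_mono mult_left_mono) auto
    also have "\<dots> = eig_const * c powr (- 10) * (1 + c) powr 15 * (1 + \<rho>) powr 11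
        * exp (pi^2 * c * ln (1 + \<rho>) / (2 * exp 1 * \<rho>)) * \<delta> powr (1 - \<alpha>)"
    proof -
      have "c powr (- 10) = 1 / c ^ 10" using c by (simp add: powr_minus_divide)
      moreover have "(1 + c) powr 15 = (1 + c) ^ 15" "(1 + \<rho>) powr 11 = (1 + \<rho>) ^ 11" using c \<rho>0 by simp_all
      ultimately show ?thesis by simp
    qed
    finally have first: "L2_norm (\<lambda>x. fourier_op c f x - w x) / cmod (\<mu> c n) \<le>
       eig_const * c powr (- 10) * (1 + c) powr 15 * (1 + \<rho>) powr 11
        * exp (pi^2 * c * ln (1 + \<rho>) / (2 * exp 1 * \<rho>)) * \<delta> powr (1 - \<alpha>)" .
    define r where "r = 2 + exp 1 * c / 4 * (\<rho> / ln (1 + \<rho>))"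
    have lpos: "0 < ln (1 + \<rho>)" using \<rho>0 by simp
    have r0: "0 < r" unfolding r_def using c \<rho>0 lpos by (intro add_pos_nonneg) auto
    have rn: "r \<le> real n"
    proof -
      have "\<rho> / ln (1 + \<rho>) \<le> \<tau>" using tau_le(2)[OF \<tau> \<rho>0] lpos \<rho>0 \<tau> by (simp add: field_simps)
      then have "exp 1 * c / 4 * (\<rho> / ln (1 + \<rho>)) \<le> exp 1 * c / 4 * \<tau>" using c by (intro mult_left_mono) auto
      also have "exp 1 * c / 4 * \<tau> = N" by (simp add: N_def mult.commute)
      finally show ?thesis using n unfolding r_def by linarith
    qed
    have "r^2 \<le> (real n)^2" using rn r0 by (intro power_mono) auto
    also have "\<dots> \<le> real (Suc n) * (real (Suc n) + 1)" by (simp add: power2_eq_square algebra_simps)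
    also have "\<dots> \<le> chi c (Suc n)" by (rule chi_lower_bound[OF sys])
    finally have r2: "r^2 \<le> chi c (Suc n)" .
    define H where "H = Htilde_norm (\<psi> c) (chi c) \<nu> f"
    have fH: "f \<in> Htilde (\<psi> c) (chi c) \<nu>" and HC: "H \<le> C * (1 + c^2) powr (\<nu> / 2) * sobolev_norm \<nu> f"
      using emb cc0 sob unfolding embedding_constant_def H_def by blast+
    have H0: "0 \<le> H"
      unfolding H_def Htilde_norm_def using fH by (auto simp: Htilde_def intro!: suminf_nonneg)
    have "L2_norm (\<lambda>y. f y - truncated_inverse (\<psi> c) (\<mu> c) n w y)
        \<le> L2_norm (\<lambda>x. fourier_op c f x - w x) / cmod (\<mu> c n) + H * r powr (- \<nu>)"
      by (rule truncation_error[OF sys f w]) (use H0 Htilde_tail[OF sys fH \<nu> r0 r2] in \<open>auto simp: H_def\<close>)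
    also have "H * r powr (- \<nu>) \<le> C * (1 + c^2) powr (\<nu> / 2) * sobolev_norm \<nu> f * r powr (- \<nu>)"
      using HC by (intro mult_right_mono) auto
    finally show "L2_norm (\<lambda>y. f y - truncated_inverse (\<psi> c) (\<mu> c) (n_star c \<alpha> \<delta>) w y)
            \<le> eig_const * c powr (- 10) * (1 + c) powr 15 * (1 + \<rho>) powr 11
                * exp (pi^2 * c * ln (1 + \<rho>) / (2 * exp 1 * \<rho>)) * \<delta> powr (1 - \<alpha>)
              + C * (1 + c^2) powr (\<nu> / 2) * sobolev_norm \<nu> f
                * (2 + exp 1 * c / 4 * (\<rho> / ln (1 + \<rho>))) powr (- \<nu>)"
      using first unfolding n_def r_def by linarith
  qed
qed

end
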